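(* Let $p$ be a prime different from $\operatorname{char}(\Bbbk)$, $\mathbf{t}\in\mathbb{I}_X$ an idele, and $G$ a cyclic subgroup of order $p$ of $\mathbb{G}(\mathbf{t})$. The following are equivalent: (1) $\mathbb{A}_X\{\mathbf{t}^{1/p}\}$ is a $G$-Galois ring extension of $\mathbb{A}_X$. (2) $\mathbb{A}_X\{\mathbf{t}^{1/p}\}^G=\mathbb{A}_X$. (3) There is some $g\in G$ whose components $(g_x)_x\in\prod_x\mathbb{G}_x(\mathbf{t})$ all have order $p$. (Such elements are then precisely the generators of $G$.) (4) At each closed point $x\in X$, the projection of $G$ onto the $x$-component is a transitive subgroup of $\mathbb{G}_x(\mathbf{t})$, the latter being considered as a permutation group on $\{1,2,\dots,p\}$.
   Context: $\Bbbk$ is an algebraically closed field and $X$ is a projective, irreducible, non-singular curve over $\Bbbk$. "$x\in X$" means a closed point. $A_x$ is the completion of the local ring at $x$, $K_x$ its fraction field, $\upsilon_x$ the valuation on $K_x$. $\mathbb{A}_X=\{(\alpha_x)_x\in\prod_{x}K_x : \alpha_x\in A_x \text{ for all but finitely many } x\}$, $\mathbb{I}_X=\mathbb{A}_X^*$. For $\mathbf{t}=(t_x)\in\mathbb{I}_X$, put $\mathbb{A}_X\{\mathbf{t}^{1/p}\}=\mathbb{A}_X[T]/(T^p-\mathbf{t})$, $K_x\{t_x^{1/p}\}=K_x[T]/(T^p-t_x)$, $\operatorname{Ram}(\mathbf{t})=\{x:\upsilon_x(t_x)\not\equiv0\bmod p\}$ (a finite set), $\mathbb{G}(\mathbf{t})=\operatorname{Aut}_{\mathbb{A}_X\text{-alg}}\mathbb{A}_X\{\mathbf{t}^{1/p}\}$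 and $\mathbb{G}_x(\mathbf{t})=\operatorname{Aut}_{K_x\text{-alg}}K_x\{t_x^{1/p}\}$. Facts fixing notation: every $g\in\mathbb{G}(\mathbf{t})$ acts componentwise through $g_x\in\mathbb{G}_x(\mathbf{t})$, and this gives $\mathbb{G}(\mathbf{t})=\prod_x\mathbb{G}_x(\mathbf{t})$. If $x\notin\operatorname{Ram}(\mathbf{t})$, then $K_x\{t_x^{1/p}\}\simeq\prod^pK_x$ and $\mathbb{G}_x(\mathbf{t})\simeq\mathcal{S}_p$ (symmetric group permuting the $p$ factors). If $x\in\operatorname{Ram}(\mathbf{t})$, then $K_x\{t_x^{1/p}\}$ is a cyclic field extension of $K_x$ of degree $p$ and $\mathbb{G}_x(\mathbf{t})\simeq\mathcal{C}_p$ is its Galois group, viewed as the group generated by a $p$-cycle in $\mathcal{S}_p$. Galois extension: a commutative ring extension $S$ of $R$ with an action of a finite group $G$ is a $G$-Galois extension of $R$ if $G$ acts faithfully on $S$ by $R$-algebra automorphisms, $S^G=R$, $S$ is a separable $R$-algebra (projective as $S\otimes_R S$-module), and for all $g\neq h$ in $G$ and every nonzero idempotent $e\in S$ there is $s\in S$ with $g(s)e\neq h(s)e$. *)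

theory Defs
  imports
    "HOL-Library.Poly_Mapping"
    "HOL-Library.Extended_Nat"
    "HOL-Computational_Algebra.Polynomial"
    "HOL-Computational_Algebra.Primes"
    "HOL-Combinatorics.Cycles"
    "HOL-Algebra.Ideal_Product"
    "HOL-Algebra.QuotRing"
    "HOL-Algebra.UnivPoly"
    "HOL-Algebra.Embedded_Algebras"
    "HOL-Algebra.Module"
    "HOL-Algebra.Multiplicative_Group"
    "HOL-Algebra.Elementary_Groups"
    "HOL-Algebra.Group_Action"
    "HOL-Algebra.Sym_Groups"
begin

section \<open>Projective varieties\<close>

text \<open>
  Varieties are classical ones: over an algebraically closed field the closed points of a
  projective variety are the points of a Zariski closed subset of projective space. The projective
  space has one homogeneous coordinate for each element of the finite type \<open>'i\<close>, so that
  \<open>'i\<close> with \<open>CARD('i) = n + 1\<close> gives n-dimensional projective space.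
\<close>

type_synonym ('i, 'k) mpoly = "('i \<Rightarrow>\<^sub>0 nat) \<Rightarrow>\<^sub>0 'k"

definition eval_mpoly :: "('i::finite, 'k::comm_semiring_1) mpoly \<Rightarrow> ('i \<Rightarrow> 'k) \<Rightarrow> 'k" where
  "eval_mpoly f v = (\<Sum>m\<in>Poly_Mapping.keys f.
     Poly_Mapping.lookup f m * (\<Prod>i\<in>UNIV. v i ^ Poly_Mapping.lookup m i))"

definition homogeneous :: "nat \<Rightarrow> ('i::finite, 'k::zero) mpoly \<Rightarrow> bool" where
  "homogeneous d f \<longleftrightarrow> (\<forall>m\<in>Poly_Mapping.keys f. (\<Sum>i\<in>UNIV. Poly_Mapping.lookup m i) = d)"

text \<open>A point is the set of all its homogeneous coordinate vectors.\<close>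

type_synonym ('i, 'k) ppoint = "('i \<Rightarrow> 'k) set"

definition proj_space :: "('i, 'k::field) ppoint set" where
  "proj_space = (UNIV - {\<lambda>_. 0}) // {(v, w). \<exists>c. c \<noteq> 0 \<and> w = (\<lambda>i. c * v i)}"

definition vanishes :: "('i::finite, 'k::field) mpoly \<Rightarrow> ('i, 'k) ppoint \<Rightarrow> bool" where
  "vanishes f x \<longleftrightarrow> (\<forall>v\<in>x. eval_mpoly f v = 0)"

definition zero_locus :: "('i::finite, 'k::field) mpoly set \<Rightarrow> ('i, 'k) ppoint set" where
  "zero_locus T = {x \<in> proj_space. \<forall>f\<in>T. vanishes f x}"

definition zariski_closed :: "('i::finite, 'k::field) ppoint set \<Rightarrow> bool" where
  "zariski_closed Y \<longleftrightarrow> (\<exists>T. (\<forall>f\<in>T. \<exists>d. homogeneous d f) \<and> Y = zero_locus T)"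

definition projective_variety :: "('i::finite, 'k::field) ppoint set \<Rightarrow> bool" where
  "projective_variety X \<longleftrightarrow> zariski_closed X \<and> X \<noteq> {} \<and>
     (\<forall>Y Z. zariski_closed Y \<longrightarrow> zariski_closed Z \<longrightarrow> X \<subseteq> Y \<union> Z \<longrightarrow> X \<subseteq> Y \<or> X \<subseteq> Z)"

definition variety_dim :: "('i::finite, 'k::field) ppoint set \<Rightarrow> enat" where
  "variety_dim X = Sup {enat d | d. \<exists>Z :: nat \<Rightarrow> ('i, 'k) ppoint set.
     (\<forall>j\<le>d. projective_variety (Z j) \<and> Z j \<subseteq> X) \<and> (\<forall>j<d. Z j \<subset> Z (Suc j))}"


section \<open>Local rings and non-singularity\<close>

text \<open>
  The local ring at a point x of a variety consists of the rational functions f / g, where f and g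
  are homogeneous of the same degree and g does not vanish at x.
\<close>

definition local_fracs ::
    "('i::finite, 'k::field) ppoint \<Rightarrow> (('i, 'k) mpoly \<times> ('i, 'k) mpoly) set" where
  "local_fracs x = {(f, g). (\<exists>d. homogeneous d f \<and> homogeneous d g) \<and> \<not> vanishes g x}"

definition local_rel :: "('i::finite, 'k::field) ppoint set \<Rightarrow> ('i, 'k) ppoint \<Rightarrow>
    ((('i, 'k) mpoly \<times> ('i, 'k) mpoly) \<times> (('i, 'k) mpoly \<times> ('i, 'k) mpoly)) set" where
  "local_rel X x = {((f, g), (f', g')). (f, g) \<in> local_fracs x \<and> (f', g') \<in> local_fracs x \<and>
     (\<forall>y\<in>X. vanishes (f * g' - f' * g) y)}"

type_synonym ('i, 'k) ratfun = "(('i, 'k) mpoly \<times> ('i, 'k) mpoly) set"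

definition local_ring ::
    "('i::finite, 'k::field) ppoint set \<Rightarrow> ('i, 'k) ppoint \<Rightarrow> ('i, 'k) ratfun ring" where
  "local_ring X x =
     \<lparr>carrier = local_fracs x // local_rel X x,
      mult = (\<lambda>A B. \<Union>(f, g)\<in>A. \<Union>(f', g')\<in>B. local_rel X x `` {(f * f', g * g')}),
      one = local_rel X x `` {(1, 1)},
      zero = local_rel X x `` {(0, 1)},
      add = (\<lambda>A B. \<Union>(f, g)\<in>A. \<Union>(f', g')\<in>B. local_rel X x `` {(f * g' + f' * g, g * g')})\<rparr>"

definition local_const ::
    "('i::finite, 'k::field) ppoint set \<Rightarrow> ('i, 'k) ppoint \<Rightarrow> 'k \<Rightarrow> ('i, 'k) ratfun" where
  "local_const X x c = local_rel X x `` {(Poly_Mapping.single 0 c, 1)}"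

definition max_ideal ::
    "('i::finite, 'k::field) ppoint set \<Rightarrow> ('i, 'k) ppoint \<Rightarrow> ('i, 'k) ratfun set" where
  "max_ideal X x = {A \<in> carrier (local_ring X x). \<exists>(f, g)\<in>A. vanishes f x}"

text \<open>
  The cotangent space of X at x, the quotient of the maximal ideal m by its square, is a subspace of
  the quotient of the local ring by the square of m, on which the image of \<open>'k\<close> acts by
  multiplication.
\<close>

definition cotangent_dim ::
    "('i::finite, 'k::field) ppoint set \<Rightarrow> ('i, 'k) ppoint \<Rightarrow> nat \<Rightarrow> bool" where
  "cotangent_dim X x d \<longleftrightarrow>
     (let L = local_ring X x; M2 = max_ideal X x \<cdot>\<^bsub>L\<^esub> max_ideal X x
      in ring.dimension (L Quot M2) d (range (\<lambda>c. M2 +>\<^bsub>L\<^esub> local_const X x c))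
           ((\<lambda>f. M2 +>\<^bsub>L\<^esub> f) ` max_ideal X x))"

definition nonsingular :: "('i::finite, 'k::field) ppoint set \<Rightarrow> bool" where
  "nonsingular X \<longleftrightarrow> (\<forall>x\<in>X. \<exists>d. variety_dim X = enat d \<and> cotangent_dim X x d)"

definition nonsingular_projective_curve :: "('i::finite, 'k::field) ppoint set \<Rightarrow> bool" where
  "nonsingular_projective_curve X \<longleftrightarrow> projective_variety X \<and> variety_dim X = 1 \<and> nonsingular X"


section \<open>Completions, fraction fields and valuations\<close>

definition ideal_pow :: "('a, 'm) ring_scheme \<Rightarrow> 'a set \<Rightarrow> nat \<Rightarrow> 'a set" where
  "ideal_pow R I n = ((\<lambda>J. I \<cdot>\<^bsub>R\<^esub> J) ^^ n) (carrier R)"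

text \<open>
  The completion is the inverse limit of the quotients by the powers of I: the inclusion
  \<open>s (Suc n) \<subseteq> s n\<close> of cosets says that the canonical map takes \<open>s (Suc n)\<close> to \<open>s n\<close>.
\<close>

definition adic_completion :: "('a, 'm) ring_scheme \<Rightarrow> 'a set \<Rightarrow> (nat \<Rightarrow> 'a set) ring" where
  "adic_completion R I =
     \<lparr>carrier = {s. \<forall>n. s n \<in> carrier (R Quot ideal_pow R I n) \<and> s (Suc n) \<subseteq> s n},
      mult = (\<lambda>s t n. s n \<otimes>\<^bsub>R Quot ideal_pow R I n\<^esub> t n),
      one = (\<lambda>n. \<one>\<^bsub>R Quot ideal_pow R I n\<^esub>),
      zero = (\<lambda>n. \<zero>\<^bsub>R Quot ideal_pow R I n\<^esub>),
      add = (\<lambda>s t n. s n \<oplus>\<^bsub>R Quot ideal_pow R I n\<^esub> t n)\<rparr>"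

definition fracs :: "('a, 'm) ring_scheme \<Rightarrow> ('a \<times> 'a) set" where
  "fracs R = carrier R \<times> (carrier R - {\<zero>\<^bsub>R\<^esub>})"

definition frac_rel :: "('a, 'm) ring_scheme \<Rightarrow> (('a \<times> 'a) \<times> ('a \<times> 'a)) set" where
  "frac_rel R = {((a, b), (a', b')). (a, b) \<in> fracs R \<and> (a', b') \<in> fracs R \<and>
     a \<otimes>\<^bsub>R\<^esub> b' = a' \<otimes>\<^bsub>R\<^esub> b}"

definition frac_field :: "('a, 'm) ring_scheme \<Rightarrow> ('a \<times> 'a) set ring" where
  "frac_field R =
     \<lparr>carrier = fracs R // frac_rel R,
      mult = (\<lambda>A B. \<Union>(a, b)\<in>A. \<Union>(a', b')\<in>B. frac_rel R `` {(a \<otimes>\<^bsub>R\<^esub> a', b \<otimes>\<^bsub>R\<^esub> b')}),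
      one = frac_rel R `` {(\<one>\<^bsub>R\<^esub>, \<one>\<^bsub>R\<^esub>)},
      zero = frac_rel R `` {(\<zero>\<^bsub>R\<^esub>, \<one>\<^bsub>R\<^esub>)},
      add = (\<lambda>A B. \<Union>(a, b)\<in>A. \<Union>(a', b')\<in>B.
               frac_rel R `` {((a \<otimes>\<^bsub>R\<^esub> b') \<oplus>\<^bsub>R\<^esub> (a' \<otimes>\<^bsub>R\<^esub> b), b \<otimes>\<^bsub>R\<^esub> b')})\<rparr>"

definition frac_of :: "('a, 'm) ring_scheme \<Rightarrow> 'a \<Rightarrow> ('a \<times> 'a) set" where
  "frac_of R a = frac_rel R `` {(a, \<one>\<^bsub>R\<^esub>)}"

text \<open>
  The normalized valuation of a discrete valuation ring R, whose maximal ideal is the set of its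
  non-units. Both functions are meaningful for nonzero arguments only.
\<close>

definition dvr_order :: "('a, 'm) ring_scheme \<Rightarrow> 'a \<Rightarrow> nat" where
  "dvr_order R a = (GREATEST n. a \<in> ideal_pow R (carrier R - Units R) n)"

definition frac_val :: "('a, 'm) ring_scheme \<Rightarrow> ('a \<times> 'a) set \<Rightarrow> int" where
  "frac_val R \<alpha> = the_elem ((\<lambda>(a, b). int (dvr_order R a) - int (dvr_order R b)) ` \<alpha>)"


section \<open>Adeles\<close>

type_synonym ('i, 'k) complete_local = "nat \<Rightarrow> ('i, 'k) ratfun set"

type_synonym ('i, 'k) local_elem = "(('i, 'k) complete_local \<times> ('i, 'k) complete_local) set"

type_synonym ('i, 'k) adele = "('i, 'k) ppoint \<Rightarrow> ('i, 'k) local_elem"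

definition complete_local_ring ::
    "('i::finite, 'k::field) ppoint set \<Rightarrow> ('i, 'k) ppoint \<Rightarrow> ('i, 'k) complete_local ring" where
  "complete_local_ring X x = adic_completion (local_ring X x) (max_ideal X x)"

definition local_field ::
    "('i::finite, 'k::field) ppoint set \<Rightarrow> ('i, 'k) ppoint \<Rightarrow> ('i, 'k) local_elem ring" where
  "local_field X x = frac_field (complete_local_ring X x)"

definition adele_ring :: "('i::finite, 'k::field) ppoint set \<Rightarrow> ('i, 'k) adele ring" where
  "adele_ring X =
     \<lparr>carrier = {\<alpha> \<in> (\<Pi>\<^sub>E x\<in>X. carrier (local_field X x)).
        finite {x \<in> X. \<alpha> x \<notin> frac_of (complete_local_ring X x) ` carrier (complete_local_ring X x)}},
      mult = (\<lambda>\<alpha> \<beta>. \<lambda>x\<in>X. \<alpha> x \<otimes>\<^bsub>local_field X x\<^esub> \<beta> x),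
      one = (\<lambda>x\<in>X. \<one>\<^bsub>local_field X x\<^esub>),
      zero = (\<lambda>x\<in>X. \<zero>\<^bsub>local_field X x\<^esub>),
      add = (\<lambda>\<alpha> \<beta>. \<lambda>x\<in>X. \<alpha> x \<oplus>\<^bsub>local_field X x\<^esub> \<beta> x)\<rparr>"

definition Ram :: "('i::finite, 'k::field) ppoint set \<Rightarrow> nat \<Rightarrow> ('i, 'k) adele \<Rightarrow>
    ('i, 'k) ppoint set" where
  "Ram X p t = {x \<in> X. \<not> int p dvd frac_val (complete_local_ring X x) (t x)}"


section \<open>Adjoining a p-th root\<close>

definition root_ideal :: "('a, 'm) ring_scheme \<Rightarrow> nat \<Rightarrow> 'a \<Rightarrow> (nat \<Rightarrow> 'a) set" where
  "root_ideal R p t =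
     PIdl\<^bsub>UP R\<^esub> (up_ring.monom (UP R) \<one>\<^bsub>R\<^esub> p \<ominus>\<^bsub>UP R\<^esub> up_ring.monom (UP R) t 0)"

definition root_ext :: "('a, 'm) ring_scheme \<Rightarrow> nat \<Rightarrow> 'a \<Rightarrow> (nat \<Rightarrow> 'a) set ring" where
  "root_ext R p t = UP R Quot root_ideal R p t"

definition root_emb :: "('a, 'm) ring_scheme \<Rightarrow> nat \<Rightarrow> 'a \<Rightarrow> 'a \<Rightarrow> (nat \<Rightarrow> 'a) set" where
  "root_emb R p t r = root_ideal R p t +>\<^bsub>UP R\<^esub> up_ring.monom (UP R) r 0"

text \<open>An R-algebra S is given by its structure homomorphism \<open>\<iota>\<close> from R to S.\<close>

definition alg_aut_group :: "('r, 'm) ring_scheme \<Rightarrow> ('r \<Rightarrow> 's) \<Rightarrow> ('s, 'n) ring_scheme \<Rightarrow>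
    ('s \<Rightarrow> 's) monoid" where
  "alg_aut_group R \<iota> S = (BijGroup (carrier S))
     \<lparr>carrier := {g \<in> Bij (carrier S). g \<in> ring_hom S S \<and> (\<forall>r\<in>carrier R. g (\<iota> r) = \<iota> r)}\<rparr>"

definition adele_root_ext :: "('i::finite, 'k::field) ppoint set \<Rightarrow> nat \<Rightarrow> ('i, 'k) adele \<Rightarrow>
    (nat \<Rightarrow> ('i, 'k) adele) set ring" where
  "adele_root_ext X p t = root_ext (adele_ring X) p t"

definition local_root_ext :: "('i::finite, 'k::field) ppoint set \<Rightarrow> nat \<Rightarrow> ('i, 'k) adele \<Rightarrow>
    ('i, 'k) ppoint \<Rightarrow> (nat \<Rightarrow> ('i, 'k) local_elem) set ring" where
  "local_root_ext X p t x = root_ext (local_field X x) p (t x)"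

definition adele_emb :: "('i::finite, 'k::field) ppoint set \<Rightarrow> nat \<Rightarrow> ('i, 'k) adele \<Rightarrow>
    ('i, 'k) adele \<Rightarrow> (nat \<Rightarrow> ('i, 'k) adele) set" where
  "adele_emb X p t = root_emb (adele_ring X) p t"

definition local_emb :: "('i::finite, 'k::field) ppoint set \<Rightarrow> nat \<Rightarrow> ('i, 'k) adele \<Rightarrow>
    ('i, 'k) ppoint \<Rightarrow> ('i, 'k) local_elem \<Rightarrow> (nat \<Rightarrow> ('i, 'k) local_elem) set" where
  "local_emb X p t x = root_emb (local_field X x) p (t x)"

definition aut_adele :: "('i::finite, 'k::field) ppoint set \<Rightarrow> nat \<Rightarrow> ('i, 'k) adele \<Rightarrow>
    ((nat \<Rightarrow> ('i, 'k) adele) set \<Rightarrow> (nat \<Rightarrow> ('i, 'k) adele) set) monoid" where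
  "aut_adele X p t = alg_aut_group (adele_ring X) (adele_emb X p t) (adele_root_ext X p t)"

definition aut_local :: "('i::finite, 'k::field) ppoint set \<Rightarrow> nat \<Rightarrow> ('i, 'k) adele \<Rightarrow>
    ('i, 'k) ppoint \<Rightarrow>
    ((nat \<Rightarrow> ('i, 'k) local_elem) set \<Rightarrow> (nat \<Rightarrow> ('i, 'k) local_elem) set) monoid" where
  "aut_local X p t x = alg_aut_group (local_field X x) (local_emb X p t x) (local_root_ext X p t x)"

text \<open>
  Taking the x-components of the coefficients of polynomials maps the adelic extension onto the
  local one. The x-component of an automorphism g is the automorphism that g induces through this
  surjection.
\<close>

definition root_proj :: "('i::finite, 'k::field) ppoint set \<Rightarrow> nat \<Rightarrow> ('i, 'k) adele \<Rightarrow>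
    ('i, 'k) ppoint \<Rightarrow> (nat \<Rightarrow> ('i, 'k) adele) set \<Rightarrow> (nat \<Rightarrow> ('i, 'k) local_elem) set" where
  "root_proj X p t x Y = (\<Union>f\<in>Y. root_ideal (local_field X x) p (t x)
     +>\<^bsub>UP (local_field X x)\<^esub> (\<lambda>n. f n x))"

definition component :: "('i::finite, 'k::field) ppoint set \<Rightarrow> nat \<Rightarrow> ('i, 'k) adele \<Rightarrow>
    ('i, 'k) ppoint \<Rightarrow>
    ((nat \<Rightarrow> ('i, 'k) adele) set \<Rightarrow> (nat \<Rightarrow> ('i, 'k) adele) set) \<Rightarrow>
    ((nat \<Rightarrow> ('i, 'k) local_elem) set \<Rightarrow> (nat \<Rightarrow> ('i, 'k) local_elem) set)" where
  "component X p t x g = (THE h. h \<in> carrier (aut_local X p t x) \<and>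
     (\<forall>s\<in>carrier (adele_root_ext X p t). root_proj X p t x (g s) = h (root_proj X p t x s)))"


section \<open>Local automorphism groups as permutation groups\<close>

definition power_ring :: "('a, 'm) ring_scheme \<Rightarrow> nat \<Rightarrow> (nat \<Rightarrow> 'a) ring" where
  "power_ring R n =
     \<lparr>carrier = {1..n} \<rightarrow>\<^sub>E carrier R,
      mult = (\<lambda>a b. \<lambda>i\<in>{1..n}. a i \<otimes>\<^bsub>R\<^esub> b i),
      one = (\<lambda>i\<in>{1..n}. \<one>\<^bsub>R\<^esub>),
      zero = (\<lambda>i\<in>{1..n}. \<zero>\<^bsub>R\<^esub>),
      add = (\<lambda>a b. \<lambda>i\<in>{1..n}. a i \<oplus>\<^bsub>R\<^esub> b i)\<rparr>"

text \<open>
  \<open>perm_identification X p t x \<rho>\<close> says that \<open>\<rho>\<close> is one of the identifications of the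
  automorphism group at x with a permutation group on \<open>{1..p}\<close>. At an unramified point an
  isomorphism of the local extension with the product of p copies of the local field is used to
  number the factors, and \<open>\<rho> g\<close> describes how g permutes them; at a ramified point the image of
  \<open>\<rho>\<close> is generated by a p-cycle.
\<close>

definition perm_identification :: "('i::finite, 'k::field) ppoint set \<Rightarrow> nat \<Rightarrow> ('i, 'k) adele \<Rightarrow>
    ('i, 'k) ppoint \<Rightarrow>
    (((nat \<Rightarrow> ('i, 'k) local_elem) set \<Rightarrow> (nat \<Rightarrow> ('i, 'k) local_elem) set) \<Rightarrow> nat \<Rightarrow> nat) \<Rightarrow>
    bool" where
  "perm_identification X p t x \<rho> \<longleftrightarrow>
     (if x \<in> Ram X p t
      then \<rho> \<in> hom (aut_local X p t x) (sym_group p) \<and>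
        inj_on \<rho> (carrier (aut_local X p t x)) \<and>
        (\<exists>cs. cycle cs \<and> set cs = {1..p} \<and>
          \<rho> ` carrier (aut_local X p t x) = generate (sym_group p) {cycle_of_list cs})
      else \<rho> \<in> iso (aut_local X p t x) (sym_group p) \<and>
        (\<exists>\<phi> \<in> ring_iso (local_root_ext X p t x) (power_ring (local_field X x) p).
          (\<forall>c\<in>carrier (local_field X x). \<phi> (local_emb X p t x c) = (\<lambda>i\<in>{1..p}. c)) \<and>
          (\<forall>g\<in>carrier (aut_local X p t x). \<forall>s\<in>carrier (local_root_ext X p t x). \<forall>i\<in>{1..p}.
             \<phi> (g s) (\<rho> g i) = \<phi> s i)))"

text \<open>
  Whether a subgroup is transitive does not depend on the choice of the identification.
\<close>

definition transitive_subgroup_at :: "('i::finite, 'k::field) ppoint set \<Rightarrow> nat \<Rightarrow>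
    ('i, 'k) adele \<Rightarrow> ('i, 'k) ppoint \<Rightarrow>
    ((nat \<Rightarrow> ('i, 'k) local_elem) set \<Rightarrow> (nat \<Rightarrow> ('i, 'k) local_elem) set) set \<Rightarrow> bool" where
  "transitive_subgroup_at X p t x H \<longleftrightarrow> subgroup H (aut_local X p t x) \<and>
     (\<exists>\<rho>. perm_identification X p t x \<rho> \<and>
        transitive_action ((aut_local X p t x)\<lparr>carrier := H\<rparr>) {1..p} (\<lambda>h. \<lambda>i\<in>{1..p}. \<rho> h i))"


section \<open>Projective modules and separable algebras\<close>

definition linear_maps :: "('r, 'm) ring_scheme \<Rightarrow> ('r, 'a, 'n) module_scheme \<Rightarrow>
    ('r, 'b, 'l) module_scheme \<Rightarrow> ('a \<Rightarrow> 'b) set" where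
  "linear_maps R M N = {h \<in> carrier M \<rightarrow> carrier N.
     (\<forall>x\<in>carrier M. \<forall>y\<in>carrier M. h (x \<oplus>\<^bsub>M\<^esub> y) = h x \<oplus>\<^bsub>N\<^esub> h y) \<and>
     (\<forall>r\<in>carrier R. \<forall>x\<in>carrier M. h (r \<odot>\<^bsub>M\<^esub> x) = r \<odot>\<^bsub>N\<^esub> h x)}"

text \<open>
  The multiplicative part of a module record is irrelevant.
\<close>

definition free_module :: "('r, 'm) ring_scheme \<Rightarrow> 'b set \<Rightarrow> ('r, 'b \<Rightarrow> 'r) module" where
  "free_module R B =
     \<lparr>carrier = {f \<in> B \<rightarrow>\<^sub>E carrier R. finite {b \<in> B. f b \<noteq> \<zero>\<^bsub>R\<^esub>}},
      mult = undefined,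
      one = undefined,
      zero = (\<lambda>b\<in>B. \<zero>\<^bsub>R\<^esub>),
      add = (\<lambda>f g. \<lambda>b\<in>B. f b \<oplus>\<^bsub>R\<^esub> g b),
      smult = (\<lambda>r f. \<lambda>b\<in>B. r \<otimes>\<^bsub>R\<^esub> f b)\<rparr>"

text \<open>
  Projective means direct summand of a free module. It is no restriction that the basis is indexed
  by elements of the type of M: every module M is a quotient of the free module on
  \<open>carrier M\<close>, and if M is projective, this surjection splits.
\<close>

definition projective_module :: "('r, 'm) ring_scheme \<Rightarrow> ('r, 'a, 'n) module_scheme \<Rightarrow> bool" where
  "projective_module R M \<longleftrightarrow> module R M \<and>
     (\<exists>B :: 'a set. \<exists>j \<in> linear_maps R M (free_module R B). \<exists>q \<in> linear_maps R (free_module R B) M.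
        \<forall>x\<in>carrier M. q (j x) = x)"

text \<open>
  For a commutative R-algebra S the ring \<open>S \<otimes>\<^sub>R S\<close> is constructed as the quotient of the
  monoid ring of the multiplicative monoid \<open>S \<times> S\<close> over the integers by the ideal that
  is generated by the bilinearity relations; the basis element of a pair (a, b) becomes the pure
  tensor of a and b.
\<close>

definition pair_ring :: "('s, 'n) ring_scheme \<Rightarrow> ('s \<times> 's \<Rightarrow>\<^sub>0 int) ring" where
  "pair_ring S =
     \<lparr>carrier = {f. Poly_Mapping.keys f \<subseteq> carrier S \<times> carrier S},
      mult = (\<lambda>f g. \<Sum>(a, b)\<in>Poly_Mapping.keys f. \<Sum>(c, d)\<in>Poly_Mapping.keys g.
                Poly_Mapping.single (a \<otimes>\<^bsub>S\<^esub> c, b \<otimes>\<^bsub>S\<^esub> d)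
                  (Poly_Mapping.lookup f (a, b) * Poly_Mapping.lookup g (c, d))),
      one = Poly_Mapping.single (\<one>\<^bsub>S\<^esub>, \<one>\<^bsub>S\<^esub>) 1,
      zero = 0,
      add = (+)\<rparr>"

definition tensor_rels :: "('r, 'm) ring_scheme \<Rightarrow> ('r \<Rightarrow> 's) \<Rightarrow> ('s, 'n) ring_scheme \<Rightarrow>
    ('s \<times> 's \<Rightarrow>\<^sub>0 int) set" where
  "tensor_rels R \<iota> S =
     (let b = (\<lambda>x y. Poly_Mapping.single (x, y) 1) in
       {b (x \<oplus>\<^bsub>S\<^esub> x') y - b x y - b x' y | x x' y.
          x \<in> carrier S \<and> x' \<in> carrier S \<and> y \<in> carrier S} \<union>
       {b x (y \<oplus>\<^bsub>S\<^esub> y') - b x y - b x y' | x y y'.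
          x \<in> carrier S \<and> y \<in> carrier S \<and> y' \<in> carrier S} \<union>
       {b (\<iota> r \<otimes>\<^bsub>S\<^esub> x) y - b x (\<iota> r \<otimes>\<^bsub>S\<^esub> y) | r x y.
          r \<in> carrier R \<and> x \<in> carrier S \<and> y \<in> carrier S})"

definition tensor_square :: "('r, 'm) ring_scheme \<Rightarrow> ('r \<Rightarrow> 's) \<Rightarrow> ('s, 'n) ring_scheme \<Rightarrow>
    ('s \<times> 's \<Rightarrow>\<^sub>0 int) set ring" where
  "tensor_square R \<iota> S = pair_ring S Quot (Idl\<^bsub>pair_ring S\<^esub> (tensor_rels R \<iota> S))"

definition pair_mult :: "('s, 'n) ring_scheme \<Rightarrow> ('s \<times> 's \<Rightarrow>\<^sub>0 int) \<Rightarrow> 's" where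
  "pair_mult S f = (\<Oplus>\<^bsub>S\<^esub>z\<in>Poly_Mapping.keys f.
     add_pow S (Poly_Mapping.lookup f z) (fst z \<otimes>\<^bsub>S\<^esub> snd z))"

text \<open>
  S as a module over its tensor square, on which a pure tensor of a and b acts as multiplication
  by the product of a and b. The map \<open>pair_mult S\<close> is constant on the elements of the tensor
  square.
\<close>

definition tensor_module :: "'s ring \<Rightarrow> (('s \<times> 's \<Rightarrow>\<^sub>0 int) set, 's) module" where
  "tensor_module S = ring.extend S \<lparr>smult = (\<lambda>W s. the_elem (pair_mult S ` W) \<otimes>\<^bsub>S\<^esub> s)\<rparr>"

definition separable_algebra :: "('r, 'm) ring_scheme \<Rightarrow> ('r \<Rightarrow> 's) \<Rightarrow> 's ring \<Rightarrow> bool" where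
  "separable_algebra R \<iota> S \<longleftrightarrow> projective_module (tensor_square R \<iota> S) (tensor_module S)"


section \<open>Galois extensions of commutative rings\<close>

definition fixed_ring :: "'s ring \<Rightarrow> ('s \<Rightarrow> 's) set \<Rightarrow> 's set" where
  "fixed_ring S G = {s \<in> carrier S. \<forall>g\<in>G. g s = s}"

text \<open>
  An action of an abstract group is a homomorphism into the group of algebra automorphisms.
\<close>

definition galois_extension :: "('r, 'm) ring_scheme \<Rightarrow> ('r \<Rightarrow> 's) \<Rightarrow> 's ring \<Rightarrow>
    ('g, 'n) monoid_scheme \<Rightarrow> ('g \<Rightarrow> 's \<Rightarrow> 's) \<Rightarrow> bool" where
  "galois_extension R \<iota> S G act \<longleftrightarrow>
     cring R \<and> cring S \<and> \<iota> \<in> ring_hom R S \<and> inj_on \<iota> (carrier R) \<and>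
     group G \<and> finite (carrier G) \<and>
     act \<in> hom G (alg_aut_group R \<iota> S) \<and> inj_on act (carrier G) \<and>
     fixed_ring S (act ` carrier G) = \<iota> ` carrier R \<and>
     separable_algebra R \<iota> S \<and>
     (\<forall>g\<in>carrier G. \<forall>h\<in>carrier G. g \<noteq> h \<longrightarrow>
        (\<forall>e\<in>carrier S. e \<otimes>\<^bsub>S\<^esub> e = e \<longrightarrow> e \<noteq> \<zero>\<^bsub>S\<^esub> \<longrightarrow>
           (\<exists>s\<in>carrier S. act g s \<otimes>\<^bsub>S\<^esub> e \<noteq> act h s \<otimes>\<^bsub>S\<^esub> e)))"

end

theory Submission
  imports Defs "HOL-Computational_Algebra.Formal_Laurent_Series"
begin

text \<open>
  The maximal ideal of the completed local ring at a point is generated by linear forms; since the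
  cotangent space is one-dimensional, Nakayama's lemma makes it principal, and Taylor expansion along
  a uniformizer identifies the ring with the power series over the ground field and its fraction
  field with the Laurent series in \<open>z\<close>. Substituting \<open>z \<mapsto> z ^ p\<close> embeds the latter
  into itself and turns every nonzero series into a \<open>p\<close>-th power:
  the local algebra then has exactly \<open>p\<close> embeddings over its base, which separate its elements,
  and its automorphism group acts faithfully on them. An element of order \<open>p\<close> acts as a
  \<open>p\<close>-cycle, so an element fixed by it takes the same value under all embeddings and, by inverting a
  discrete Fourier transform, lies in the base field; for the same reason no nonzero idempotent can
  identify two distinct powers. Conversely, since \<open>p\<close> is prime, a component which is not of order
  \<open>p\<close> is trivial, and then too much is fixed. Separability costs nothing:
  \<open>1/p * (\<Sum>i<p. T ^ i \<otimes> T ^ (- i))\<close> is a separability idempotent because \<open>t\<close> is a unit.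
\<close>

text \<open>All four conditions are compared with one statement, \<open>full\<close>: no nontrivial
  element of G has a trivial component. As G has prime order, every nontrivial element generates it,
  so a single trivial component makes the whole projection of G at that point trivial.

  The obstacle is that the local algebra is a field at the points of \<open>Ram\<close> and a
  product of p fields elsewhere. The substitution z \<mapsto> z^p removes the distinction: writing
  the idele component as h = z^n v^p, its image has the p-th root y = z^n v(z^p), and in both cases
  the embeddings send the adjoined root to W^j y for a p-th root of unity W. Ramification is
  consulted only when the action on the indices j has to be matched with the prescribed permutation
  group.

  The passage from adeles to points avoids the product decomposition of the automorphism group.
  Representatives of degree below p are unique over every base ring, so elements are compared
  coefficientwise at each point, and an idempotent adele with one nonzero component isolates that
  point.\<close>

unbundle fps_syntax

section \<open>Homogeneous polynomials\<close>

text \<open>Cancellation can shrink the key set of a sum, so evaluations are compared over a common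
  finite set of monomials.\<close>

lemma eval_mpoly_superset:
  assumes "finite A" "Poly_Mapping.keys f \<subseteq> A"
  shows "eval_mpoly f v = (\<Sum>m\<in>A. Poly_Mapping.lookup f m * (\<Prod>i\<in>UNIV. v i ^ Poly_Mapping.lookup m i))"
  unfolding eval_mpoly_def
  by (rule sum.mono_neutral_left) (use assms in \<open>auto simp: in_keys_iff\<close>)

lemma eval_mpoly_zero [simp]: "eval_mpoly 0 v = 0"
  by (simp add: eval_mpoly_def)

lemma eval_mpoly_single [simp]:
  "eval_mpoly (Poly_Mapping.single m c) v = c * (\<Prod>i\<in>UNIV. v i ^ Poly_Mapping.lookup m i)"
  by (subst eval_mpoly_superset[of "{m}"]) auto

lemma eval_mpoly_one [simp]: "eval_mpoly 1 v = 1"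
  by (simp flip: single_one)

lemma eval_mpoly_add [simp]: "eval_mpoly (f + g) v = eval_mpoly f v + eval_mpoly g v"
proof -
  let ?A = "Poly_Mapping.keys f \<union> Poly_Mapping.keys g"
  have "Poly_Mapping.keys (f + g) \<subseteq> ?A"
    by (rule Poly_Mapping.keys_add)
  then show ?thesis
    by (simp add: eval_mpoly_superset[of ?A] lookup_add distrib_right sum.distrib)
qed

lemma eval_mpoly_uminus [simp]: "eval_mpoly (- f) v = - eval_mpoly (f :: ('i::finite, 'k::comm_ring_1) mpoly) v"
proof -
  have "eval_mpoly (f + - f) v = 0" by simp
  then show ?thesis unfolding eval_mpoly_add by (simp add: add_eq_0_iff)
qed

lemma eval_mpoly_diff [simp]:
  "eval_mpoly (f - g) v = eval_mpoly (f :: ('i::finite, 'k::comm_ring_1) mpoly) v - eval_mpoly g v"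
  using eval_mpoly_add[of f "- g" v] by simp

lemma eval_mpoly_sum [simp]: "eval_mpoly (sum F A) v = (\<Sum>a\<in>A. eval_mpoly (F a) v)"
  by (induction A rule: infinite_finite_induct) auto

lemma poly_mapping_sum_single: "(\<Sum>m\<in>Poly_Mapping.keys f. Poly_Mapping.single m (Poly_Mapping.lookup f m)) = f"
  by (rule poly_mapping_eqI) (simp add: lookup_sum lookup_single when_def in_keys_iff)

lemma eval_mpoly_mult [simp]: "eval_mpoly (f * g) v = eval_mpoly f v * eval_mpoly g v"
proof -
  have *: "f * g = (\<Sum>m\<in>Poly_Mapping.keys f. \<Sum>n\<in>Poly_Mapping.keys g.
      Poly_Mapping.single (m + n) (Poly_Mapping.lookup f m * Poly_Mapping.lookup g n))"
    using arg_cong2[OF poly_mapping_sum_single[of f] poly_mapping_sum_single[of g], of "(*)"]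
    by (simp add: sum_product mult_single)
  show ?thesis
    unfolding * eval_mpoly_sum eval_mpoly_single
    by (simp add: eval_mpoly_def sum_product lookup_add power_add prod.distrib mult_ac)
qed

lemma homogeneous_zero [simp]: "homogeneous d 0"
  by (simp add: homogeneous_def)

lemma homogeneous_single: "(\<Sum>i\<in>UNIV. Poly_Mapping.lookup m i) = d \<Longrightarrow> homogeneous d (Poly_Mapping.single m c)"
  by (simp add: homogeneous_def)

lemma homogeneous_one [simp]: "homogeneous 0 1"
  by (auto simp: homogeneous_def simp flip: single_one)

lemma homogeneous_add: "homogeneous d f \<Longrightarrow> homogeneous d g \<Longrightarrow> homogeneous d (f + g)"
  using Poly_Mapping.keys_add[of f g] by (auto simp: homogeneous_def)

lemma homogeneous_uminus [simp]: "homogeneous d (- f) \<longleftrightarrow> homogeneous d (f :: ('i::finite, 'k::comm_ring_1) mpoly)"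
  by (simp add: homogeneous_def)

lemma homogeneous_diff:
  "homogeneous d f \<Longrightarrow> homogeneous d g \<Longrightarrow> homogeneous d (f - g :: ('i::finite, 'k::comm_ring_1) mpoly)"
  using homogeneous_add[of d f "- g"] by simp

lemma homogeneous_mult: "homogeneous d f \<Longrightarrow> homogeneous e g \<Longrightarrow> homogeneous (d + e) (f * g)"
  using Poly_Mapping.keys_mult[of f g]
  by (fastforce simp: homogeneous_def lookup_add sum.distrib)

lemma homogeneous_sum: "(\<And>a. a \<in> A \<Longrightarrow> homogeneous d (F a)) \<Longrightarrow> homogeneous d (sum F A)"
  by (induction A rule: infinite_finite_induct) (auto simp: homogeneous_add)

lemma homogeneous_power: "homogeneous d f \<Longrightarrow> homogeneous (n * d) (f ^ n)"
  by (induction n) (auto intro: homogeneous_mult)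

lemma eval_mpoly_scale:
  assumes "homogeneous d f"
  shows "eval_mpoly f (\<lambda>i. c * v i) = c ^ d * eval_mpoly f v"
  using assms
  by (simp add: eval_mpoly_def sum_distrib_left power_mult_distrib prod.distrib homogeneous_def
      mult_ac flip: power_sum)

section \<open>The local ring of a point\<close>

definition scale_rel :: "(('i \<Rightarrow> 'k::field) \<times> ('i \<Rightarrow> 'k)) set" where
  "scale_rel = {(v, w). \<exists>c. c \<noteq> 0 \<and> w = (\<lambda>i. c * v i)}"

lemma proj_point_scale:
  assumes "y \<in> proj_space" "v \<in> y" "w \<in> y"
  shows "\<exists>c. c \<noteq> 0 \<and> w = (\<lambda>i. c * v i)"
proof -
  obtain u c d where "v = (\<lambda>i. c * u i)" "w = (\<lambda>i. d * u i)" "c \<noteq> 0" "d \<noteq> 0"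
    using assms by (auto simp: proj_space_def quotient_def)
  then show ?thesis by (intro exI[of _ "d / c"]) (auto simp: fun_eq_iff)
qed

text \<open>The coordinate equal to 1 later provides the denominator \<open>lin i0\<close> for
  dehomogenising at the point.\<close>

lemma proj_point_normalized:
  assumes "y \<in> proj_space"
  obtains v i where "v \<in> y" "v i = 1"
proof -
  obtain u :: "'a \<Rightarrow> 'b" where u: "u \<noteq> (\<lambda>_. 0)" "y = {(v, w). \<exists>c. c \<noteq> 0 \<and> w = (\<lambda>i. c * v i)} `` {u}"
    using assms by (auto simp: proj_space_def quotient_def)
  then obtain i where "u i \<noteq> 0" by auto
  then have "(\<lambda>j. inverse (u i) * u j) \<in> y"
    using u by (auto intro!: exI[of _ "inverse (u i)"])
  with \<open>u i \<noteq> 0\<close> show ?thesis by (intro that[of "\<lambda>j. inverse (u i) * u j" i]) auto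
qed

text \<open>Rescaling changes the value of a homogeneous polynomial by a power of the scalar only,
  so one fixed representative vector decides vanishing.\<close>

lemma vanishes_iff:
  assumes "y \<in> proj_space" "v \<in> y" "homogeneous d f"
  shows "vanishes f y \<longleftrightarrow> eval_mpoly f v = 0"
proof
  assume *: "eval_mpoly f v = 0"
  show "vanishes f y"
    unfolding vanishes_def
  proof
    fix w assume "w \<in> y"
    then obtain c where "w = (\<lambda>i. c * v i)" using proj_point_scale assms by blast
    then show "eval_mpoly f w = 0" using eval_mpoly_scale[OF assms(3)] * by simp
  qed
qed (use assms in \<open>auto simp: vanishes_def\<close>)

lemma projective_variety_subset: "projective_variety X \<Longrightarrow> X \<subseteq> proj_space"
  by (auto simp: projective_variety_def zariski_closed_def zero_locus_def)

text \<open>Irreducibility in algebraic form: the zero loci of f and g are closed and cover X, so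
  one of them contains X. This primality of the homogeneous ideal is what permits cancellation in
  fractions.\<close>

lemma projective_variety_prime:
  fixes f g :: "('i::finite, 'k::field) mpoly"
  assumes X: "projective_variety X" and f: "homogeneous d f" and g: "homogeneous e g"
    and fg: "\<And>w. w \<in> \<Union>X \<Longrightarrow> eval_mpoly f w * eval_mpoly g w = 0"
  shows "(\<forall>w\<in>\<Union>X. eval_mpoly f w = 0) \<or> (\<forall>w\<in>\<Union>X. eval_mpoly g w = 0)"
proof -
  have "zariski_closed (zero_locus {f})" "zariski_closed (zero_locus {g})"
    unfolding zariski_closed_def
    by (rule exI[of _ "{f}"], use f in blast) (rule exI[of _ "{g}"], use g in blast)
  moreover have "X \<subseteq> zero_locus {f} \<union> zero_locus {g}"
  proof
    fix y assume y: "y \<in> X"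
    then have yp: "y \<in> proj_space" using projective_variety_subset[OF X] by auto
    then obtain v i where v: "v \<in> y" by (rule proj_point_normalized)
    then have "eval_mpoly f v = 0 \<or> eval_mpoly g v = 0" using fg[of v] y by auto
    then show "y \<in> zero_locus {f} \<union> zero_locus {g}"
      using vanishes_iff[OF yp v f] vanishes_iff[OF yp v g] yp by (auto simp: zero_locus_def)
  qed
  ultimately have "X \<subseteq> zero_locus {f} \<or> X \<subseteq> zero_locus {g}"
    using X unfolding projective_variety_def by blast
  then show ?thesis by (auto simp: zero_locus_def vanishes_def)
qed

text \<open>Operations on classes are defined as unions over all representatives; once the result is
  independent of them, the union collapses to a single class.\<close>

lemma UN2_const:
  assumes "A \<noteq> {}" "B \<noteq> {}" "\<And>p q. p \<in> A \<Longrightarrow> q \<in> B \<Longrightarrow> F p q = C"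
  shows "(\<Union>p\<in>A. \<Union>q\<in>B. F p q) = C"
  using assms by blast

text \<open>Fixing a normalised vector v of the point turns evaluation at the point into evaluation
  of polynomials at v.\<close>

locale variety_point =
  fixes X :: "('i::finite, 'k::field) ppoint set" and x :: "('i, 'k) ppoint" and v :: "'i \<Rightarrow> 'k" and i0 :: 'i
  assumes X: "projective_variety X" and x: "x \<in> X" and v: "v \<in> x" and v_i0: "v i0 = 1"
begin

abbreviation L where "L \<equiv> local_ring X x"

definition fr :: "('i, 'k) mpoly \<Rightarrow> ('i, 'k) mpoly \<Rightarrow> ('i, 'k) ratfun" where
  "fr f g = local_rel X x `` {(f, g)}"

definition admissible :: "('i, 'k) mpoly \<Rightarrow> ('i, 'k) mpoly \<Rightarrow> bool" where
  "admissible f g \<longleftrightarrow> (\<exists>d. homogeneous d f \<and> homogeneous d g) \<and> eval_mpoly g v \<noteq> 0"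

lemma x_proj: "x \<in> proj_space"
  using X x projective_variety_subset by blast

lemma local_fracs_iff: "(f, g) \<in> local_fracs x \<longleftrightarrow> admissible f g"
  using vanishes_iff[OF x_proj v] by (auto simp: local_fracs_def admissible_def)

lemma local_rel_iff:
  "((f, g), (f', g')) \<in> local_rel X x \<longleftrightarrow> admissible f g \<and> admissible f' g' \<and>
     (\<forall>w\<in>\<Union>X. eval_mpoly f w * eval_mpoly g' w = eval_mpoly f' w * eval_mpoly g w)"
  unfolding local_rel_def by (auto simp: local_fracs_iff vanishes_def)

text \<open>Transitivity uses irreducibility: the two given relations yield equality only after
  multiplication by the middle denominator g'. Since g' does not vanish at v, primality forces the
  other factor to vanish on all of X.\<close>

lemma equiv_local_rel: "equiv (local_fracs x) (local_rel X x)"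
proof (rule equivI)
  show "local_rel X x \<subseteq> local_fracs x \<times> local_fracs x"
    by (auto simp: local_rel_def)
  show "refl_on (local_fracs x) (local_rel X x)"
    by (rule refl_onI) (auto simp: local_rel_iff local_fracs_iff)
  show "sym (local_rel X x)"
    by (rule symI) (auto simp: local_rel_iff)
  show "trans (local_rel X x)"
  proof (rule transI, clarify)
    fix f g f' g' f'' g''
    assume 1: "((f, g), (f', g')) \<in> local_rel X x" and 2: "((f', g'), (f'', g'')) \<in> local_rel X x"
    from 1 2 obtain d d' d'' where h: "homogeneous d f" "homogeneous d g" "homogeneous d' g'"
      "homogeneous d'' f''" "homogeneous d'' g''" and g'v: "eval_mpoly g' v \<noteq> 0"
      by (auto simp: local_rel_iff admissible_def)
    have "homogeneous (d + d'') (f * g'' - f'' * g)"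
      using h homogeneous_mult[of d f d'' g''] homogeneous_mult[of d'' f'' d g]
      by (auto intro!: homogeneous_diff simp: add.commute)
    then have "(\<forall>w\<in>\<Union>X. eval_mpoly (f * g'' - f'' * g) w = 0) \<or> (\<forall>w\<in>\<Union>X. eval_mpoly g' w = 0)"
    proof (rule projective_variety_prime[OF X _ h(3)])
      fix w assume w: "w \<in> \<Union>X"
      have a: "eval_mpoly f w * eval_mpoly g' w = eval_mpoly f' w * eval_mpoly g w"
        "eval_mpoly f' w * eval_mpoly g'' w = eval_mpoly f'' w * eval_mpoly g' w"
        using 1 2 w by (auto simp: local_rel_iff)
      have "eval_mpoly f w * eval_mpoly g'' w * eval_mpoly g' w =
          eval_mpoly f'' w * eval_mpoly g w * eval_mpoly g' w"
        using a by (metis (no_types, lifting) mult.assoc mult.commute)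
      then show "eval_mpoly (f * g'' - f'' * g) w * eval_mpoly g' w = 0"
        by (simp add: left_diff_distrib)
    qed
    with g'v v x have "\<forall>w\<in>\<Union>X. eval_mpoly (f * g'' - f'' * g) w = 0" by blast
    then show "((f, g), (f'', g'')) \<in> local_rel X x"
      using 1 2 by (auto simp: local_rel_iff)
  qed
qed

lemma fr_eq_iff:
  assumes "admissible f g" "admissible f' g'"
  shows "fr f g = fr f' g' \<longleftrightarrow>
    (\<forall>w\<in>\<Union>X. eval_mpoly f w * eval_mpoly g' w = eval_mpoly f' w * eval_mpoly g w)"
  using eq_equiv_class_iff[OF equiv_local_rel, of "(f, g)" "(f', g')"] assms
  by (auto simp: fr_def local_rel_iff local_fracs_iff)

lemma mem_frD: "(f', g') \<in> fr f g \<Longrightarrow> admissible f' g' \<and> fr f' g' = fr f g"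
  using equiv_class_eq[OF equiv_local_rel, of "(f, g)" "(f', g')"]
  by (auto simp: fr_def local_rel_iff)

lemma fr_mem: "admissible f g \<Longrightarrow> (f, g) \<in> fr f g"
  by (auto simp: fr_def local_rel_iff)

lemma carrier_L: "carrier L = {fr f g | f g. admissible f g}"
  by (auto simp: local_ring_def quotient_def fr_def) (use local_fracs_iff in blast)+

lemma fr_closed [intro]: "admissible f g \<Longrightarrow> fr f g \<in> carrier L"
  by (auto simp: carrier_L)

lemma fr_cases:
  assumes "a \<in> carrier L"
  obtains f g d where "a = fr f g" "homogeneous d f" "homogeneous d g" "eval_mpoly g v \<noteq> 0" "admissible f g"
  using assms by (auto simp: carrier_L admissible_def)

lemma admissible_mult: "admissible f g \<Longrightarrow> admissible f' g' \<Longrightarrow> admissible (f * f') (g * g')"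
  unfolding admissible_def using homogeneous_mult by fastforce

lemma admissible_add:
  assumes "admissible f g" "admissible f' g'"
  shows "admissible (f * g' + f' * g) (g * g')"
proof -
  obtain d e where "homogeneous d f" "homogeneous d g" "homogeneous e f'" "homogeneous e g'"
    using assms by (auto simp: admissible_def)
  then have "homogeneous (d + e) (f * g' + f' * g)" "homogeneous (d + e) (g * g')"
    using homogeneous_mult[of e f' d g] by (auto simp: homogeneous_add homogeneous_mult add.commute)
  with assms show ?thesis by (auto simp: admissible_def)
qed

lemma fr_mult:
  assumes "admissible f g" "admissible f' g'"
  shows "fr f g \<otimes>\<^bsub>L\<^esub> fr f' g' = fr (f * f') (g * g')"
proof -
  have "fr f g \<otimes>\<^bsub>L\<^esub> fr f' g' = (\<Union>p\<in>fr f g. \<Union>q\<in>fr f' g'. fr (fst p * fst q) (snd p * snd q))"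
    by (simp add: local_ring_def fr_def case_prod_beta)
  also have "\<dots> = fr (f * f') (g * g')"
  proof (rule UN2_const)
    fix p q assume p: "p \<in> fr f g" and q: "q \<in> fr f' g'"
    obtain a b c d where pq: "p = (a, b)" "q = (c, d)" by fastforce
    have 1: "admissible a b" "fr a b = fr f g" using mem_frD p pq by auto
    have 2: "admissible c d" "fr c d = fr f' g'" using mem_frD q pq by auto
    have "eval_mpoly (a * c) w * eval_mpoly (g * g') w = eval_mpoly (f * f') w * eval_mpoly (b * d) w"
      if w: "w \<in> \<Union>X" for w
    proof -
      have "eval_mpoly a w * eval_mpoly g w = eval_mpoly f w * eval_mpoly b w"
        "eval_mpoly c w * eval_mpoly g' w = eval_mpoly f' w * eval_mpoly d w"
        using 1 2 assms w by (auto simp: fr_eq_iff)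
      then show ?thesis unfolding eval_mpoly_mult by Groebner_Basis.algebra
    qed
    then show "fr (fst p * fst q) (snd p * snd q) = fr (f * f') (g * g')"
      using 1 2 assms unfolding pq fst_conv snd_conv by (subst fr_eq_iff) (auto simp: admissible_mult)
  qed (use fr_mem assms in auto)
  finally show ?thesis .
qed

lemma fr_add:
  assumes "admissible f g" "admissible f' g'"
  shows "fr f g \<oplus>\<^bsub>L\<^esub> fr f' g' = fr (f * g' + f' * g) (g * g')"
proof -
  have "fr f g \<oplus>\<^bsub>L\<^esub> fr f' g' =
      (\<Union>p\<in>fr f g. \<Union>q\<in>fr f' g'. fr (fst p * snd q + fst q * snd p) (snd p * snd q))"
    by (simp add: local_ring_def fr_def case_prod_beta)
  also have "\<dots> = fr (f * g' + f' * g) (g * g')"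
  proof (rule UN2_const)
    fix p q assume p: "p \<in> fr f g" and q: "q \<in> fr f' g'"
    obtain a b c d where pq: "p = (a, b)" "q = (c, d)" by fastforce
    have 1: "admissible a b" "fr a b = fr f g" using mem_frD p pq by auto
    have 2: "admissible c d" "fr c d = fr f' g'" using mem_frD q pq by auto
    have "eval_mpoly (a * d + c * b) w * eval_mpoly (g * g') w =
        eval_mpoly (f * g' + f' * g) w * eval_mpoly (b * d) w" if w: "w \<in> \<Union>X" for w
    proof -
      have "eval_mpoly a w * eval_mpoly g w = eval_mpoly f w * eval_mpoly b w"
        "eval_mpoly c w * eval_mpoly g' w = eval_mpoly f' w * eval_mpoly d w"
        using 1 2 assms w by (auto simp: fr_eq_iff)
      then show ?thesis unfolding eval_mpoly_mult eval_mpoly_add by Groebner_Basis.algebra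
    qed
    then show "fr (fst p * snd q + fst q * snd p) (snd p * snd q) = fr (f * g' + f' * g) (g * g')"
      using 1 2 assms unfolding pq fst_conv snd_conv by (subst fr_eq_iff) (auto simp: admissible_mult admissible_add)
  qed (use fr_mem assms in auto)
  finally show ?thesis .
qed

lemma fr_zero: "\<zero>\<^bsub>L\<^esub> = fr 0 1" and fr_one: "\<one>\<^bsub>L\<^esub> = fr 1 1"
  by (simp_all add: local_ring_def fr_def)

lemma admissible_zero [simp]: "admissible 0 1" and admissible_one [simp]: "admissible 1 1"
  by (auto simp: admissible_def intro: exI[of _ 0])

lemma L_closed:
  assumes "a \<in> carrier L" "b \<in> carrier L"
  shows "a \<oplus>\<^bsub>L\<^esub> b \<in> carrier L" "a \<otimes>\<^bsub>L\<^esub> b \<in> carrier L"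
proof -
  obtain f g f' g' where "a = fr f g" "b = fr f' g'" "admissible f g" "admissible f' g'"
    using assms by (auto simp: carrier_L)
  then show "a \<oplus>\<^bsub>L\<^esub> b \<in> carrier L" "a \<otimes>\<^bsub>L\<^esub> b \<in> carrier L"
    by (simp_all add: fr_add fr_mult fr_closed admissible_add admissible_mult)
qed

lemma L_cring: "cring L"
proof (rule cringI)
  have z: "fr 0 1 \<in> carrier L" and o: "fr 1 1 \<in> carrier L" by auto
  show "abelian_group L"
  proof (rule abelian_groupI)
    fix a b c assume "a \<in> carrier L" "b \<in> carrier L" "c \<in> carrier L"
    then obtain f g f' g' f'' g'' where abc: "a = fr f g" "b = fr f' g'" "c = fr f'' g''"
      and adm: "admissible f g" "admissible f' g'" "admissible f'' g''"
      by (auto simp: carrier_L)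
    have "(f * g' + f' * g) * g'' + f'' * (g * g') = f * (g' * g'') + (f' * g'' + f'' * g') * g"
      by (simp add: algebra_simps)
    then show "a \<oplus>\<^bsub>L\<^esub> b \<oplus>\<^bsub>L\<^esub> c = a \<oplus>\<^bsub>L\<^esub> (b \<oplus>\<^bsub>L\<^esub> c)"
      using adm by (simp add: abc fr_add admissible_add mult.assoc)
  next
    fix a b assume "a \<in> carrier L" "b \<in> carrier L"
    then obtain f g f' g' where "a = fr f g" "b = fr f' g'" "admissible f g" "admissible f' g'"
      by (auto simp: carrier_L)
    then show "a \<oplus>\<^bsub>L\<^esub> b = b \<oplus>\<^bsub>L\<^esub> a" by (simp add: fr_add add.commute mult.commute)
  next
    fix a assume "a \<in> carrier L"
    then obtain f g where a: "a = fr f g" "admissible f g" by (auto simp: carrier_L)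
    then show "\<zero>\<^bsub>L\<^esub> \<oplus>\<^bsub>L\<^esub> a = a" by (simp add: fr_add fr_zero)
    from a have "admissible (- f) g" by (auto simp: admissible_def)
    moreover from this a have "admissible (- f * g + f * g) (g * g)" by (intro admissible_add)
    ultimately have "fr (- f) g \<oplus>\<^bsub>L\<^esub> a = \<zero>\<^bsub>L\<^esub>"
      using a by (simp add: fr_add fr_zero fr_eq_iff)
    with \<open>admissible (- f) g\<close> show "\<exists>y\<in>carrier L. y \<oplus>\<^bsub>L\<^esub> a = \<zero>\<^bsub>L\<^esub>" by blast
  qed (use z L_closed in \<open>simp_all add: fr_zero\<close>)
  show "comm_monoid L"
  proof (rule comm_monoidI)
    fix a b c assume "a \<in> carrier L" "b \<in> carrier L" "c \<in> carrier L"
    then obtain f g f' g' f'' g'' where "a = fr f g" "b = fr f' g'" "c = fr f'' g''"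
      "admissible f g" "admissible f' g'" "admissible f'' g''"
      by (auto simp: carrier_L)
    then show "a \<otimes>\<^bsub>L\<^esub> b \<otimes>\<^bsub>L\<^esub> c = a \<otimes>\<^bsub>L\<^esub> (b \<otimes>\<^bsub>L\<^esub> c)"
      by (simp add: fr_mult admissible_mult mult.assoc)
  next
    fix a b assume "a \<in> carrier L" "b \<in> carrier L"
    then obtain f g f' g' where "a = fr f g" "b = fr f' g'" "admissible f g" "admissible f' g'"
      by (auto simp: carrier_L)
    then show "a \<otimes>\<^bsub>L\<^esub> b = b \<otimes>\<^bsub>L\<^esub> a" by (simp add: fr_mult mult.commute)
  next
    fix a assume "a \<in> carrier L"
    then obtain f g where "a = fr f g" "admissible f g" by (auto simp: carrier_L)
    then show "\<one>\<^bsub>L\<^esub> \<otimes>\<^bsub>L\<^esub> a = a" by (simp add: fr_mult fr_one)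
  qed (use o L_closed in \<open>simp_all add: fr_one\<close>)
next
  fix a b c assume "a \<in> carrier L" "b \<in> carrier L" "c \<in> carrier L"
  then obtain f g f' g' f'' g'' where abc: "a = fr f g" "b = fr f' g'" "c = fr f'' g''"
    and adm: "admissible f g" "admissible f' g'" "admissible f'' g''"
    by (auto simp: carrier_L)
  have "fr ((f * g' + f' * g) * f'') (g * g' * g'') =
      fr (f * f'' * (g' * g'') + f' * f'' * (g * g'')) (g * g'' * (g' * g''))"
    using adm by (subst fr_eq_iff) (simp_all add: admissible_mult admissible_add, simp add: algebra_simps)
  then show "(a \<oplus>\<^bsub>L\<^esub> b) \<otimes>\<^bsub>L\<^esub> c = a \<otimes>\<^bsub>L\<^esub> c \<oplus>\<^bsub>L\<^esub> b \<otimes>\<^bsub>L\<^esub> c"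
    using adm by (simp add: abc fr_mult fr_add admissible_mult admissible_add)
qed

sublocale L: cring L by (rule L_cring)

lemma L_domain: "domain L"
proof
  show "\<one>\<^bsub>L\<^esub> \<noteq> \<zero>\<^bsub>L\<^esub>"
    using v x by (auto simp: fr_zero fr_one fr_eq_iff)
next
  fix a b assume ab: "a \<otimes>\<^bsub>L\<^esub> b = \<zero>\<^bsub>L\<^esub>" "a \<in> carrier L" "b \<in> carrier L"
  from ab(2) obtain f g d where a: "a = fr f g" "homogeneous d f" "admissible f g" by (rule fr_cases)
  from ab(3) obtain f' g' d' where b: "b = fr f' g'" "homogeneous d' f'" "admissible f' g'" by (rule fr_cases)
  have "(\<forall>w\<in>\<Union>X. eval_mpoly f w = 0) \<or> (\<forall>w\<in>\<Union>X. eval_mpoly f' w = 0)"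
    by (rule projective_variety_prime[OF X a(2) b(2)])
      (use ab(1) a b in \<open>auto simp: fr_mult fr_zero fr_eq_iff admissible_mult\<close>)
  then show "a = \<zero>\<^bsub>L\<^esub> \<or> b = \<zero>\<^bsub>L\<^esub>"
    using a b by (auto simp: fr_zero fr_eq_iff)
qed

subsection \<open>The residue map\<close>

text \<open>The value of a rational function at the point, computed from some admissible
  representative; \<open>res_fr\<close> shows that the choice is immaterial.\<close>

definition res :: "('i, 'k) ratfun \<Rightarrow> 'k" where
  "res a = (SOME c. \<exists>f g. admissible f g \<and> a = fr f g \<and> c = eval_mpoly f v / eval_mpoly g v)"

abbreviation cst where "cst \<equiv> local_const X x"

lemma res_fr:
  assumes "admissible f g"
  shows "res (fr f g) = eval_mpoly f v / eval_mpoly g v"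
  unfolding res_def
proof (rule some_equality)
  fix c assume "\<exists>f' g'. admissible f' g' \<and> fr f g = fr f' g' \<and> c = eval_mpoly f' v / eval_mpoly g' v"
  then obtain f' g' where 1: "admissible f' g'" "fr f g = fr f' g'" "c = eval_mpoly f' v / eval_mpoly g' v"
    by blast
  then have "eval_mpoly f v * eval_mpoly g' v = eval_mpoly f' v * eval_mpoly g v"
    using x v assms by (auto simp: fr_eq_iff)
  then show "c = eval_mpoly f v / eval_mpoly g v"
    using 1 assms by (simp add: admissible_def frac_eq_eq)
qed (use assms in blast)

lemma cst_fr: "cst c = fr (Poly_Mapping.single 0 c) 1"
  by (simp add: local_const_def fr_def)

lemma admissible_const [simp]: "admissible (Poly_Mapping.single 0 c) 1"
  by (auto simp: admissible_def homogeneous_def intro: exI[of _ 0])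

lemma cst_closed [simp]: "cst c \<in> carrier L"
  by (simp add: cst_fr fr_closed)

lemma cst_add: "cst (c + d) = cst c \<oplus>\<^bsub>L\<^esub> cst d"
  by (simp add: cst_fr fr_add single_add)

lemma cst_mult: "cst (c * d) = cst c \<otimes>\<^bsub>L\<^esub> cst d"
  by (simp add: cst_fr fr_mult mult_single)

lemma cst_one [simp]: "cst 1 = \<one>\<^bsub>L\<^esub>" and cst_zero [simp]: "cst 0 = \<zero>\<^bsub>L\<^esub>"
  by (simp_all add: cst_fr fr_one fr_zero)

lemma res_cst [simp]: "res (cst c) = c"
  by (simp add: cst_fr res_fr)

lemma res_one [simp]: "res \<one>\<^bsub>L\<^esub> = 1" and res_zero [simp]: "res \<zero>\<^bsub>L\<^esub> = 0"
  using res_cst[of 1] res_cst[of 0] by simp_all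

lemma res_mult [simp]: "a \<in> carrier L \<Longrightarrow> b \<in> carrier L \<Longrightarrow> res (a \<otimes>\<^bsub>L\<^esub> b) = res a * res b"
  by (elim fr_cases) (simp add: fr_mult res_fr admissible_mult)

lemma res_add [simp]: "a \<in> carrier L \<Longrightarrow> b \<in> carrier L \<Longrightarrow> res (a \<oplus>\<^bsub>L\<^esub> b) = res a + res b"
  by (elim fr_cases) (simp add: fr_add res_fr admissible_add add_frac_eq)

lemma res_uminus [simp]: "a \<in> carrier L \<Longrightarrow> res (\<ominus>\<^bsub>L\<^esub> a) = - res a"
  using res_add[of "\<ominus>\<^bsub>L\<^esub> a" a] by (simp add: L.l_neg add_eq_0_iff2)

lemma res_minus [simp]: "a \<in> carrier L \<Longrightarrow> b \<in> carrier L \<Longrightarrow> res (a \<ominus>\<^bsub>L\<^esub> b) = res a - res b"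
  by (simp add: a_minus_def)

lemma max_ideal_eq: "max_ideal X x = {a \<in> carrier L. res a = 0}"
proof -
  have "(\<exists>(f, g)\<in>a. vanishes f x) \<longleftrightarrow> res a = 0" if a: "a \<in> carrier L" for a
  proof
    assume "\<exists>(f, g)\<in>a. vanishes f x"
    then obtain f g where fg: "(f, g) \<in> a" "vanishes f x" by blast
    obtain f' g' where "a = fr f' g'" using a by (auto simp: carrier_L)
    with fg have "admissible f g" "a = fr f g" using mem_frD by auto
    with fg v show "res a = 0" by (auto simp: res_fr vanishes_def)
  next
    assume 0: "res a = 0"
    obtain f g d where "a = fr f g" "homogeneous d f" "homogeneous d g" "eval_mpoly g v \<noteq> 0" "admissible f g"
      using a by (rule fr_cases)
    with 0 fr_mem[of f g] vanishes_iff[OF x_proj v, of d f] show "\<exists>(f, g)\<in>a. vanishes f x"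
      by (auto simp: res_fr intro!: bexI[of _ "(f, g)"])
  qed
  then show ?thesis by (auto simp: max_ideal_def)
qed

text \<open>The ring is local: when the numerator does not vanish at v, exchanging numerator and
  denominator gives an admissible inverse.\<close>

lemma res_unit: "a \<in> carrier L \<Longrightarrow> res a \<noteq> 0 \<Longrightarrow> a \<in> Units L"
proof -
  assume a: "a \<in> carrier L" "res a \<noteq> 0"
  then obtain f g where fg: "a = fr f g" "admissible f g" by (auto simp: carrier_L)
  with a have gf: "admissible g f" by (auto simp: res_fr admissible_def)
  have "fr g f \<otimes>\<^bsub>L\<^esub> a = \<one>\<^bsub>L\<^esub>"
    using fg gf admissible_mult[OF gf fg(2)] by (simp add: fr_mult fr_one fr_eq_iff)
  with gf show ?thesis using a by (auto simp: Units_def L.m_comm intro!: bexI[of _ "fr g f"])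
qed

lemma max_ideal_ideal: "ideal (max_ideal X x) L"
  unfolding max_ideal_eq
proof (rule idealI)
  show "subgroup {a \<in> carrier L. res a = 0} (add_monoid L)"
  proof (rule L.add.subgroupI)
    fix a assume "a \<in> {a \<in> carrier L. res a = 0}"
    then show "\<ominus>\<^bsub>L\<^esub> a \<in> {a \<in> carrier L. res a = 0}" by simp
  qed (auto intro: exI[of _ "\<zero>\<^bsub>L\<^esub>"])
qed (auto simp: L.ring_axioms)

subsection \<open>The maximal ideal is finitely generated\<close>

definition lin :: "'i \<Rightarrow> ('i, 'k) mpoly" where
  "lin j = Poly_Mapping.single (Poly_Mapping.single j 1) 1"

lemma homogeneous_lin: "homogeneous 1 (lin j)"
  unfolding lin_def by (rule homogeneous_single) (simp add: lookup_single when_def)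

lemma eval_lin [simp]: "eval_mpoly (lin j) w = w j"
proof -
  have "(\<Prod>i\<in>UNIV. w i ^ Poly_Mapping.lookup (Poly_Mapping.single j (1::nat)) i) =
      (\<Prod>i\<in>UNIV. if i = j then w i else 1)"
    by (rule prod.cong) (auto simp: lookup_single when_def)
  then show ?thesis by (simp add: lin_def)
qed

lemma eval_power [simp]: "eval_mpoly (f ^ n) w = eval_mpoly f w ^ n"
  by (induction n) auto

lemma admissible_dehom: "homogeneous d f \<Longrightarrow> admissible f (lin i0 ^ d)"
  using homogeneous_power[OF homogeneous_lin, of d i0] v_i0 by (auto simp: admissible_def)

text \<open>The affine coordinate functions x_j / x_i0, shifted so that they vanish at the
  point.\<close>

definition lin_gen :: "'i \<Rightarrow> ('i, 'k) ratfun" where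
  "lin_gen j = fr (lin j) (lin i0) \<ominus>\<^bsub>L\<^esub> cst (v j)"

lemma admissible_lin [simp]: "admissible (lin j) (lin i0)"
  using homogeneous_lin v_i0 by (auto simp: admissible_def)

lemma lin_gen_closed [simp]: "lin_gen j \<in> carrier L"
  by (simp add: lin_gen_def fr_closed)

lemma res_lin_gen [simp]: "res (lin_gen j) = 0"
  using v_i0 by (simp add: lin_gen_def fr_closed res_fr)

lemma ideal_cong_mult:
  assumes "ideal I L" "a \<ominus>\<^bsub>L\<^esub> a' \<in> I" "b \<ominus>\<^bsub>L\<^esub> b' \<in> I"
    "a \<in> carrier L" "a' \<in> carrier L" "b \<in> carrier L" "b' \<in> carrier L"
  shows "a \<otimes>\<^bsub>L\<^esub> b \<ominus>\<^bsub>L\<^esub> a' \<otimes>\<^bsub>L\<^esub> b' \<in> I"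
proof -
  interpret I: ideal I L by fact
  have "a \<otimes>\<^bsub>L\<^esub> b \<ominus>\<^bsub>L\<^esub> a' \<otimes>\<^bsub>L\<^esub> b' = (a \<ominus>\<^bsub>L\<^esub> a') \<otimes>\<^bsub>L\<^esub> b \<oplus>\<^bsub>L\<^esub> a' \<otimes>\<^bsub>L\<^esub> (b \<ominus>\<^bsub>L\<^esub> b')"
    using assms(4-) by algebra
  then show ?thesis using assms by (simp add: I.I_l_closed I.I_r_closed I.a_closed)
qed

lemma ideal_cong_add:
  assumes "ideal I L" "a \<ominus>\<^bsub>L\<^esub> a' \<in> I" "b \<ominus>\<^bsub>L\<^esub> b' \<in> I"
    "a \<in> carrier L" "a' \<in> carrier L" "b \<in> carrier L" "b' \<in> carrier L"
  shows "(a \<oplus>\<^bsub>L\<^esub> b) \<ominus>\<^bsub>L\<^esub> (a' \<oplus>\<^bsub>L\<^esub> b') \<in> I"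
proof -
  interpret I: ideal I L by fact
  have "(a \<oplus>\<^bsub>L\<^esub> b) \<ominus>\<^bsub>L\<^esub> (a' \<oplus>\<^bsub>L\<^esub> b') = (a \<ominus>\<^bsub>L\<^esub> a') \<oplus>\<^bsub>L\<^esub> (b \<ominus>\<^bsub>L\<^esub> b')"
    using assms(4-) by algebra
  then show ?thesis using assms by (simp add: I.a_closed)
qed

text \<open>Modulo such an ideal each quotient x_j / x_i0 is congruent to the constant
  \<open>v j\<close>. Peeling one variable off the monomial at a time therefore replaces it by its
  value at v.\<close>

lemma dehom_monomial:
  assumes I: "ideal I L" "range lin_gen \<subseteq> I" and "(\<Sum>i\<in>UNIV. Poly_Mapping.lookup m i) = d"
  shows "fr (Poly_Mapping.single m c) (lin i0 ^ d) \<ominus>\<^bsub>L\<^esub> cst (eval_mpoly (Poly_Mapping.single m c) v) \<in> I"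
  using assms(3)
proof (induction d arbitrary: m)
  case 0
  then have "m = 0" by (intro poly_mapping_eqI) simp
  then show ?case using I(1) additive_subgroup.zero_closed ideal.axioms(1)
    by (fastforce simp: L.r_neg a_minus_def simp flip: cst_fr)
next
  case (Suc d)
  then obtain j where j: "Poly_Mapping.lookup m j > 0"
    by (metis gr0I old.nat.distinct(1) sum.neutral)
  define m' where "m' = m - Poly_Mapping.single j 1"
  have m: "m = m' + Poly_Mapping.single j 1"
    using j by (intro poly_mapping_eqI) (auto simp: m'_def lookup_add lookup_minus lookup_single when_def)
  then have m'_sum: "(\<Sum>i\<in>UNIV. Poly_Mapping.lookup m' i) = d"
    using Suc.prems by (simp add: lookup_add sum.distrib lookup_single when_def)
  have s: "Poly_Mapping.single m c = Poly_Mapping.single m' c * lin j"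
    by (simp add: mult_single m lin_def)
  have adm: "admissible (Poly_Mapping.single m' c) (lin i0 ^ d)"
    using m'_sum by (intro admissible_dehom homogeneous_single)
  have l: "fr (lin j) (lin i0) \<ominus>\<^bsub>L\<^esub> cst (v j) \<in> I"
    using I(2) by (auto simp: lin_gen_def)
  have "fr (Poly_Mapping.single m c) (lin i0 ^ Suc d) =
      fr (Poly_Mapping.single m' c) (lin i0 ^ d) \<otimes>\<^bsub>L\<^esub> fr (lin j) (lin i0)"
    unfolding s by (subst fr_mult[OF adm admissible_lin]) (simp add: mult.commute)
  moreover have "cst (eval_mpoly (Poly_Mapping.single m c) v) =
      cst (eval_mpoly (Poly_Mapping.single m' c) v) \<otimes>\<^bsub>L\<^esub> cst (v j)"
    unfolding s by (simp only: eval_mpoly_mult eval_lin cst_mult)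
  ultimately show ?case
    using ideal_cong_mult[OF I(1) Suc.IH[OF m'_sum] l] adm
    by (simp only: fr_closed cst_closed admissible_lin)
qed

lemma dehom:
  assumes I: "ideal I L" "range lin_gen \<subseteq> I" and f: "homogeneous d f"
  shows "fr f (lin i0 ^ d) \<ominus>\<^bsub>L\<^esub> cst (eval_mpoly f v) \<in> I"
proof -
  let ?m = "\<lambda>m. Poly_Mapping.single m (Poly_Mapping.lookup f m)"
  interpret I: ideal I L by fact
  have "fr (sum ?m A) (lin i0 ^ d) \<ominus>\<^bsub>L\<^esub> cst (eval_mpoly (sum ?m A) v) \<in> I"
    if "finite A" "A \<subseteq> Poly_Mapping.keys f" for A
    using that
  proof (induction A rule: finite_induct)
    case empty
    have adm: "admissible 0 (lin i0 ^ d)" by (rule admissible_dehom) simp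
    then have "fr 0 (lin i0 ^ d) = fr 0 1" by (subst fr_eq_iff) auto
    then show ?case using I.zero_closed by (simp flip: fr_zero add: a_minus_def)
  next
    case (insert m A)
    have deg: "homogeneous d (?m n)" if "n \<in> Poly_Mapping.keys f" for n
      using f that by (intro homogeneous_single) (auto simp: homogeneous_def)
    have adm: "admissible (?m m) (lin i0 ^ d)" "admissible (sum ?m A) (lin i0 ^ d)"
      using insert.prems deg by (intro admissible_dehom homogeneous_sum, blast)+
    have "admissible (?m m + sum ?m A) (lin i0 ^ d)"
      using insert.prems deg by (auto intro!: admissible_dehom homogeneous_sum homogeneous_add)
    then have "fr (?m m + sum ?m A) (lin i0 ^ d) = fr (?m m) (lin i0 ^ d) \<oplus>\<^bsub>L\<^esub> fr (sum ?m A) (lin i0 ^ d)"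
      unfolding fr_add[OF adm] using admissible_add[OF adm]
      by (subst fr_eq_iff) (auto simp: algebra_simps)
    moreover have "fr (?m m) (lin i0 ^ d) \<ominus>\<^bsub>L\<^esub> cst (eval_mpoly (?m m) v) \<in> I"
      using f insert.prems by (intro dehom_monomial[OF I]) (auto simp: homogeneous_def)
    moreover have "fr (sum ?m A) (lin i0 ^ d) \<ominus>\<^bsub>L\<^esub> cst (eval_mpoly (sum ?m A) v) \<in> I"
      using insert by auto
    ultimately have "fr (?m m + sum ?m A) (lin i0 ^ d) \<ominus>\<^bsub>L\<^esub> cst (eval_mpoly (?m m + sum ?m A) v) \<in> I"
      using ideal_cong_add[OF I(1)] adm by (simp only: eval_mpoly_add cst_add fr_closed cst_closed)
    then show ?case by (simp only: sum.insert[OF insert.hyps])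
  qed
  from this[of "Poly_Mapping.keys f"] show ?thesis by (simp add: poly_mapping_sum_single)
qed

text \<open>Factor f / g as (f / x_i0^d) * (x_i0^d / g): the first factor is congruent to f(v) = 0
  modulo the ideal generated by the shifted coordinates. The finite set of generators is what the
  application of Nakayama's lemma relies on.\<close>

lemma max_ideal_generated: "max_ideal X x = Idl\<^bsub>L\<^esub> (range lin_gen)"
proof
  let ?I = "Idl\<^bsub>L\<^esub> (range lin_gen)"
  have I: "ideal ?I L" "range lin_gen \<subseteq> ?I"
    by (auto intro!: L.genideal_ideal L.genideal_self)
  interpret I: ideal ?I L by fact
  show "max_ideal X x \<subseteq> ?I"
  proof
    fix a assume "a \<in> max_ideal X x"
    then have a: "a \<in> carrier L" "res a = 0" by (auto simp: max_ideal_eq)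
    from a(1) obtain f g d where fg: "a = fr f g" "homogeneous d f" "homogeneous d g"
      "eval_mpoly g v \<noteq> 0" "admissible f g" by (rule fr_cases)
    with a have f0: "eval_mpoly f v = 0" by (simp add: res_fr)
    have adm: "admissible f (lin i0 ^ d)" "admissible (lin i0 ^ d) g"
      using fg homogeneous_power[OF homogeneous_lin, of d i0]
      by (simp add: admissible_dehom) (use fg homogeneous_power[OF homogeneous_lin, of d i0] in \<open>auto simp: admissible_def\<close>)
    have "a = fr f (lin i0 ^ d) \<otimes>\<^bsub>L\<^esub> fr (lin i0 ^ d) g"
      unfolding fg fr_mult[OF adm] using fg(5) admissible_mult[OF adm] by (subst fr_eq_iff) auto
    moreover have "fr f (lin i0 ^ d) \<in> ?I"
      using dehom[OF I fg(2)] f0 adm by (simp add: a_minus_def fr_closed)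
    ultimately show "a \<in> ?I" using adm by (simp add: I.I_r_closed fr_closed)
  qed
  show "?I \<subseteq> max_ideal X x"
    by (rule L.genideal_minimal[OF max_ideal_ideal]) (auto simp: max_ideal_eq)
qed

end

section \<open>Nakayama's lemma and the uniformizer at a non-singular point\<close>

lemma (in ring) ideal_subset_sum:
  assumes "ideal I R" "ideal J R"
  shows "I \<subseteq> I <+> J" "J \<subseteq> I <+> J"
proof -
  interpret I: ideal I R by fact
  interpret J: ideal J R by fact
  show "I \<subseteq> I <+> J"
  proof
    fix a assume "a \<in> I"
    then have "a = a \<oplus> \<zero>" using I.Icarr by simp
    with \<open>a \<in> I\<close> show "a \<in> I <+> J" unfolding set_add_def' using J.zero_closed by blast
  qed
  show "J \<subseteq> I <+> J"
  proof
    fix a assume "a \<in> J"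
    then have "a = \<zero> \<oplus> a" using J.Icarr by simp
    with \<open>a \<in> J\<close> show "a \<in> I <+> J" unfolding set_add_def' using I.zero_closed by blast
  qed
qed

text \<open>Generators outside N are discarded one by one. For a generator u and the ideal N' of the
  others, the hypothesis yields u = n + c u with n in N' and c in M; as 1 - c is a unit, u already
  lies in N'.\<close>

lemma (in cring) nakayama:
  assumes M: "ideal M R" and N: "ideal N R"
    and units: "\<And>a. a \<in> M \<Longrightarrow> \<one> \<ominus> a \<in> Units R"
    and MN: "M \<subseteq> N <+> M \<cdot> M" and S: "finite S" and S_carr: "S \<subseteq> carrier R" and gen: "M = Idl (N \<union> S)"
  shows "M = N"
  using S S_carr gen
proof (induction S rule: finite_induct)
  case empty
  have "N \<subseteq> carrier R" using ideal.Icarr[OF N] by auto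
  then have "Idl N = N" using genideal_minimal[OF N, of N] genideal_self[of N] by auto
  with empty show ?case by simp
next
  case (insert u S)
  interpret M: ideal M R by fact
  interpret N: ideal N R by fact
  have carr: "N \<union> insert u S \<subseteq> carrier R"
    using insert.prems N.Icarr by auto
  define N' where "N' = Idl (N \<union> S)"
  have N'i: "ideal N' R" and N'sub: "N \<union> S \<subseteq> N'"
    using carr by (auto simp: N'_def intro!: genideal_ideal) (use genideal_self[of "N \<union> S"] in auto)
  interpret N': ideal N' R by fact
  have sub: "N \<union> insert u S \<subseteq> M"
    using genideal_self[OF carr] insert.prems(2) by simp
  then have N'M: "N' \<subseteq> M" unfolding N'_def by (intro genideal_minimal[OF M]) auto
  have u: "u \<in> carrier R" "u \<in> M" using carr sub by auto
  let ?P = "PIdl u"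
  have P: "ideal ?P R" by (rule cgenideal_ideal[OF u(1)])
  have "M \<subseteq> N' <+> ?P"
  proof -
    have "N' \<subseteq> N' <+> ?P" "?P \<subseteq> N' <+> ?P"
      using ideal_subset_sum[OF N'i P] by auto
    moreover have "u \<in> ?P" by (rule cgenideal_self[OF u(1)])
    ultimately have "N \<union> insert u S \<subseteq> N' <+> ?P"
      using N'sub by blast
    then show ?thesis
      unfolding insert.prems(2) by (rule genideal_minimal[OF add_ideals[OF N'i P]])
  qed
  then have M_form: "\<exists>n\<in>N'. \<exists>c\<in>carrier R. a = n \<oplus> c \<otimes> u" if "a \<in> M" for a
    using subsetD[OF \<open>M \<subseteq> N' <+> ?P\<close> that] by (auto simp: set_add_def' cgenideal_def)
  \<comment> \<open>The elements whose coefficient at u can be taken in M. This set contains N and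
    all products from M \<cdot> M and is closed under addition, so it contains u.\<close>
  define J where "J = {n \<oplus> c \<otimes> u | n c. n \<in> N' \<and> c \<in> M}"
  have J_add: "a \<oplus> b \<in> J" if "a \<in> J" "b \<in> J" for a b
  proof -
    from that obtain n c n' c' where *: "a = n \<oplus> c \<otimes> u" "b = n' \<oplus> c' \<otimes> u" "n \<in> N'" "c \<in> M" "n' \<in> N'" "c' \<in> M"
      by (auto simp: J_def)
    have "a \<oplus> b = (n \<oplus> n') \<oplus> (c \<oplus> c') \<otimes> u"
      unfolding * using *(3-) u N'.Icarr M.Icarr by algebra
    then show ?thesis using * N'.a_closed M.a_closed unfolding J_def by blast
  qed
  have "M \<cdot> M \<subseteq> J"
  proof
    fix a assume "a \<in> M \<cdot> M"
    then show "a \<in> J"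
    proof (induction rule: ideal_prod.induct)
      case (prod i j)
      then obtain n c where j: "j = n \<oplus> c \<otimes> u" "n \<in> N'" "c \<in> carrier R" using M_form by blast
      have "i \<otimes> j = i \<otimes> n \<oplus> (i \<otimes> c) \<otimes> u"
        unfolding j using j(2,3) prod(1) u N'.Icarr M.Icarr by algebra
      then show ?case using j prod(1) N'.I_l_closed M.I_r_closed M.Icarr unfolding J_def by blast
    qed (rule J_add)
  qed
  moreover have "N \<subseteq> J"
  proof
    fix n assume n: "n \<in> N"
    then have "n = n \<oplus> \<zero> \<otimes> u" using N.Icarr u by simp
    then show "n \<in> J" using n N'sub M.zero_closed unfolding J_def by blast
  qed
  ultimately have "u \<in> J"
    using subsetD[OF MN u(2)] J_add by (auto simp: set_add_def')
  then obtain n c where nc: "u = n \<oplus> c \<otimes> u" "n \<in> N'" "c \<in> M" by (auto simp: J_def)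
  have cR: "c \<in> carrier R" "n \<in> carrier R" using nc N'.Icarr M.Icarr by auto
  have "(\<one> \<ominus> c) \<otimes> u = u \<ominus> c \<otimes> u" using cR u by algebra
  also have "\<dots> = (n \<oplus> c \<otimes> u) \<ominus> c \<otimes> u" using nc(1) by simp
  also have "\<dots> = n" using cR u by algebra
  finally have "(\<one> \<ominus> c) \<otimes> u = n" .
  then have "u = inv (\<one> \<ominus> c) \<otimes> n"
    using units[OF nc(3)] u by (metis Units_closed Units_inv_closed Units_l_inv l_one m_assoc)
  then have "u \<in> N'"
    using units[OF nc(3)] nc(2) N'.I_l_closed by auto
  then have "M \<subseteq> N'"
    unfolding insert.prems(2) using N'sub by (intro genideal_minimal[OF N'i]) auto
  with N'M show ?case using insert.IH insert.prems by (simp add: N'_def)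
qed

context variety_point
begin

lemma range_lin_gen: "range lin_gen \<subseteq> max_ideal X x"
  by (auto simp: max_ideal_eq)

lemma one_minus_unit: "a \<in> max_ideal X x \<Longrightarrow> \<one>\<^bsub>L\<^esub> \<ominus>\<^bsub>L\<^esub> a \<in> Units L"
  by (rule res_unit) (simp_all add: max_ideal_eq)

text \<open>If z lifts a basis vector of the cotangent space, every element of the maximal ideal is
  a constant multiple of z up to the square of the ideal. Nakayama's lemma with N the ideal of z
  removes the error term.\<close>

lemma max_ideal_principal:
  assumes "cotangent_dim X x 1"
  obtains z where "z \<in> max_ideal X x" "z \<noteq> \<zero>\<^bsub>L\<^esub>" "\<And>a. a \<in> max_ideal X x \<Longrightarrow> \<exists>b\<in>carrier L. a = z \<otimes>\<^bsub>L\<^esub> b"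
proof -
  let ?m = "max_ideal X x"
  let ?M2 = "?m \<cdot>\<^bsub>L\<^esub> ?m"
  have M2: "ideal ?M2 L" by (rule L.ideal_prod_is_ideal[OF max_ideal_ideal max_ideal_ideal])
  interpret m: ideal ?m L by (rule max_ideal_ideal)
  interpret M2: ideal ?M2 L by (rule M2)
  interpret Q: cring "L Quot ?M2" by (rule M2.quotient_is_cring[OF L_cring])
  interpret q: ring_hom_ring L "L Quot ?M2" "(+>\<^bsub>L\<^esub>) ?M2" by (rule M2.rcos_ring_hom_ring)
  let ?q = "(+>\<^bsub>L\<^esub>) ?M2"
  have "Q.dimension (Suc 0) (range (\<lambda>c. ?q (cst c))) (?q ` ?m)"
    using assms unfolding cotangent_dim_def Let_def One_nat_def .
  \<comment> \<open>Dimension one unfolds into a line over the zero space, spanned by a single coset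
    V.\<close>
  then obtain V where V: "V \<in> carrier (L Quot ?M2)" "V \<noteq> \<zero>\<^bsub>L Quot ?M2\<^esub>"
    "?q ` ?m = Q.line_extension (range (\<lambda>c. ?q (cst c))) V {\<zero>\<^bsub>L Quot ?M2\<^esub>}"
  proof (cases rule: Q.dimension.cases)
    case (Suc_dim V E)
    from Suc_dim(4) have E: "E = {\<zero>\<^bsub>L Quot ?M2\<^esub>}" by (cases rule: Q.dimension.cases) simp_all
    show ?thesis by (rule that[of V]) (use Suc_dim(1-3) E in blast)+
  qed
  have mem: "W \<in> ?q ` ?m \<longleftrightarrow> (\<exists>c. W = ?q (cst c) \<otimes>\<^bsub>L Quot ?M2\<^esub> V)" for W
  proof -
    have "?q (cst c) \<otimes>\<^bsub>L Quot ?M2\<^esub> V \<oplus>\<^bsub>L Quot ?M2\<^esub> \<zero>\<^bsub>L Quot ?M2\<^esub> = ?q (cst c) \<otimes>\<^bsub>L Quot ?M2\<^esub> V" for c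
      by (rule Q.r_zero[OF Q.m_closed[OF q.hom_closed[OF cst_closed] V(1)]])
    note z = this
    show ?thesis
    proof
      assume "W \<in> ?q ` ?m"
      then obtain c where "W = ?q (cst c) \<otimes>\<^bsub>L Quot ?M2\<^esub> V \<oplus>\<^bsub>L Quot ?M2\<^esub> \<zero>\<^bsub>L Quot ?M2\<^esub>"
        unfolding V(3) Q.line_extension_mem_iff by blast
      then show "\<exists>c. W = ?q (cst c) \<otimes>\<^bsub>L Quot ?M2\<^esub> V" unfolding z by blast
    next
      assume "\<exists>c. W = ?q (cst c) \<otimes>\<^bsub>L Quot ?M2\<^esub> V"
      then obtain c where "W = ?q (cst c) \<otimes>\<^bsub>L Quot ?M2\<^esub> V \<oplus>\<^bsub>L Quot ?M2\<^esub> \<zero>\<^bsub>L Quot ?M2\<^esub>"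
        unfolding z by blast
      then show "W \<in> ?q ` ?m" unfolding V(3) Q.line_extension_mem_iff by blast
    qed
  qed
  \<comment> \<open>The coefficient 1 shows that the spanning vector itself comes from the maximal
    ideal and so can be lifted to z.\<close>
  have "V = ?q (cst 1) \<otimes>\<^bsub>L Quot ?M2\<^esub> V"
    by (simp only: cst_one q.hom_one Q.l_one[OF V(1)])
  then have "V \<in> ?q ` ?m" using mem by blast
  then obtain z where z: "z \<in> ?m" "V = ?q z" by blast
  have zL: "z \<in> carrier L" using z(1) by (rule m.Icarr)
  have "z \<noteq> \<zero>\<^bsub>L\<^esub>" using V(2) z(2) q.hom_zero by blast
  let ?P = "PIdl\<^bsub>L\<^esub> z"
  have P: "ideal ?P L" by (rule L.cgenideal_ideal[OF zL])
  have "?m = ?P"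
  proof (rule L.nakayama[OF max_ideal_ideal P])
    show "\<one>\<^bsub>L\<^esub> \<ominus>\<^bsub>L\<^esub> a \<in> Units L" if "a \<in> ?m" for a
      using that by (rule one_minus_unit)
    show "?m \<subseteq> ?P <+>\<^bsub>L\<^esub> ?M2"
    proof
      fix a assume a: "a \<in> ?m"
      then have aL: "a \<in> carrier L" by (rule m.Icarr)
      from a obtain c where c: "?q a = ?q (cst c) \<otimes>\<^bsub>L Quot ?M2\<^esub> ?q z" using mem z(2) by blast
      also have "\<dots> = ?q (cst c \<otimes>\<^bsub>L\<^esub> z)" by (rule q.hom_mult[symmetric, OF cst_closed zL])
      finally have "a \<ominus>\<^bsub>L\<^esub> cst c \<otimes>\<^bsub>L\<^esub> z \<in> ?M2"
        using L.quotient_eq_iff_same_a_r_cos[OF M2 aL L.m_closed[OF cst_closed zL]] by blast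
      moreover have "cst c \<otimes>\<^bsub>L\<^esub> z \<in> ?P" using cst_closed[of c] unfolding cgenideal_def by blast
      moreover have "a = cst c \<otimes>\<^bsub>L\<^esub> z \<oplus>\<^bsub>L\<^esub> (a \<ominus>\<^bsub>L\<^esub> cst c \<otimes>\<^bsub>L\<^esub> z)"
        using aL zL cst_closed[of c] by algebra
      ultimately show "a \<in> ?P <+>\<^bsub>L\<^esub> ?M2" unfolding set_add_def' by blast
    qed
    have "?m = Idl\<^bsub>L\<^esub> (?P \<union> range lin_gen)"
    proof
      have "?P \<union> range lin_gen \<subseteq> carrier L"
        using ideal.Icarr[OF P] lin_gen_closed by blast
      then have "ideal (Idl\<^bsub>L\<^esub> (?P \<union> range lin_gen)) L" "range lin_gen \<subseteq> Idl\<^bsub>L\<^esub> (?P \<union> range lin_gen)"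
        using L.genideal_ideal L.genideal_self by blast+
      then show "?m \<subseteq> Idl\<^bsub>L\<^esub> (?P \<union> range lin_gen)"
        unfolding max_ideal_generated by (rule L.genideal_minimal)
      have "?P \<subseteq> ?m" using z(1) by (rule L.cgenideal_minimal[OF max_ideal_ideal])
      then show "Idl\<^bsub>L\<^esub> (?P \<union> range lin_gen) \<subseteq> ?m"
        using range_lin_gen by (intro L.genideal_minimal[OF max_ideal_ideal] Un_least)
    qed
    then show "?m = Idl\<^bsub>L\<^esub> (?P \<union> range lin_gen)" .
    show "finite (range lin_gen)" by simp
    show "range lin_gen \<subseteq> carrier L" using lin_gen_closed by blast
  qed
  show ?thesis
  proof (rule that[OF z(1) \<open>z \<noteq> \<zero>\<^bsub>L\<^esub>\<close>])
    fix a assume "a \<in> ?m"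
    with \<open>?m = ?P\<close> obtain b where "b \<in> carrier L" "a = b \<otimes>\<^bsub>L\<^esub> z"
      unfolding cgenideal_def by blast
    then show "\<exists>b\<in>carrier L. a = z \<otimes>\<^bsub>L\<^esub> b" using L.m_comm[OF zL] by blast
  qed
qed

end

section \<open>Complete discrete valuation rings\<close>

text \<open>Both the local ring with its Taylor expansion and the power series ring with its
  coordinate are instances, so that the powers of the maximal ideal are computed once for the
  completion and once more for the valuation by the same lemma.\<close>

locale fps_ring = cring R for R (structure) +
  fixes T :: "'a \<Rightarrow> 'k::field fps" and z :: 'a
  assumes T_add: "a \<in> carrier R \<Longrightarrow> b \<in> carrier R \<Longrightarrow> T (a \<oplus> b) = T a + T b"
    and T_mult: "a \<in> carrier R \<Longrightarrow> b \<in> carrier R \<Longrightarrow> T (a \<otimes> b) = T a * T b"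
    and T_one: "T \<one> = 1"
    and z_closed: "z \<in> carrier R" and T_z: "T z = fps_X"
    and z_dvd: "a \<in> carrier R \<Longrightarrow> T a $ 0 = 0 \<Longrightarrow> \<exists>b\<in>carrier R. a = z \<otimes> b"
begin

abbreviation fil :: "nat \<Rightarrow> 'a set" where
  "fil n \<equiv> {a \<in> carrier R. \<forall>i<n. T a $ i = 0}"

abbreviation maxi :: "'a set" where "maxi \<equiv> {a \<in> carrier R. T a $ 0 = 0}"

lemma T_zero: "T \<zero> = 0"
  using T_add[of \<zero> \<zero>] by (metis add_cancel_left_right l_zero zero_closed)

lemma T_uminus: "a \<in> carrier R \<Longrightarrow> T (\<ominus> a) = - T a"
  using T_add[of "\<ominus> a" a] by (simp add: l_neg T_zero eq_neg_iff_add_eq_0)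

lemma T_minus: "a \<in> carrier R \<Longrightarrow> b \<in> carrier R \<Longrightarrow> T (a \<ominus> b) = T a - T b"
  by (simp add: a_minus_def T_add T_uminus)

text \<open>Orders of vanishing add under multiplication; conversely, an element of positive order
  splits off a factor z and loses exactly one order.\<close>

lemma ideal_pow_eq_fil: "ideal_pow R maxi n = fil n"
proof (induction n)
  case 0
  then show ?case by (simp add: ideal_pow_def)
next
  case (Suc n)
  have "maxi \<cdot> fil n = fil (Suc n)"
  proof (intro equalityI subsetI)
    fix a assume "a \<in> maxi \<cdot> fil n"
    then show "a \<in> fil (Suc n)"
    proof (induction rule: ideal_prod.induct)
      case (prod i j)
      have "(T i * T j) $ k = 0" if "k < Suc n" for k
        unfolding fps_mult_nth
      proof (rule sum.neutral, rule ballI)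
        fix l assume "l \<in> {0..k}"
        then show "T i $ l * T j $ (k - l) = 0"
          using prod that by (cases "l = 0") auto
      qed
      with prod show ?case by (simp add: T_mult)
    next
      case (sum s1 s2)
      then show ?case by (simp add: T_add)
    qed
  next
    fix a assume a: "a \<in> fil (Suc n)"
    then obtain b where b: "b \<in> carrier R" "a = z \<otimes> b" using z_dvd by auto
    have "T b $ i = 0" if "i < n" for i
    proof -
      have "T a $ Suc i = 0" using a that by simp
      then show ?thesis using b by (simp add: T_mult T_z z_closed)
    qed
    with b show "a \<in> maxi \<cdot> fil n"
      by (auto intro!: ideal_prod.prod simp: z_closed T_z)
  qed
  with Suc show ?case by (simp add: ideal_pow_def)
qed

lemma fil_ideal: "ideal (fil n) R"
proof (rule idealI)
  show "ring R" ..
  show "subgroup (fil n) (add_monoid R)"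
  proof (rule add.subgroupI)
    fix a assume "a \<in> fil n"
    then show "\<ominus> a \<in> fil n" by (simp add: T_uminus)
  next
    show "fil n \<noteq> {}" using T_zero by fastforce
  qed (auto simp: T_add)
  fix a x assume ax: "a \<in> fil n" "x \<in> carrier R"
  have "(T x * T a) $ k = 0" if "k < n" for k
    unfolding fps_mult_nth using ax that by (intro sum.neutral) auto
  then show "x \<otimes> a \<in> fil n" using ax by (simp add: T_mult)
  then show "a \<otimes> x \<in> fil n" using ax by (simp add: m_comm)
qed

end

section \<open>Completion of a ring with dense image in the power series\<close>

locale dense_fps_ring = fps_ring R T z
  for R (structure) and T :: "'a \<Rightarrow> 'k::field fps" and z +
  assumes approx: "\<exists>a\<in>carrier R. \<forall>i<n. T a $ i = f $ i"
begin

text \<open>By density these sets are exactly the cosets modulo \<open>fil n\<close>, each labelled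
  by the first n coefficients of a series.\<close>

definition jet :: "nat \<Rightarrow> 'k fps \<Rightarrow> 'a set" where
  "jet n f = {a \<in> carrier R. \<forall>i<n. T a $ i = f $ i}"

lemma coset_eq_jet:
  assumes "a \<in> carrier R"
  shows "fil n +> a = jet n (T a)"
proof (intro equalityI subsetI)
    fix b assume "b \<in> fil n +> a"
    then obtain h where "h \<in> fil n" "b = h \<oplus> a" unfolding a_r_coset_def' by blast
    with assms show "b \<in> jet n (T a)" by (simp add: jet_def T_add)
  next
    fix b assume b: "b \<in> jet n (T a)"
    then have "b \<ominus> a \<in> fil n" using assms by (simp add: jet_def T_minus)
    moreover have "b = (b \<ominus> a) \<oplus> a" using b assms by (simp add: jet_def a_minus_def a_assoc l_neg)
    ultimately show "b \<in> fil n +> a" unfolding a_r_coset_def' by blast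
qed

lemma fil_coset_add:
  assumes "a \<in> carrier R" "b \<in> carrier R"
  shows "(fil n +> a) <+> (fil n +> b) = fil n +> (a \<oplus> b)"
proof -
  interpret I: ideal "fil n" R by (rule fil_ideal)
  show ?thesis by (rule I.a_rcos_sum[OF assms])
qed

lemma jet_cong: "(\<And>i. i < n \<Longrightarrow> f $ i = g $ i) \<Longrightarrow> jet n f = jet n g"
  by (auto simp: jet_def)

lemma jet_ex:
  "\<exists>a. a \<in> carrier R \<and> jet n f = fil n +> a \<and> jet n f = jet n (T a) \<and> (\<forall>i<n. T a $ i = f $ i)"
proof -
  obtain a where a: "a \<in> carrier R" "\<And>i. i < n \<Longrightarrow> T a $ i = f $ i" using approx by blast
  then have "jet n f = jet n (T a)" by (intro jet_cong) simp
  with a show ?thesis using coset_eq_jet by blast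
qed

lemma fps_mult_cong_below:
  fixes f g f' g' :: "'c::comm_semiring_1 fps"
  assumes "\<And>i. i < n \<Longrightarrow> f $ i = f' $ i" "\<And>i. i < n \<Longrightarrow> g $ i = g' $ i" "i < n"
  shows "(f * g) $ i = (f' * g') $ i"
  unfolding fps_mult_nth using assms by (intro sum.cong) auto

definition embed :: "'k fps \<Rightarrow> nat \<Rightarrow> 'a set" where
  "embed f = (\<lambda>n. jet n f)"

lemma quot_carrier: "carrier (R Quot fil n) = range (jet n)"
proof
  show "carrier (R Quot fil n) \<subseteq> range (jet n)"
    by (auto simp: FactRing_def A_RCOSETS_def' coset_eq_jet)
  show "range (jet n) \<subseteq> carrier (R Quot fil n)"
  proof
    fix C assume "C \<in> range (jet n)"
    then obtain f where C: "C = jet n f" by blast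
    obtain a where "a \<in> carrier R" "jet n f = fil n +> a" using jet_ex by blast
    with C show "C \<in> carrier (R Quot fil n)" by (auto simp: FactRing_def A_RCOSETS_def')
  qed
qed

abbreviation completion where "completion \<equiv> adic_completion R maxi"

lemma completion_carrier: "carrier completion = range embed"
proof
  show "range embed \<subseteq> carrier completion"
    by (auto simp: adic_completion_def embed_def ideal_pow_eq_fil quot_carrier) (simp add: jet_def)
  show "carrier completion \<subseteq> range embed"
  proof
    fix s assume "s \<in> carrier completion"
    then have s: "\<And>n. s n \<in> range (jet n)" and dec: "\<And>n. s (Suc n) \<subseteq> s n"
      by (auto simp: adic_completion_def ideal_pow_eq_fil quot_carrier)
    have "\<exists>a. a \<in> carrier R \<and> s n = jet n (T a)" for n
      using s[of n] jet_ex by (metis (no_types, lifting) imageE)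
    then obtain a where a: "\<And>n. a n \<in> carrier R" "\<And>n. s n = jet n (T (a n))" by metis
    \<comment> \<open>Coefficient n is first determined by the coset at level \<open>Suc n\<close>,
      because level n only sees the coefficients below n.\<close>
    define f where "f = Abs_fps (\<lambda>n. T (a (Suc n)) $ n)"
    have "s n = jet n f" for n
      unfolding a(2)
    proof (rule jet_cong)
      fix i assume "i < n"
      then have "s n \<subseteq> s (Suc i)" by (intro lift_Suc_antimono_le[of s, OF dec]) simp
      moreover have "a n \<in> s n" using a(1) by (simp add: a(2) jet_def)
      ultimately have "a n \<in> jet (Suc i) (T (a (Suc i)))" using a(2) by blast
      then show "T (a n) $ i = f $ i" by (simp add: jet_def f_def)
    qed
    then have "s = embed f" by (auto simp: embed_def)
    then show "s \<in> range embed" by blast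
  qed
qed

lemma inj_embed: "inj embed"
proof (rule injI)
  fix f g assume *: "embed f = embed g"
  show "f = g"
  proof (rule fps_ext)
    fix n
    obtain a where a: "a \<in> carrier R" "\<And>i. i < Suc n \<Longrightarrow> T a $ i = f $ i" using approx by blast
    then have "a \<in> jet (Suc n) f" by (simp add: jet_def)
    moreover have "jet (Suc n) f = jet (Suc n) g" using * by (simp add: embed_def fun_eq_iff)
    ultimately have "a \<in> jet (Suc n) g" by simp
    then show "f $ n = g $ n" using a by (auto simp: jet_def)
  qed
qed

lemma embed_add: "embed f \<oplus>\<^bsub>completion\<^esub> embed g = embed (f + g)"
proof -
  have "jet n f <+> jet n g = jet n (f + g)" for n
  proof -
    obtain a where a: "a \<in> carrier R" "jet n f = fil n +> a" "\<And>i. i < n \<Longrightarrow> T a $ i = f $ i"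
      using jet_ex by blast
    obtain b where b: "b \<in> carrier R" "jet n g = fil n +> b" "\<And>i. i < n \<Longrightarrow> T b $ i = g $ i"
      using jet_ex by blast
    have "jet n f <+> jet n g = jet n (T (a \<oplus> b))"
      unfolding a(2) b(2) fil_coset_add[OF a(1) b(1)] using a(1) b(1) by (simp add: coset_eq_jet)
    also have "\<dots> = jet n (f + g)" by (rule jet_cong) (simp add: T_add a b)
    finally show ?thesis .
  qed
  then show ?thesis by (simp add: adic_completion_def embed_def ideal_pow_eq_fil FactRing_def)
qed

lemma embed_mult: "embed f \<otimes>\<^bsub>completion\<^esub> embed g = embed (f * g)"
proof -
  have "rcoset_mult R (fil n) (jet n f) (jet n g) = jet n (f * g)" for n
  proof -
    obtain a where a: "a \<in> carrier R" "jet n f = fil n +> a" "\<And>i. i < n \<Longrightarrow> T a $ i = f $ i"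
      using jet_ex by blast
    obtain b where b: "b \<in> carrier R" "jet n g = fil n +> b" "\<And>i. i < n \<Longrightarrow> T b $ i = g $ i"
      using jet_ex by blast
    have "rcoset_mult R (fil n) (jet n f) (jet n g) = jet n (T (a \<otimes> b))"
      unfolding a(2) b(2) ideal.rcoset_mult_add[OF fil_ideal a(1) b(1)] using a(1) b(1) by (simp add: coset_eq_jet)
    also have "\<dots> = jet n (f * g)"
    proof (rule jet_cong)
      fix i assume "i < n"
      then show "T (a \<otimes> b) $ i = (f * g) $ i"
        unfolding T_mult[OF a(1) b(1)] using a(3) b(3) by (rule fps_mult_cong_below[rotated 2])
    qed
    finally show ?thesis .
  qed
  then show ?thesis by (simp add: adic_completion_def embed_def ideal_pow_eq_fil FactRing_def)
qed

lemma embed_one: "\<one>\<^bsub>completion\<^esub> = embed 1"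
  by (auto simp: adic_completion_def embed_def ideal_pow_eq_fil FactRing_def coset_eq_jet T_one)

lemma embed_zero: "\<zero>\<^bsub>completion\<^esub> = embed 0"
  by (auto simp: adic_completion_def embed_def ideal_pow_eq_fil FactRing_def jet_def)

end

section \<open>Taylor expansion along a uniformizer\<close>

locale taylor = "domain" L for L (structure) +
  fixes res :: "'a \<Rightarrow> 'k::field" and cst :: "'k \<Rightarrow> 'a" and z :: 'a
  assumes res_add: "a \<in> carrier L \<Longrightarrow> b \<in> carrier L \<Longrightarrow> res (a \<oplus> b) = res a + res b"
    and res_mult: "a \<in> carrier L \<Longrightarrow> b \<in> carrier L \<Longrightarrow> res (a \<otimes> b) = res a * res b"
    and cst_closed [simp]: "cst c \<in> carrier L" and res_cst [simp]: "res (cst c) = c"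
    and cst_add: "cst (c + d) = cst c \<oplus> cst d" and cst_mult: "cst (c * d) = cst c \<otimes> cst d"
    and cst_one: "cst 1 = \<one>"
    and z [simp]: "z \<in> carrier L" "z \<noteq> \<zero>" and res_z [simp]: "res z = 0"
    and z_dvd: "a \<in> carrier L \<Longrightarrow> res a = 0 \<Longrightarrow> \<exists>b\<in>carrier L. a = z \<otimes> b"
begin

text \<open>The difference quotient (a - res a) / z; it is well defined because z is a nonzero
  element of a domain.\<close>

definition D :: "'a \<Rightarrow> 'a" where
  "D a = (THE b. b \<in> carrier L \<and> a = cst (res a) \<oplus> z \<otimes> b)"

lemma res_zero: "res \<zero> = 0"
  using res_add[of \<zero> \<zero>] by (metis add_cancel_left_right l_zero zero_closed)

lemma res_uminus: "a \<in> carrier L \<Longrightarrow> res (\<ominus> a) = - res a"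
  using res_add[of "\<ominus> a" a] by (simp add: l_neg res_zero eq_neg_iff_add_eq_0)

lemma D_unique:
  assumes "b \<in> carrier L" "a = cst (res a) \<oplus> z \<otimes> b"
  shows "D a = b"
  unfolding D_def
proof (rule the_equality)
  fix b' assume b': "b' \<in> carrier L \<and> a = cst (res a) \<oplus> z \<otimes> b'"
  with assms have "z \<otimes> b' \<oplus> cst (res a) = z \<otimes> b \<oplus> cst (res a)"
    by (metis a_comm cst_closed m_closed z(1))
  then have "z \<otimes> b' = z \<otimes> b" using assms b' by simp
  then show "b' = b" using assms b' m_lcancel[of z b' b] by simp
qed (use assms in auto)

lemma D:
  assumes "a \<in> carrier L"
  shows "D a \<in> carrier L" "a = cst (res a) \<oplus> z \<otimes> D a"
proof -
  have "res (a \<ominus> cst (res a)) = 0" using assms by (simp add: a_minus_def res_add res_uminus)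
  then obtain b where b: "b \<in> carrier L" "a \<ominus> cst (res a) = z \<otimes> b"
    using z_dvd[of "a \<ominus> cst (res a)"] assms by auto
  have "a = cst (res a) \<oplus> (a \<ominus> cst (res a))" using assms cst_closed[of "res a"] by algebra
  then have "a = cst (res a) \<oplus> z \<otimes> b" by (simp add: b)
  with D_unique[OF b(1) this] b(1) show "D a \<in> carrier L" "a = cst (res a) \<oplus> z \<otimes> D a" by auto
qed

definition T :: "'a \<Rightarrow> 'k fps" where
  "T a = Abs_fps (\<lambda>n. res ((D ^^ n) a))"

lemma T_0 [simp]: "T a $ 0 = res a"
  by (simp add: T_def)

lemma T_Suc [simp]: "T a $ Suc n = T (D a) $ n"
  by (simp add: T_def funpow_Suc_right del: funpow.simps)

lemma D_cst_add:
  assumes "b \<in> carrier L"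
  shows "D (cst c \<oplus> z \<otimes> b) = b"
  by (rule D_unique) (use assms in \<open>simp_all add: res_add res_mult\<close>)

lemma T_eq: "a \<in> carrier L \<Longrightarrow> T a = fps_const (res a) + fps_X * T (D a)"
  by (rule fps_ext, case_tac n) auto

lemma T_add:
  assumes "a \<in> carrier L" "b \<in> carrier L"
  shows "T (a \<oplus> b) = T a + T b"
proof -
  have "\<forall>a\<in>carrier L. \<forall>b\<in>carrier L. T (a \<oplus> b) $ n = T a $ n + T b $ n" for n
  proof (induction n)
    case (Suc n)
    show ?case
    proof (intro ballI)
      fix a b assume ab: "a \<in> carrier L" "b \<in> carrier L"
      have "a \<oplus> b = (cst (res a) \<oplus> z \<otimes> D a) \<oplus> (cst (res b) \<oplus> z \<otimes> D b)"
        using D(2)[OF ab(1)] D(2)[OF ab(2)] by simp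
      also have "\<dots> = (cst (res a) \<oplus> cst (res b)) \<oplus> z \<otimes> (D a \<oplus> D b)"
        using cst_closed[of "res a"] cst_closed[of "res b"] z(1) D(1)[OF ab(1)] D(1)[OF ab(2)] by algebra
      finally have "a \<oplus> b = cst (res a + res b) \<oplus> z \<otimes> (D a \<oplus> D b)" by (simp add: cst_add)
      then have "D (a \<oplus> b) = D a \<oplus> D b" using D_cst_add D(1) ab by simp
      then show "T (a \<oplus> b) $ Suc n = T a $ Suc n + T b $ Suc n" using Suc ab D(1) by simp
    qed
  qed (simp add: res_add)
  then show ?thesis using assms by (intro fps_ext) simp
qed

lemma T_cst: "T (cst c) = fps_const c"
proof -
  have D0: "D (cst c) = \<zero>" for c by (rule D_unique) auto
  have "cst 0 \<oplus> cst 0 = cst 0" by (simp flip: cst_add)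
  then have c0: "cst 0 = \<zero>" by (metis cst_closed add.l_cancel_one)
  have "D \<zero> = \<zero>" using D0[of 0] c0 by simp
  then have "(D ^^ n) \<zero> = \<zero>" for n by (induction n) auto
  then have "T \<zero> = 0" by (intro fps_ext) (simp add: T_def res_zero)
  then show ?thesis using T_eq[of "cst c"] D0 by simp
qed

text \<open>The difference quotient obeys the twisted Leibniz rule D(ab) = D(a) b + res(a) D(b),
  which is the recursion satisfied by the shifted coefficients of a product of series.\<close>

lemma T_mult:
  assumes "a \<in> carrier L" "b \<in> carrier L"
  shows "T (a \<otimes> b) = T a * T b"
proof -
  have "\<forall>a\<in>carrier L. \<forall>b\<in>carrier L. T (a \<otimes> b) $ n = (T a * T b) $ n" for n
  proof (induction n)
    case (Suc n)
    show ?case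
    proof (intro ballI)
      fix a b assume ab: "a \<in> carrier L" "b \<in> carrier L"
      have "a \<otimes> b = (cst (res a) \<oplus> z \<otimes> D a) \<otimes> b"
        using D(2)[OF ab(1)] by simp
      also have "\<dots> = cst (res a) \<otimes> b \<oplus> z \<otimes> (D a \<otimes> b)"
        using cst_closed[of "res a"] z(1) D(1)[OF ab(1)] ab by algebra
      also have "cst (res a) \<otimes> b = cst (res a) \<otimes> (cst (res b) \<oplus> z \<otimes> D b)"
        using D(2)[OF ab(2)] by simp
      also have "\<dots> \<oplus> z \<otimes> (D a \<otimes> b) = cst (res a) \<otimes> cst (res b) \<oplus> z \<otimes> (D a \<otimes> b \<oplus> cst (res a) \<otimes> D b)"
        using cst_closed[of "res a"] cst_closed[of "res b"] z(1) D(1)[OF ab(1)] D(1)[OF ab(2)] ab(2) by algebra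
      finally have "a \<otimes> b = cst (res a * res b) \<oplus> z \<otimes> (D a \<otimes> b \<oplus> cst (res a) \<otimes> D b)"
        by (simp add: cst_mult)
      then have "D (a \<otimes> b) = D a \<otimes> b \<oplus> cst (res a) \<otimes> D b"
        using D_cst_add[of "D a \<otimes> b \<oplus> cst (res a) \<otimes> D b"] D(1) ab by simp
      then have "T (a \<otimes> b) $ Suc n = (T (D a) * T b) $ n + (fps_const (res a) * T (D b)) $ n"
        using Suc ab D(1) by (simp add: T_add T_cst del: fps_mult_left_const_nth)
      also have "\<dots> = (T a * T b) $ Suc n"
        by (subst T_eq[OF ab(1)]) (simp add: distrib_right mult.assoc)
      finally show "T (a \<otimes> b) $ Suc n = (T a * T b) $ Suc n" .
    qed
  qed (simp add: res_mult)
  then show ?thesis using assms by (intro fps_ext) simp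
qed

text \<open>Any finite list of coefficients is realised by a polynomial in z with constant
  coefficients, assembled in the manner of Horner's scheme.\<close>

lemma dense_fps_ring: "dense_fps_ring L T z"
proof unfold_locales
  fix n and f :: "'k fps"
  show "\<exists>a\<in>carrier L. \<forall>i<n. T a $ i = f $ i"
  proof (induction n arbitrary: f)
    case (Suc n)
    obtain b where b: "b \<in> carrier L" "\<And>i. i < n \<Longrightarrow> T b $ i = fps_shift 1 f $ i" using Suc by blast
    have "T (cst (f $ 0) \<oplus> z \<otimes> b) $ i = f $ i" if "i < Suc n" for i
      using b that by (cases i) (simp_all add: D_cst_add res_add res_mult)
    with b show ?case by (intro bexI[of _ "cst (f $ 0) \<oplus> z \<otimes> b"]) auto
  qed auto
next
  show "T z = fps_X"
    using T_eq[of z] D_cst_add[of \<one> 0] T_cst[of 1] T_cst[of 0] T_mult[of z \<one>]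
  proof -
    have "cst 0 \<oplus> cst 0 = cst 0" by (simp flip: cst_add)
    then have "cst 0 = \<zero>" by (metis cst_closed add.l_cancel_one)
    then have "D z = \<one>" using D_cst_add[of \<one> 0] by simp
    then show ?thesis using T_eq[of z] T_cst[of 1] by (simp add: cst_one)
  qed
qed (use T_add T_mult z_dvd T_cst[of 1] in \<open>auto simp: cst_one\<close>)

end

subsection \<open>Rings of formal power series and their fraction fields\<close>

text \<open>The completion consists of sequences of cosets; transport along E lets all computations
  in it, and in its fraction field, take place with actual series.\<close>

locale fps_copy =
  fixes A (structure) and E :: "'k::field fps \<Rightarrow> 'a"
  assumes inj: "inj E" and carrier_eq: "carrier A = range E"
    and E_add: "E f \<oplus> E g = E (f + g)" and E_mult: "E f \<otimes> E g = E (f * g)"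
    and E_zero: "\<zero> = E 0" and E_one: "\<one> = E 1"
begin

lemma E_eq [simp]: "E f = E g \<longleftrightarrow> f = g"
  using inj by (auto dest: injD)

lemma E_closed [simp]: "E f \<in> carrier A"
  by (simp add: carrier_eq)

lemma cring: "cring A"
proof (rule cringI)
  show "abelian_group A"
  proof (rule abelian_groupI)
    fix x assume "x \<in> carrier A"
    then obtain f where "x = E f" by (auto simp: carrier_eq)
    then show "\<exists>y\<in>carrier A. y \<oplus> x = \<zero>" by (intro bexI[of _ "E (- f)"]) (simp_all add: E_add E_zero)
  qed (auto simp: carrier_eq E_add E_zero ac_simps)
  show "comm_monoid A"
    by (rule comm_monoidI) (auto simp: carrier_eq E_mult E_one ac_simps)
qed (auto simp: carrier_eq E_add E_mult distrib_right)

sublocale A: cring A by (rule cring)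

definition Ei :: "'a \<Rightarrow> 'k fps" where "Ei = the_inv E"

lemma Ei_E [simp]: "Ei (E f) = f"
  unfolding Ei_def by (rule the_inv_f_f[OF inj])

lemma E_Ei [simp]: "x \<in> carrier A \<Longrightarrow> E (Ei x) = x"
  by (auto simp: carrier_eq)

lemma E_Units_iff: "E f \<in> Units A \<longleftrightarrow> f $ 0 \<noteq> 0"
proof
  assume "E f \<in> Units A"
  then obtain g where "f * g = 1" by (auto simp: Units_def carrier_eq E_mult E_one)
  then have "(f * g) $ 0 = 1" by simp
  then show "f $ 0 \<noteq> 0" by auto
next
  assume "f $ 0 \<noteq> 0"
  then have "inverse f * f = 1" by (rule inverse_mult_eq_1)
  then show "E f \<in> Units A"
    by (auto simp: Units_def E_mult E_one mult.commute intro!: bexI[of _ "E (inverse f)"])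
qed

sublocale fps_ring A Ei "E fps_X"
proof unfold_locales
  fix a assume a: "a \<in> carrier A" "Ei a $ 0 = 0"
  then obtain f where f: "a = E f" by (auto simp: carrier_eq)
  with a have "f = fps_X * fps_shift 1 f"
    by (intro fps_ext) (auto simp: fps_X_mult_nth)
  with f show "\<exists>b\<in>carrier A. a = E fps_X \<otimes> b" by (intro bexI[of _ "E (fps_shift 1 f)"]) (simp_all add: E_mult)
qed (auto simp: carrier_eq E_add E_mult E_one)

lemma dvr_order_E:
  assumes "f \<noteq> 0"
  shows "dvr_order A (E f) = subdegree f"
proof -
  have "carrier A - Units A = maxi"
    by (auto simp: carrier_eq E_Units_iff)
  then have "dvr_order A (E f) = (GREATEST n. \<forall>i<n. f $ i = 0)"
    by (simp add: dvr_order_def ideal_pow_eq_fil)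
  also have "\<dots> = subdegree f"
  proof (rule Greatest_equality)
    fix n assume "\<forall>i<n. f $ i = 0"
    then show "n \<le> subdegree f" using assms nth_subdegree_nonzero not_le by blast
  qed (auto intro: nth_less_subdegree_zero)
  finally show ?thesis .
qed

definition quo :: "'a \<times> 'a \<Rightarrow> 'k fls" where
  "quo = (\<lambda>(a, b). fps_to_fls (Ei a) / fps_to_fls (Ei b))"

text \<open>The fibres of \<open>quo\<close> are the classes of \<open>frac_rel\<close>, so Laurent
  series label the elements of the fraction field.\<close>

definition FE :: "'k fls \<Rightarrow> ('a \<times> 'a) set" where
  "FE h = {p \<in> fracs A. quo p = h}"

lemma fracs_iff: "(a, b) \<in> fracs A \<longleftrightarrow> (\<exists>f g. a = E f \<and> b = E g \<and> g \<noteq> 0)"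
  by (auto simp: fracs_def carrier_eq E_zero)

lemma frac_rel_eq: "frac_rel A = {(p, q). p \<in> fracs A \<and> q \<in> fracs A \<and> quo p = quo q}"
proof -
  have "E f \<otimes> E g' = E f' \<otimes> E g \<longleftrightarrow> quo (E f, E g) = quo (E f', E g')" if "g \<noteq> 0" "g' \<noteq> 0" for f g f' g'
    using that by (simp add: quo_def E_mult frac_eq_eq flip: fls_times_fps_to_fls)
  then show ?thesis
    by (fastforce simp: frac_rel_def fracs_iff)
qed

lemma frac_class: "p \<in> fracs A \<Longrightarrow> frac_rel A `` {p} = FE (quo p)"
  by (auto simp: frac_rel_eq FE_def)

text \<open>A Laurent series has a pole of finite order, which a power of the variable
  clears.\<close>

lemma fls_quotient: "\<exists>f g. g \<noteq> 0 \<and> (h :: 'k fls) = fps_to_fls f / fps_to_fls g"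
proof -
  obtain n f where f: "h = fls_shift n (fps_to_fls f)"
    using fls_base_factor_to_fps_to_fls by (metis fls_conv_base_factor_to_fps_shift_subdegree)
  show ?thesis
  proof (cases "n \<ge> 0")
    case True
    have "h * fps_to_fls (fps_X ^ nat n) = fps_to_fls f"
      using True by (simp add: f fps_to_fls_power fls_X_power_times_conv_shift)
    moreover have "fps_to_fls (fps_X ^ nat n) \<noteq> (0 :: 'k fls)" by simp
    ultimately show ?thesis
      by (intro exI[of _ f] exI[of _ "fps_X ^ nat n"] conjI) (auto simp: nonzero_eq_divide_eq simp del: fps_to_fls_eq_0_iff)
  next
    case False
    then have "h = fps_to_fls (fps_X ^ nat (- n) * f) / fps_to_fls 1"
      by (simp add: f fls_times_fps_to_fls fps_to_fls_power fls_X_power_times_conv_shift)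
    then show ?thesis by (intro exI[of _ "fps_X ^ nat (- n) * f"] exI[of _ 1]) simp
  qed
qed

lemma FE_nonempty: "\<exists>f g. g \<noteq> 0 \<and> (E f, E g) \<in> FE h \<and> h = fps_to_fls f / fps_to_fls g"
  using fls_quotient[of h] by (auto simp: FE_def fracs_iff quo_def)

abbreviation K where "K \<equiv> frac_field A"

lemma K_carrier: "carrier K = range FE"
proof -
  have "carrier K = (\<lambda>p. FE (quo p)) ` fracs A"
    by (auto simp: frac_field_def quotient_def frac_class intro!: frac_class)
  also have "\<dots> = range FE"
  proof -
    have "FE h \<in> (\<lambda>p. FE (quo p)) ` fracs A" for h
      using FE_nonempty[of h] by (auto simp: FE_def image_iff)
    then show ?thesis by auto
  qed
  finally show ?thesis .
qed

lemma FE_inj: "inj FE"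
  using FE_nonempty by (intro injI) (force simp: FE_def)

lemma FE_op:
  assumes "\<And>f g f' g'. g \<noteq> 0 \<Longrightarrow> g' \<noteq> 0 \<Longrightarrow>
    F (E f, E g) (E f', E g') = FE (op (fps_to_fls f / fps_to_fls g) (fps_to_fls f' / fps_to_fls g'))"
  shows "(\<Union>p\<in>FE h. \<Union>q\<in>FE h'. F p q) = FE (op h h')"
proof -
  have *: "F p q = FE (op h h')" if "p \<in> FE h" "q \<in> FE h'" for p q
    using that assms by (cases p; cases q) (auto simp: FE_def fracs_iff quo_def)
  show ?thesis using FE_nonempty[of h] FE_nonempty[of h'] * by blast
qed

lemma FE_mult: "FE h \<otimes>\<^bsub>K\<^esub> FE h' = FE (h * h')"
  unfolding frac_field_def
  by (simp add: case_prod_beta, rule FE_op)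
    (simp add: E_mult frac_class fracs_iff quo_def fls_times_fps_to_fls)

lemma FE_add: "FE h \<oplus>\<^bsub>K\<^esub> FE h' = FE (h + h')"
  unfolding frac_field_def
  by (simp add: case_prod_beta, rule FE_op)
    (simp add: E_mult E_add frac_class fracs_iff quo_def fls_times_fps_to_fls add_frac_eq)

lemma FE_frac_of: "frac_of A (E f) = FE (fps_to_fls f)"
  unfolding frac_of_def by (subst frac_class) (auto simp: fracs_iff quo_def E_one)

lemma FE_one: "\<one>\<^bsub>K\<^esub> = FE 1"
  unfolding frac_field_def by simp (subst frac_class, auto simp: fracs_iff quo_def E_one)

lemma FE_zero: "\<zero>\<^bsub>K\<^esub> = FE 0"
  unfolding frac_field_def by simp (subst frac_class, auto simp: fracs_iff quo_def E_one E_zero)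

lemma frac_val_FE:
  assumes "h \<noteq> 0"
  shows "frac_val A (FE h) = fls_subdegree h"
proof -
  have "int (dvr_order A a) - int (dvr_order A b) = fls_subdegree h" if "(a, b) \<in> FE h" for a b
  proof -
    have "(a, b) \<in> fracs A" "quo (a, b) = h" using that by (auto simp: FE_def)
    then obtain f g where fg: "a = E f" "b = E g" "g \<noteq> 0" "h = fps_to_fls f / fps_to_fls g"
      unfolding fracs_iff by (auto simp: quo_def)
    with assms have "f \<noteq> 0" by auto
    with fg show ?thesis
      by (simp add: dvr_order_E fls_divide_subdegree fls_subdegree_fls_to_fps)
  qed
  moreover have "FE h \<noteq> {}" using FE_nonempty[of h] by blast
  ultimately have "(\<lambda>(a, b). int (dvr_order A a) - int (dvr_order A b)) ` FE h = {fls_subdegree h}"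
    by force
  then show ?thesis by (simp add: frac_val_def)
qed

lemma frac_of_range: "FE h \<in> frac_of A ` carrier A \<longleftrightarrow> fls_subdegree h \<ge> 0"
proof
  assume "FE h \<in> frac_of A ` carrier A"
  then obtain f where "FE h = FE (fps_to_fls f)" by (auto simp: carrier_eq FE_frac_of)
  then have "h = fps_to_fls f" using FE_inj by (auto dest: injD)
  then show "fls_subdegree h \<ge> 0" by (simp add: fls_subdegree_fls_to_fps_gt0)
next
  assume "fls_subdegree h \<ge> 0"
  then have "h = fps_to_fls (fls_regpart h)" by (simp add: fls_regpart_to_fls_trivial)
  then have "FE h = frac_of A (E (fls_regpart h))" by (simp add: FE_frac_of)
  then show "FE h \<in> frac_of A ` carrier A" by simp
qed

end

lemma local_field_laurent:
  fixes X :: "('i::finite, 'k::field) ppoint set"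
  assumes X: "nonsingular_projective_curve X" and x: "x \<in> X"
  shows "\<exists>E :: 'k fps \<Rightarrow> _. fps_copy (complete_local_ring X x) E"
proof -
  have var: "projective_variety X" using X by (simp add: nonsingular_projective_curve_def)
  have "x \<in> proj_space" using projective_variety_subset[OF var] x by blast
  then obtain v i0 where v: "v \<in> x" "v i0 = 1" by (rule proj_point_normalized)
  interpret variety_point X x v i0 using var x v by unfold_locales
  obtain d where "variety_dim X = enat d" "cotangent_dim X x d"
    using assms by (auto simp: nonsingular_projective_curve_def nonsingular_def)
  moreover have "variety_dim X = 1" using assms(1) by (simp add: nonsingular_projective_curve_def)
  ultimately have "cotangent_dim X x 1" by (metis enat.inject one_enat_def)
  then have "\<exists>z. z \<in> max_ideal X x \<and> z \<noteq> \<zero>\<^bsub>L\<^esub> \<and> (\<forall>a\<in>max_ideal X x. \<exists>b\<in>carrier L. a = z \<otimes>\<^bsub>L\<^esub> b)"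
    by (rule max_ideal_principal) blast
  then obtain z where z: "z \<in> max_ideal X x" "z \<noteq> \<zero>\<^bsub>L\<^esub>"
    and z_dvd: "\<And>a. a \<in> max_ideal X x \<Longrightarrow> \<exists>b\<in>carrier L. a = z \<otimes>\<^bsub>L\<^esub> b"
    by blast
  interpret D: "domain" L by (rule L_domain)
  have "taylor L res cst z"
    using z z_dvd unfolding max_ideal_eq
    by (intro taylor.intro L_domain taylor_axioms.intro) (simp_all add: cst_add cst_mult)
  then interpret T: taylor L res cst z .
  interpret D: dense_fps_ring L T.T z by (rule T.dense_fps_ring)
  have "max_ideal X x = D.maxi" by (simp only: max_ideal_eq T.T_0)
  then have "complete_local_ring X x = D.completion" by (simp only: complete_local_ring_def)
  moreover have "fps_copy D.completion D.embed"
    by (rule fps_copy.intro[OF D.inj_embed D.completion_carrier D.embed_add D.embed_mult D.embed_zero D.embed_one])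
  ultimately have "fps_copy (complete_local_ring X x) D.embed" by (simp only:)
  then show ?thesis by blast
qed

section \<open>Adjoining a root of a unit\<close>

lemma alg_aut_group:
  assumes S: "ring S" and \<iota>: "\<And>r. r \<in> carrier R \<Longrightarrow> \<iota> r \<in> carrier S"
  shows "group (alg_aut_group R \<iota> S)"
    and "g \<in> carrier (alg_aut_group R \<iota> S) \<longleftrightarrow>
      g \<in> Bij (carrier S) \<and> g \<in> ring_hom S S \<and> (\<forall>r\<in>carrier R. g (\<iota> r) = \<iota> r)"
    and "\<one>\<^bsub>alg_aut_group R \<iota> S\<^esub> = (\<lambda>s\<in>carrier S. s)"
proof -
  let ?H = "{g \<in> Bij (carrier S). g \<in> ring_hom S S \<and> (\<forall>r\<in>carrier R. g (\<iota> r) = \<iota> r)}"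
  have "subgroup ?H (BijGroup (carrier S))"
  proof (rule group.subgroupI[OF group_BijGroup])
    show "?H \<subseteq> carrier (BijGroup (carrier S))" by (auto simp: BijGroup_def)
    have "(\<lambda>s\<in>carrier S. s) \<in> ?H"
      using \<iota> id_Bij[of "carrier S"] ring.ring_simprules(1,5,6)[OF S]
      by (auto simp: ring_hom_def)
    then show "?H \<noteq> {}" by blast
  next
    fix g assume g: "g \<in> ?H"
    let ?i = "\<lambda>s\<in>carrier S. inv_into (carrier S) g s"
    have bij: "bij_betw g (carrier S) (carrier S)" using g by (auto simp: Bij_def)
    have i_g: "?i (g s) = s" if "s \<in> carrier S" for s
      using bij that by (simp add: bij_betw_inv_into_left bij_betwE)
    have surj: "\<exists>s'\<in>carrier S. s = g s'" if "s \<in> carrier S" for s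
      using bij that by (auto simp: bij_betw_def)
    have hom: "g \<in> ring_hom S S" using g by auto
    have "?i \<in> ring_hom S S"
    proof (rule ring_hom_memI)
      fix a b assume "a \<in> carrier S" "b \<in> carrier S"
      then obtain a' b' where ab: "a' \<in> carrier S" "a = g a'" "b' \<in> carrier S" "b = g b'"
        using surj by metis
      have m: "a \<otimes>\<^bsub>S\<^esub> b = g (a' \<otimes>\<^bsub>S\<^esub> b')" "a \<oplus>\<^bsub>S\<^esub> b = g (a' \<oplus>\<^bsub>S\<^esub> b')"
        using ab hom by (simp_all add: ring_hom_mult ring_hom_add)
      show "?i (a \<otimes>\<^bsub>S\<^esub> b) = ?i a \<otimes>\<^bsub>S\<^esub> ?i b" "?i (a \<oplus>\<^bsub>S\<^esub> b) = ?i a \<oplus>\<^bsub>S\<^esub> ?i b"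
        unfolding m using ab i_g ring.ring_simprules(1,5)[OF S] by (simp_all del: restrict_apply)
      show "?i a \<in> carrier S" unfolding ab(2) i_g[OF ab(1)] by (rule ab(1))
    next
      have o: "\<one>\<^bsub>S\<^esub> \<in> carrier S" using S by (rule ring.ring_simprules)
      show "?i \<one>\<^bsub>S\<^esub> = \<one>\<^bsub>S\<^esub>" using i_g[OF o] ring_hom_one[OF hom] by simp
    qed
    moreover have "?i (\<iota> r) = \<iota> r" if "r \<in> carrier R" for r
    proof -
      have e: "g (\<iota> r) = \<iota> r" using g that by blast
      show ?thesis using i_g[OF \<iota>[OF that]] unfolding e .
    qed
    moreover have "?i \<in> Bij (carrier S)" using g by (intro restrict_inv_into_Bij) auto
    ultimately show "inv\<^bsub>BijGroup (carrier S)\<^esub> g \<in> ?H"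
      using g by (simp add: inv_BijGroup)
  next
    fix g h assume gh: "g \<in> ?H" "h \<in> ?H"
    have hS: "h s \<in> carrier S" "g s \<in> carrier S" if "s \<in> carrier S" for s
      using gh that by (auto intro: ring_hom_closed)
    have homs: "g \<in> ring_hom S S" "h \<in> ring_hom S S" using gh by auto
    have "compose (carrier S) g h \<in> ring_hom S S"
    proof (rule ring_hom_memI)
      show "compose (carrier S) g h \<one>\<^bsub>S\<^esub> = \<one>\<^bsub>S\<^esub>"
        using homs ring.ring_simprules(6)[OF S] by (simp add: compose_def ring_hom_one)
    qed (use homs hS ring.ring_simprules(1,5)[OF S] in \<open>simp_all add: compose_def ring_hom_mult ring_hom_add\<close>)
    moreover have "compose (carrier S) g h (\<iota> r) = \<iota> r" if "r \<in> carrier R" for r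
      using gh \<iota>[OF that] that by (simp add: compose_def)
    moreover have "compose (carrier S) g h \<in> Bij (carrier S)" using gh by (simp add: compose_Bij)
    ultimately show "g \<otimes>\<^bsub>BijGroup (carrier S)\<^esub> h \<in> ?H"
      using gh by (simp add: BijGroup_def)
  qed
  from group.subgroup_imp_group[OF group_BijGroup this]
  show "group (alg_aut_group R \<iota> S)" by (simp add: alg_aut_group_def)
  show "g \<in> carrier (alg_aut_group R \<iota> S) \<longleftrightarrow>
      g \<in> Bij (carrier S) \<and> g \<in> ring_hom S S \<and> (\<forall>r\<in>carrier R. g (\<iota> r) = \<iota> r)"
    by (simp add: alg_aut_group_def)
  show "\<one>\<^bsub>alg_aut_group R \<iota> S\<^esub> = (\<lambda>s\<in>carrier S. s)"
    by (simp add: alg_aut_group_def BijGroup_def)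
qed

lemma alg_aut_mult:
  assumes "g \<in> carrier (alg_aut_group R \<iota> S)" "h \<in> carrier (alg_aut_group R \<iota> S)" "s \<in> carrier S"
  shows "(g \<otimes>\<^bsub>alg_aut_group R \<iota> S\<^esub> h) s = g (h s)"
  using assms by (simp add: alg_aut_group_def BijGroup_def compose_def)

lemma alg_aut_eqI:
  assumes "g \<in> carrier (alg_aut_group R \<iota> S)" "h \<in> carrier (alg_aut_group R \<iota> S)"
    "\<And>s. s \<in> carrier S \<Longrightarrow> g s = h s"
  shows "g = h"
proof (rule extensionalityI[of _ "carrier S"])
  show "g \<in> extensional (carrier S)" "h \<in> extensional (carrier S)"
    using assms(1,2) by (auto simp: alg_aut_group_def Bij_def)
qed (use assms(3) in auto)

text \<open>The base is an arbitrary commutative ring because the construction is used both over the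
  adeles and over each local field, and the two are then compared.\<close>

locale root_extension = UP_cring R P for R (structure) and P (structure) +
  fixes p :: nat and t :: 'a
  assumes p_pos: "p > 0" and t_closed [simp]: "t \<in> carrier R"
begin

abbreviation (input) I where "I \<equiv> root_ideal R p t"
abbreviation (input) S where "S \<equiv> root_ext R p t"
abbreviation (input) emb where "emb \<equiv> root_emb R p t"
definition cls :: "(nat \<Rightarrow> 'a) \<Rightarrow> (nat \<Rightarrow> 'a) set" where "cls f = I +>\<^bsub>P\<^esub> f"
definition rt :: "(nat \<Rightarrow> 'a) set" where "rt = cls (monom P \<one> 1)"
definition minpol :: "nat \<Rightarrow> 'a" where "minpol = monom P \<one> p \<ominus>\<^bsub>P\<^esub> monom P t 0"
definition short :: "(nat \<Rightarrow> 'a) \<Rightarrow> bool" where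
  "short f \<longleftrightarrow> f \<in> carrier P \<and> (\<forall>n\<ge>p. f n = \<zero>)"

lemma minpol_closed [simp]: "minpol \<in> carrier P"
  by (simp add: minpol_def)

lemma I_eq: "I = PIdl\<^bsub>P\<^esub> minpol"
  by (simp add: root_ideal_def minpol_def P_def)

lemma I_ideal: "ideal I P"
  unfolding I_eq by (rule P.cgenideal_ideal) simp

lemma S_def': "S = P Quot I"
  by (simp add: root_ext_def P_def)

lemma S_cring: "cring S"
  unfolding S_def' by (rule ideal.quotient_is_cring[OF I_ideal P.cring_axioms])

lemma cls_hom: "cls \<in> ring_hom P S"
  using ideal.rcos_ring_hom[OF I_ideal] by (simp add: S_def' cls_def[abs_def])

lemma emb_eq: "emb r = cls (monom P r 0)"
  by (simp add: root_emb_def cls_def P_def)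

lemma cls_closed [simp]: "f \<in> carrier P \<Longrightarrow> cls f \<in> carrier S"
  by (rule ring_hom_closed[OF cls_hom])

lemma emb_closed [simp]: "r \<in> carrier R \<Longrightarrow> emb r \<in> carrier S"
  by (simp add: emb_eq)

lemma rt_closed [simp]: "rt \<in> carrier S"
  by (simp add: rt_def)

lemma S_carrier: "carrier S = cls ` carrier P"
  by (auto simp: S_def' FactRing_def A_RCOSETS_def' cls_def)

lemma cls_eq_iff: "f \<in> carrier P \<Longrightarrow> g \<in> carrier P \<Longrightarrow> cls f = cls g \<longleftrightarrow> f \<ominus>\<^bsub>P\<^esub> g \<in> I"
  unfolding cls_def by (rule P.quotient_eq_iff_same_a_r_cos[OF I_ideal, symmetric])

lemma coeff_eq: "f \<in> carrier P \<Longrightarrow> coeff P f n = f n"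
  unfolding P_def UP_def by simp

lemma carrier_bound:
  assumes "f \<in> carrier P"
  shows "\<exists>n. \<forall>m>n. f m = \<zero>"
proof -
  have "f \<in> up R" using assms unfolding P_def UP_def by simp
  then obtain n where "bound \<zero> n f" using R.bound_upD by blast
  then show ?thesis by (auto simp: bound_def)
qed

lemma emb_hom: "emb \<in> ring_hom R S"
  using const_ring_hom ring_hom_trans[OF _ cls_hom]
  by (force simp: emb_eq[abs_def] comp_def)

text \<open>Division with remainder by the monic polynomial T^p - t, available over any commutative
  ring. Each induction step kills the top coefficient by subtracting a monomial multiple of
  \<open>minpol\<close>.\<close>

lemma short_rep:
  assumes "s \<in> carrier S"
  shows "\<exists>f. short f \<and> s = cls f"
proof -
  have *: "\<forall>f\<in>carrier P. (\<forall>k\<ge>n + p. f k = \<zero>) \<longrightarrow> (\<exists>g. short g \<and> cls f = cls g)" for n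
  proof (induction n)
    case 0
    then show ?case by (auto simp: short_def)
  next
    case (Suc n)
    show ?case
    proof (intro ballI impI)
      fix f assume f: "f \<in> carrier P" "\<forall>k\<ge>Suc n + p. f k = \<zero>"
      have fR: "f k \<in> carrier R" for k using coeff_closed[OF f(1)] f(1) by (simp add: coeff_eq)
      let ?m = "monom P (f (n + p)) n"
      let ?g = "f \<ominus>\<^bsub>P\<^esub> ?m \<otimes>\<^bsub>P\<^esub> minpol"
      have m: "?m \<in> carrier P" using fR by simp
      have prod: "?m \<otimes>\<^bsub>P\<^esub> minpol = monom P (f (n + p)) (n + p) \<ominus>\<^bsub>P\<^esub> monom P (f (n + p) \<otimes> t) n"
      proof -
        have "?m \<otimes>\<^bsub>P\<^esub> minpol = ?m \<otimes>\<^bsub>P\<^esub> monom P \<one> p \<ominus>\<^bsub>P\<^esub> ?m \<otimes>\<^bsub>P\<^esub> monom P t 0"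
          unfolding minpol_def using m monom_closed[OF R.one_closed, of p] monom_closed[OF t_closed, of 0]
          by (simp add: P.minus_eq P.r_distr P.r_minus)
        also have "?m \<otimes>\<^bsub>P\<^esub> monom P \<one> p = monom P (f (n + p)) (n + p)"
          using monom_mult[of "f (n + p)" \<one> n p] fR by simp
        also have "?m \<otimes>\<^bsub>P\<^esub> monom P t 0 = monom P (f (n + p) \<otimes> t) n"
          using monom_mult[of "f (n + p)" t n 0] fR by simp
        finally show ?thesis .
      qed
      have g: "?g \<in> carrier P" using f m by simp
      have "?g k = \<zero>" if "k \<ge> n + p" for k
      proof -
        have "?g k = coeff P ?g k" using coeff_eq[OF g] by simp
        also have "\<dots> = f k \<ominus> (coeff P (monom P (f (n + p)) (n + p)) k \<ominus> coeff P (monom P (f (n + p) \<otimes> t) n) k)"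
          unfolding prod using f(1) fR m by (simp add: coeff_eq[OF f(1)])
        also have "\<dots> = \<zero>"
          using that f(2) fR p_pos by (cases "k = n + p") (simp_all add: a_minus_def R.r_neg)
        finally show ?thesis .
      qed
      then obtain h where h: "short h" "cls ?g = cls h" using Suc g by blast
      have "?m \<otimes>\<^bsub>P\<^esub> minpol \<in> I" unfolding I_eq cgenideal_def using m by blast
      moreover have "f \<ominus>\<^bsub>P\<^esub> ?g = ?m \<otimes>\<^bsub>P\<^esub> minpol"
        using f(1) m minpol_closed P.ring_simprules by (simp add: P.minus_eq P.minus_add P.r_neg2)
      ultimately have "cls f = cls ?g" using f(1) g cls_eq_iff by simp
      with h show "\<exists>g. short g \<and> cls f = cls g" by auto
    qed
  qed
  obtain f where f: "f \<in> carrier P" "s = cls f" using assms by (auto simp: S_carrier)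
  obtain n where "\<forall>m>n. f m = \<zero>" using carrier_bound[OF f(1)] by blast
  then have "\<forall>k\<ge>Suc n + p. f k = \<zero>" by auto
  with *[of "Suc n"] f show ?thesis by blast
qed

text \<open>If the difference is q (T^p - t), its coefficients from index p on vanish, which says
  that q_n = t q_(n+p) for all n. A polynomial with this recursion is zero because its coefficients
  vanish far out.\<close>

lemma short_unique:
  assumes "short f" "short g" "cls f = cls g"
  shows "f = g"
proof -
  have fP: "f \<in> carrier P" and gP: "g \<in> carrier P" using assms by (auto simp: short_def)
  then have "f \<ominus>\<^bsub>P\<^esub> g \<in> I" using assms cls_eq_iff by simp
  then obtain q where q: "q \<in> carrier P" "f \<ominus>\<^bsub>P\<^esub> g = q \<otimes>\<^bsub>P\<^esub> minpol"
    unfolding I_eq cgenideal_def by blast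
  have rel: "coeff P q n = t \<otimes> coeff P q (n + p)" for n
  proof -
    have "q \<otimes>\<^bsub>P\<^esub> minpol = monom P \<one> p \<otimes>\<^bsub>P\<^esub> q \<ominus>\<^bsub>P\<^esub> monom P t 0 \<otimes>\<^bsub>P\<^esub> q"
      unfolding minpol_def using q(1) monom_closed[OF R.one_closed, of p] monom_closed[OF t_closed, of 0]
      by (simp add: P.minus_eq P.r_distr P.r_minus P.m_comm)
    then have "coeff P (f \<ominus>\<^bsub>P\<^esub> g) (n + p) =
        coeff P (monom P \<one> p \<otimes>\<^bsub>P\<^esub> q) (n + p) \<ominus> coeff P (monom P t 0 \<otimes>\<^bsub>P\<^esub> q) (n + p)"
      unfolding q(2) using q(1) by simp
    moreover have "coeff P (monom P \<one> p \<otimes>\<^bsub>P\<^esub> q) (n + p) = coeff P q n"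
      using coeff_monom_mult[OF R.one_closed q(1), of p n] q(1) by (simp add: add.commute)
    moreover have "coeff P (monom P t 0 \<otimes>\<^bsub>P\<^esub> q) (n + p) = t \<otimes> coeff P q (n + p)"
      using coeff_monom_mult[OF t_closed q(1), of 0 "n + p"] by simp
    moreover have "coeff P (f \<ominus>\<^bsub>P\<^esub> g) (n + p) = \<zero>"
      using assms fP gP by (simp add: short_def coeff_eq[OF fP] coeff_eq[OF gP])
    ultimately have "coeff P q n \<ominus> t \<otimes> coeff P q (n + p) = \<zero>" by simp
    then show ?thesis using q(1) by simp
  qed
  obtain N where N: "\<forall>m>N. coeff P q m = \<zero>" using carrier_bound[OF q(1)] coeff_eq[OF q(1)] by auto
  \<comment> \<open>A descending induction written upwards: each round pushes the range of vanishing
    coefficients down by at least one index, as p is positive.\<close>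
  have zero: "\<forall>n. n + k > N \<longrightarrow> coeff P q n = \<zero>" for k
  proof (induction k)
    case 0
    then show ?case using N by simp
  next
    case (Suc k)
    show ?case
    proof (intro allI impI)
      fix n assume "n + Suc k > N"
      then have "coeff P q (n + p) = \<zero>" using Suc p_pos by auto
      then show "coeff P q n = \<zero>" using rel[of n] by simp
    qed
  qed
  have "coeff P q n = \<zero>" for n using zero[of "Suc N"] by simp
  then have "q = \<zero>\<^bsub>P\<^esub>" using q(1) by (intro up_eqI) auto
  then have "f \<ominus>\<^bsub>P\<^esub> g = \<zero>\<^bsub>P\<^esub>" using q by simp
  then show "f = g" using fP gP by simp
qed

lemma emb_inj: "inj_on emb (carrier R)"
proof (rule inj_onI)
  fix a b assume ab: "a \<in> carrier R" "b \<in> carrier R" "emb a = emb b"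
  have "short (monom P r 0)" if "r \<in> carrier R" for r
  proof -
    have "monom P r 0 n = \<zero>" if "n \<ge> p" for n
      using \<open>r \<in> carrier R\<close> that p_pos coeff_eq[of "monom P r 0" n] coeff_monom[of r 0 n] by simp
    with that show ?thesis by (simp add: short_def)
  qed
  then have "monom P a 0 = monom P b 0" using ab by (intro short_unique) (simp_all add: emb_eq)
  then show "a = b" using ab monom_inj[of 0] by (auto dest: inj_onD)
qed

lemma rt_power: "rt [^]\<^bsub>S\<^esub> p = emb t"
proof -
  interpret S: cring S by (rule S_cring)
  interpret c: ring_hom_cring P S cls
    by (intro ring_hom_cringI P.cring_axioms S_cring cls_hom)
  have "rt [^]\<^bsub>S\<^esub> p = cls (monom P \<one> 1 [^]\<^bsub>P\<^esub> p)"
    unfolding rt_def by (rule c.hom_pow[symmetric]) simp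
  also have "monom P \<one> 1 [^]\<^bsub>P\<^esub> p = monom P \<one> p"
    using monom_pow[of \<one> 1 p] by simp
  also have "cls (monom P \<one> p) = cls (monom P t 0)"
  proof (subst cls_eq_iff)
    show "monom P \<one> p \<ominus>\<^bsub>P\<^esub> monom P t 0 \<in> I"
      unfolding I_eq using P.cgenideal_self[OF minpol_closed] by (simp add: minpol_def)
  qed simp_all
  finally show ?thesis by (simp add: emb_eq)
qed

lemma cls_short:
  assumes "short f"
  shows "cls f = (\<Oplus>\<^bsub>S\<^esub>i\<in>{..<p}. emb (f i) \<otimes>\<^bsub>S\<^esub> rt [^]\<^bsub>S\<^esub> i)"
proof -
  interpret S: cring S by (rule S_cring)
  interpret c: ring_hom_cring P S cls
    by (intro ring_hom_cringI P.cring_axioms S_cring cls_hom)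
  have f: "f \<in> carrier P" and f0: "\<forall>n\<ge>p. f n = \<zero>" using assms by (auto simp: short_def)
  have fR: "f k \<in> carrier R" for k using coeff_closed[OF f] f by (simp add: coeff_eq)
  have "deg R f \<le> p - 1"
    using f f0 p_pos by (intro deg_aboveI) (auto simp: coeff_eq)
  from up_repr_le[OF this f] have "f = (\<Oplus>\<^bsub>P\<^esub>i\<in>{..p - 1}. monom P (f i) i)"
    unfolding coeff_eq[OF f] by (rule sym)
  also have "{..p - 1} = {..<p}" using p_pos by auto
  finally have "cls f = cls (\<Oplus>\<^bsub>P\<^esub>i\<in>{..<p}. monom P (f i) i)" by (rule arg_cong)
  also have "\<dots> = (\<Oplus>\<^bsub>S\<^esub>i\<in>{..<p}. cls (monom P (f i) i))"
    using fR by (subst c.hom_finsum) (auto simp: comp_def)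
  also have "\<dots> = (\<Oplus>\<^bsub>S\<^esub>i\<in>{..<p}. emb (f i) \<otimes>\<^bsub>S\<^esub> rt [^]\<^bsub>S\<^esub> i)"
  proof (rule S.finsum_cong')
    fix i
    have "monom P (f i) i = monom P (f i) 0 \<otimes>\<^bsub>P\<^esub> monom P \<one> 1 [^]\<^bsub>P\<^esub> i"
      using monom_pow[of \<one> 1 i] monom_mult[of "f i" \<one> 0 i] fR by simp
    then show "cls (monom P (f i) i) = emb (f i) \<otimes>\<^bsub>S\<^esub> rt [^]\<^bsub>S\<^esub> i"
      using fR by (simp add: emb_eq rt_def)
  qed (use fR in auto)
  finally show ?thesis .
qed

lemma hom_short:
  assumes B: "cring B" and \<Phi>: "\<Phi> \<in> ring_hom S B" and f: "short f"
  shows "\<Phi> (cls f) = (\<Oplus>\<^bsub>B\<^esub>i\<in>{..<p}. \<Phi> (emb (f i)) \<otimes>\<^bsub>B\<^esub> \<Phi> rt [^]\<^bsub>B\<^esub> i)"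
proof -
  interpret S: cring S by (rule S_cring)
  interpret B: cring B by (rule B)
  interpret h: ring_hom_cring S B \<Phi>
    by (intro ring_hom_cringI B S_cring \<Phi>)
  have fR: "f k \<in> carrier R" for k using coeff_closed[of f] f by (simp add: coeff_eq short_def)
  show ?thesis
    unfolding cls_short[OF f] using fR
    by (subst h.hom_finsum) (auto simp: comp_def intro!: B.finsum_cong')
qed

lemma hom_eqI:
  assumes B: "cring B" and \<Phi>: "\<Phi> \<in> ring_hom S B" and \<Psi>: "\<Psi> \<in> ring_hom S B"
    and emb: "\<And>r. r \<in> carrier R \<Longrightarrow> \<Phi> (emb r) = \<Psi> (emb r)" and rt: "\<Phi> rt = \<Psi> rt"
    and s: "s \<in> carrier S"
  shows "\<Phi> s = \<Psi> s"
proof -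
  obtain f where f: "short f" "s = cls f" using short_rep[OF s] by blast
  have fR: "f k \<in> carrier R" for k using coeff_closed[of f] f by (simp add: coeff_eq short_def)
  show ?thesis
    unfolding f(2) hom_short[OF B \<Phi> f(1)] hom_short[OF B \<Psi> f(1)] rt emb[OF fR] ..
qed

text \<open>Universal property of the extension: evaluation at y kills \<open>minpol\<close> and
  hence factors through the quotient.\<close>

lemma hom_ex:
  assumes B: "cring B" and h: "h \<in> ring_hom R B" and y: "y \<in> carrier B" "y [^]\<^bsub>B\<^esub> p = h t"
  shows "\<exists>\<Phi>. \<Phi> \<in> ring_hom S B \<and> (\<forall>r\<in>carrier R. \<Phi> (emb r) = h r) \<and> \<Phi> rt = y"
proof -
  interpret S: cring S by (rule S_cring)
  interpret B: cring B by (rule B)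
  interpret h: ring_hom_cring R B h by (intro ring_hom_cringI R.cring_axioms B h)
  interpret U: UP_pre_univ_prop R B h P
    by (intro UP_pre_univ_prop.intro h.ring_hom_cring_axioms UP_cring_axioms) (rule P_def)
  define ev where "ev = eval R B h y"
  have ev: "ev \<in> ring_hom P B" unfolding ev_def by (rule U.eval_ring_hom[OF y(1)])
  interpret e: ring_hom_cring P B ev by (intro ring_hom_cringI P.cring_axioms B ev)
  have ev_const: "ev (monom P r 0) = h r" if "r \<in> carrier R" for r
    unfolding ev_def by (rule U.eval_const[OF y(1) that])
  have ev_monom: "ev (monom P \<one> n) = y [^]\<^bsub>B\<^esub> n" for n
    using U.eval_monom[OF R.one_closed y(1), of n] y by (simp add: ev_def)
  have "ev minpol = \<zero>\<^bsub>B\<^esub>"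
  proof -
    have "ev minpol = ev (monom P \<one> p) \<ominus>\<^bsub>B\<^esub> ev (monom P t 0)"
      unfolding minpol_def P.minus_eq B.minus_eq by simp
    then show ?thesis using y by (simp add: ev_monom ev_const B.r_neg B.minus_eq)
  qed
  then have ev_I: "ev q = \<zero>\<^bsub>B\<^esub>" if "q \<in> I" for q
    using that unfolding I_eq cgenideal_def by auto
  have ev_cong: "ev f = ev g" if "f \<in> carrier P" "g \<in> carrier P" "cls f = cls g" for f g
  proof -
    have "ev (f \<ominus>\<^bsub>P\<^esub> g) = \<zero>\<^bsub>B\<^esub>" using that cls_eq_iff ev_I by blast
    then show ?thesis using that by (simp add: P.minus_eq flip: B.minus_eq)
  qed
  define \<Phi> where "\<Phi> = (\<lambda>s. ev (SOME f. f \<in> carrier P \<and> s = cls f))"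
  have \<Phi>: "\<Phi> (cls f) = ev f" if "f \<in> carrier P" for f
  proof -
    define g where "g = (SOME g. g \<in> carrier P \<and> cls f = cls g)"
    have "g \<in> carrier P \<and> cls f = cls g"
      unfolding g_def by (rule someI[of _ f]) (use that in simp)
    then have "ev f = ev g" using ev_cong[OF that] by blast
    then show ?thesis unfolding \<Phi>_def g_def by simp
  qed
  have "\<Phi> \<in> ring_hom S B"
  proof (rule ring_hom_memI)
    fix a b assume "a \<in> carrier S" "b \<in> carrier S"
    then obtain f g where fg: "f \<in> carrier P" "g \<in> carrier P" "a = cls f" "b = cls g"
      unfolding S_carrier by blast
    have "a \<otimes>\<^bsub>S\<^esub> b = cls (f \<otimes>\<^bsub>P\<^esub> g)" "a \<oplus>\<^bsub>S\<^esub> b = cls (f \<oplus>\<^bsub>P\<^esub> g)"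
      using fg ring_hom_mult[OF cls_hom] ring_hom_add[OF cls_hom] by simp_all
    then show "\<Phi> (a \<otimes>\<^bsub>S\<^esub> b) = \<Phi> a \<otimes>\<^bsub>B\<^esub> \<Phi> b" "\<Phi> (a \<oplus>\<^bsub>S\<^esub> b) = \<Phi> a \<oplus>\<^bsub>B\<^esub> \<Phi> b" "\<Phi> a \<in> carrier B"
      using fg by (simp_all add: \<Phi>)
  next
    have "\<one>\<^bsub>S\<^esub> = cls \<one>\<^bsub>P\<^esub>" using ring_hom_one[OF cls_hom] by simp
    then show "\<Phi> \<one>\<^bsub>S\<^esub> = \<one>\<^bsub>B\<^esub>" by (simp add: \<Phi>)
  qed
  moreover have "\<Phi> (emb r) = h r" if "r \<in> carrier R" for r
    using that by (simp add: emb_eq \<Phi> ev_const)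
  moreover have "\<Phi> rt = y" using ev_monom[of 1] y by (simp add: rt_def \<Phi>)
  ultimately show ?thesis by blast
qed

end

section \<open>Roots of unity\<close>

lemma of_nat_prime_neq_0:
  assumes "prime p" "p \<noteq> CHAR('k::field)"
  shows "of_nat p \<noteq> (0 :: 'k)"
proof
  assume "of_nat p = (0 :: 'k)"
  then have "CHAR('k) dvd p" by (simp add: of_nat_eq_0_iff_char_dvd)
  with assms have "CHAR('k) = 1" by (auto simp: prime_nat_iff)
  moreover have "of_nat CHAR('k) = (0 :: 'k)" by (rule of_nat_CHAR)
  ultimately show False by simp
qed

text \<open>Take a root of 1 + w + ... + w^(p-1). It cannot be 1, since the value there is p, which
  is nonzero in the field.\<close>

lemma root_of_unity_exists:
  assumes "prime p" "of_nat p \<noteq> (0 :: 'k::alg_closed_field)"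
  shows "\<exists>w :: 'k. w ^ p = 1 \<and> w \<noteq> 1"
proof -
  have p: "p > 1" using assms(1) by (rule prime_gt_1_nat)
  have "\<exists>w :: 'k. (\<Sum>k\<le>p - 1. 1 * w ^ k) = 0"
    using p by (intro alg_closed) simp_all
  then obtain w :: 'k where w: "(\<Sum>k\<le>p - 1. 1 * w ^ k) = 0" by blast
  have "{..p - 1} = {..<p}" using p by auto
  with w have s: "(\<Sum>k<p. w ^ k) = 0" by simp
  have "w \<noteq> 1" using s assms(2) by auto
  moreover have "w ^ p - 1 = (w - 1) * (\<Sum>k<p. w ^ k)" by (rule power_diff_1_eq)
  ultimately show ?thesis using s by auto
qed

locale root_of_unity =
  fixes w :: "'f::field" and p :: nat
  assumes prime: "prime p" and w_power: "w ^ p = 1" and w_neq_1: "w \<noteq> 1" and p_neq_0: "of_nat p \<noteq> (0 :: 'f)"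
begin

lemma p_gt_1: "p > 1"
  using prime by (rule prime_gt_1_nat)

lemma w_neq_0 [simp]: "w \<noteq> 0"
proof
  assume "w = 0"
  then have "w ^ p = 0" using p_gt_1 by (simp add: power_0_left)
  with w_power show False by simp
qed

lemma w_power_eq_1_iff: "w ^ n = 1 \<longleftrightarrow> p dvd n"
proof
  assume 1: "w ^ n = 1"
  show "p dvd n"
  proof (rule ccontr)
    assume "\<not> p dvd n"
    then have "coprime n p" using prime_imp_coprime[OF prime] by (simp add: coprime_commute[of n])
    moreover have "n \<noteq> 0" using \<open>\<not> p dvd n\<close> by (metis dvd_0_right)
    \<comment> \<open>Bezout in the natural numbers: together with w^n = 1 and w^p = 1 this identity
      would give w = 1.\<close>
    ultimately obtain a b where "n * a = p * b + 1"
      using bezout_nat[of n p] by (auto simp: coprime_iff_gcd_eq_1)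
    then have "w ^ (n * a) = w ^ (p * b) * w" by simp
    then show False using 1 w_power w_neq_1 by (simp add: power_mult)
  qed
qed (auto simp: power_mult w_power elim!: dvdE)

lemma w_power_inj:
  assumes "i \<in> {1..p}" "j \<in> {1..p}" "w ^ i = w ^ j"
  shows "i = j"
  using assms
proof (induction i j rule: linorder_wlog)
  case (le i j)
  have "w ^ i * w ^ (j - i) = w ^ j" using le(1) by (simp flip: power_add)
  with le(4) have "w ^ i * w ^ (j - i) = w ^ i" by simp
  then have "p dvd j - i" by (simp add: w_power_eq_1_iff)
  moreover have "j - i < p" using le by auto
  ultimately show ?case using le(1) by (auto dest: nat_dvd_not_less)
qed auto

text \<open>Orthogonality of the characters of a cyclic group of order p. The summation runs over
  {1..p} rather than over residues from 0, to match the set on which the permutation groups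
  act.\<close>

lemma sum_powers: "(\<Sum>j\<in>{1..p}. w ^ (j * m)) = (if p dvd m then of_nat p else 0)"
proof (cases "p dvd m")
  case True
  then have "w ^ (j * m) = 1" for j by (simp add: w_power_eq_1_iff)
  then show ?thesis using True by simp
next
  case False
  define u where "u = w ^ m"
  have u: "u \<noteq> 1" "u ^ p = 1"
    using False w_power by (auto simp: u_def w_power_eq_1_iff simp flip: power_mult)
  have "(\<Sum>j\<in>{1..p}. w ^ (j * m)) = (\<Sum>j<p. u ^ Suc j)"
    by (rule sum.reindex_bij_witness[of _ Suc "\<lambda>j. j - 1"]) (auto simp: u_def mult.commute simp flip: power_mult)
  also have "\<dots> = u * (\<Sum>j<p. u ^ j)" by (simp add: sum_distrib_left)
  also have "(\<Sum>j<p. u ^ j) = 0"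
    using power_diff_1_eq[of u p] u by simp
  finally show ?thesis using False by simp
qed

text \<open>Testing a constant transform against a nontrivial character gives 0 on one side and p
  times the matching coefficient on the other.\<close>

lemma dft_const:
  assumes c: "\<And>j. j \<in> {1..p} \<Longrightarrow> (\<Sum>i<p. c i * w ^ (j * i)) = d" and k: "0 < k" "k < p"
  shows "c k = 0"
proof -
  \<comment> \<open>The exponent p - k represents -k, so that the orthogonality relation applies
    with natural exponents.\<close>
  have "(\<Sum>j\<in>{1..p}. w ^ (j * (p - k)) * (\<Sum>i<p. c i * w ^ (j * i))) =
      (\<Sum>j\<in>{1..p}. \<Sum>i<p. c i * w ^ (j * (i + (p - k))))"
    by (simp add: sum_distrib_left power_add distrib_left mult_ac)
  also have "\<dots> = (\<Sum>i<p. c i * (\<Sum>j\<in>{1..p}. w ^ (j * (i + (p - k)))))"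
    by (subst sum.swap) (simp add: sum_distrib_left)
  also have "\<dots> = (\<Sum>i<p. if i = k then c k * of_nat p else 0)"
  proof (rule sum.cong)
    fix i assume i: "i \<in> {..<p}"
    have "p dvd i + (p - k) \<longleftrightarrow> i = k"
    proof
      assume "p dvd i + (p - k)"
      then obtain q where q: "i + (p - k) = p * q" by (elim dvdE)
      have "i + (p - k) < p * 2" using i k by auto
      then have "q < 2" by (simp add: q)
      moreover have "q \<noteq> 0" using q k by (intro notI) simp
      ultimately have "q = 1" by simp
      with q k show "i = k" by simp
    qed (use k in auto)
    then show "c i * (\<Sum>j\<in>{1..p}. w ^ (j * (i + (p - k)))) = (if i = k then c k * of_nat p else 0)"
      unfolding sum_powers by simp
  qed simp
  also have "\<dots> = c k * of_nat p" using k by simp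
  finally have "c k * of_nat p = (\<Sum>j\<in>{1..p}. w ^ (j * (p - k)) * d)" using c by simp
  also have "\<dots> = (\<Sum>j\<in>{1..p}. w ^ (j * (p - k))) * d" by (simp add: sum_distrib_right)
  also have "\<dots> = 0"
    unfolding sum_powers using k nat_dvd_not_less[of "p - k" p] by simp
  finally show ?thesis using p_neq_0 by simp
qed

lemma dft_inj:
  assumes c: "\<And>j. j \<in> {1..p} \<Longrightarrow> (\<Sum>i<p. c i * w ^ (j * i)) = 0" and k: "k < p"
  shows "c k = 0"
proof -
  have c': "c i = 0" if "0 < i" "i < p" for i using dft_const[OF c] that by blast
  \<comment> \<open>At the index p every power of w is 1, and the coefficients with positive index
    are already known to vanish, so this value isolates \<open>c 0\<close>.\<close>
  have "(\<Sum>i<p. c i * w ^ (p * i)) = c 0"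
  proof -
    have "(\<Sum>i<p. c i * w ^ (p * i)) = (\<Sum>i\<in>{0}. c i * w ^ (p * i))"
      using p_gt_1 c' by (intro sum.mono_neutral_right) auto
    then show ?thesis by simp
  qed
  with c[of p] p_gt_1 have "c 0 = 0" by auto
  with c' k show ?thesis by (cases k) auto
qed

text \<open>Prescribed values at all p embeddings can be attained; this is what makes the unramified
  algebra fill the whole product of p factors.\<close>

lemma dft_surj:
  fixes b :: "nat \<Rightarrow> 'f"
  shows "\<exists>c. \<forall>j\<in>{1..p}. (\<Sum>i<p. c i * w ^ (j * i)) = b j"
proof -
  \<comment> \<open>The inverse discrete Fourier transform of b.\<close>
  define c where "c i = (\<Sum>l\<in>{1..p}. b l * inverse (w ^ l) ^ i) / of_nat p" for i
  have "(\<Sum>i<p. c i * w ^ (j * i)) = b j" if j: "j \<in> {1..p}" for j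
  proof -
    have geo: "(\<Sum>i<p. (inverse (w ^ l) * w ^ j) ^ i) = (if l = j then of_nat p else 0)"
      if l: "l \<in> {1..p}" for l
    proof (cases "l = j")
      case False
      define u where "u = inverse (w ^ l) * w ^ j"
      have pow: "(w ^ k) ^ p = 1" for k
      proof -
        have "(w ^ k) ^ p = (w ^ p) ^ k" by (simp add: mult.commute flip: power_mult)
        then show ?thesis by (simp add: w_power)
      qed
      have "u ^ p = 1" by (simp add: u_def power_mult_distrib power_inverse pow)
      moreover have "u \<noteq> 1"
        using False w_power_inj[OF l j] by (auto simp: u_def field_simps)
      ultimately have "(\<Sum>i<p. u ^ i) = 0" using power_diff_1_eq[of u p] by simp
      then show ?thesis using False by (simp add: u_def)
    qed simp
    have "c i * w ^ (j * i) = (\<Sum>l\<in>{1..p}. b l * (inverse (w ^ l) * w ^ j) ^ i) / of_nat p" for i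
      unfolding c_def power_mult power_mult_distrib times_divide_eq_left sum_distrib_right
      by (simp only: mult.assoc)
    then have "(\<Sum>i<p. c i * w ^ (j * i)) = (\<Sum>i<p. \<Sum>l\<in>{1..p}. b l * (inverse (w ^ l) * w ^ j) ^ i) / of_nat p"
      by (simp only: sum_divide_distrib)
    also have "\<dots> = (\<Sum>l\<in>{1..p}. b l * (\<Sum>i<p. (inverse (w ^ l) * w ^ j) ^ i)) / of_nat p"
      by (subst sum.swap) (simp add: sum_distrib_left)
    also have "\<dots> = (\<Sum>l\<in>{1..p}. if l = j then b j * of_nat p else 0) / of_nat p"
      using geo by (intro arg_cong2[of _ _ _ _ "(/)"] sum.cong) auto
    also have "\<dots> = b j" using j p_neq_0 by simp
    finally show ?thesis .
  qed
  then show ?thesis by blast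
qed

text \<open>The polynomial X^p - 1 has at most p roots in a field, and the powers of w already
  supply p different ones.\<close>

lemma root_cases:
  assumes "x ^ p = y ^ p" "y \<noteq> 0"
  shows "\<exists>j\<in>{1..p}. x = w ^ j * y"
proof -
  define q :: "'f poly" where "q = Polynomial.monom 1 p - 1"
  have deg: "degree q = p"
    using degree_add_eq_left[of "- 1" "Polynomial.monom (1 :: 'f) p"] p_gt_1
    by (simp add: q_def degree_monom_eq)
  then have q0: "q \<noteq> 0" using p_gt_1 by auto
  have roots: "{u. poly q u = 0} = {u. u ^ p = 1}" by (simp add: q_def poly_monom)
  have "card {u :: 'f. u ^ p = 1} \<le> p"
    using card_poly_roots_bound[OF q0] deg by (simp add: roots)
  moreover have "card ((\<lambda>j. w ^ j) ` {1..p}) = p"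
    using w_power_inj by (subst card_image) (auto intro!: inj_onI)
  moreover have "(\<lambda>j. w ^ j) ` {1..p} \<subseteq> {u. u ^ p = 1}"
  proof -
    have "(w ^ j) ^ p = (w ^ p) ^ j" for j by (simp add: mult.commute flip: power_mult)
    then show ?thesis by (auto simp: w_power)
  qed
  moreover have "finite {u :: 'f. u ^ p = 1}" using poly_roots_finite[OF q0] by (simp add: roots)
  ultimately have *: "(\<lambda>j. w ^ j) ` {1..p} = {u. u ^ p = 1}" by (intro card_seteq) auto
  have "(x / y) ^ p = 1" using assms by (simp add: power_divide)
  then have "x / y \<in> (\<lambda>j. w ^ j) ` {1..p}" using * by blast
  with assms(2) show ?thesis by (auto simp: field_simps)
qed

end

section \<open>Roots of Laurent series\<close>

lemma fps_power_cong_below: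
  fixes f g :: "'a::comm_ring_1 fps"
  assumes "\<And>i. i < n \<Longrightarrow> f $ i = g $ i" "i < n"
  shows "(f ^ m) $ i = (g ^ m) $ i"
proof -
  have "\<forall>i<n. (f ^ m) $ i = (g ^ m) $ i"
  proof (induction m)
    case (Suc m)
    show ?case
      unfolding power_Suc fps_mult_nth using assms(1) Suc by (auto intro!: sum.cong)
  qed simp
  with assms(2) show ?thesis by blast
qed

text \<open>The linear term of Hensel lifting. V^p - v^p is the product of V - v = e X^m with a
  cofactor, and only the constant term p v_0^(p-1) of the cofactor reaches coefficient m.\<close>

lemma fps_root_step:
  fixes v :: "'k::field fps"
  assumes m: "m > 0"
  shows "((v + fps_const e * fps_X ^ m) ^ p) $ m = (v ^ p) $ m + of_nat p * e * (v $ 0) ^ (p - 1)"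
proof -
  define V where "V = v + fps_const e * fps_X ^ m"
  have v0: "V $ 0 = v $ 0" using m by (simp add: fps_X_power_iff V_def)
  have "V ^ p - v ^ p = fps_const e * (fps_X ^ m * (\<Sum>i<p. v ^ (p - Suc i) * V ^ i))"
    by (simp add: power_diff_sumr2 mult.assoc V_def)
  then have "(V ^ p - v ^ p) $ m = e * (\<Sum>i<p. v ^ (p - Suc i) * V ^ i) $ 0"
    by (simp add: fps_X_power_mult_nth)
  also have "(\<Sum>i<p. v ^ (p - Suc i) * V ^ i) $ 0 = (\<Sum>i<p. (v $ 0) ^ (p - 1))"
    unfolding fps_sum_nth using v0
    by (intro sum.cong) (simp_all add: fps_nth_power_0 flip: power_add)
  finally show ?thesis by (simp add: algebra_simps V_def)
qed

lemma fps_root_exists: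
  fixes u :: "'k::alg_closed_field fps"
  assumes "of_nat p \<noteq> (0 :: 'k)" "u $ 0 \<noteq> 0"
  shows "\<exists>v. v ^ p = u"
proof -
  have p: "p > 0" using assms(1) by (cases p) auto
  obtain c where c: "c ^ p = u $ 0" using nth_root_exists[of p "u $ 0"] p by blast
  then have c0: "c \<noteq> 0" using assms(2) p by (metis power_0_left less_numeral_extra(3))
  define good where "good n v \<longleftrightarrow> v $ 0 = c \<and> (\<forall>i\<le>n. (v ^ p) $ i = u $ i)" for n and v :: "'k fps"
  have "\<exists>f. \<forall>n. good n (f n) \<and> (\<forall>i\<le>n. f (Suc n) $ i = f n $ i)"
  proof (rule dependent_nat_choice)
    show "\<exists>v. good 0 v" using c by (intro exI[of _ "fps_const c"]) (simp add: good_def fps_nth_power_0)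
  next
    fix v n assume v: "good n v"
    \<comment> \<open>The solution of the linear equation in \<open>fps_root_step\<close> that
      corrects coefficient \<open>Suc n\<close>; the division is possible since p and c are
      nonzero.\<close>
    define e where "e = (u $ Suc n - (v ^ p) $ Suc n) / (of_nat p * c ^ (p - 1))"
    define V where "V = v + fps_const e * fps_X ^ Suc n"
    have below: "V $ i = v $ i" if "i < Suc n" for i
      using that by (simp add: V_def fps_X_power_iff del: power_Suc)
    have v0: "v $ 0 = c" and vp: "i \<le> n \<Longrightarrow> (v ^ p) $ i = u $ i" for i
      using v by (simp_all add: good_def)
    have "(V ^ p) $ i = u $ i" if "i \<le> n" for i
      using fps_power_cong_below[of "Suc n" V v i p] below that vp by simp
    moreover have "(V ^ p) $ Suc n = u $ Suc n"
    proof -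
      have "of_nat p * e * c ^ (p - 1) = u $ Suc n - (v ^ p) $ Suc n"
        using assms(1) c0 by (simp add: e_def)
      then show ?thesis using fps_root_step[of "Suc n" v e p] unfolding V_def[symmetric] v0 by simp
    qed
    ultimately have "good (Suc n) V"
      using v0 below[of 0] by (simp add: good_def le_Suc_eq)
    with below show "\<exists>v'. good (Suc n) v' \<and> (\<forall>i\<le>n. v' $ i = v $ i)" by (intro exI[of _ V]) simp
  qed
  then obtain f where f: "\<And>n. good n (f n)" "\<And>n i. i \<le> n \<Longrightarrow> f (Suc n) $ i = f n $ i" by blast
  have stable: "i \<le> n \<Longrightarrow> f n $ i = f i $ i" for n i
  proof (induction n rule: dec_induct)
    case (step m)
    then show ?case using f(2)[of i m] by simp
  qed simp
  define v where "v = Abs_fps (\<lambda>n. f n $ n)"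
  have "(v ^ p) $ n = u $ n" for n
  proof -
    have "v $ i = f n $ i" if "i < Suc n" for i
      using stable[of i n] that by (simp add: v_def)
    then have "(v ^ p) $ n = (f n ^ p) $ n"
      by (intro fps_power_cong_below[of "Suc n" v "f n" n p]) simp_all
    then show ?thesis using f(1)[of n] by (simp add: good_def)
  qed
  then show ?thesis by (intro exI[of _ v] fps_ext)
qed

text \<open>After removing the power of the variable, a series with nonzero constant term is left,
  and it is a p-th power. Only the order of h can obstruct the existence of a root.\<close>

lemma fls_root_exists:
  fixes h :: "'k::alg_closed_field fls"
  assumes "of_nat p \<noteq> (0 :: 'k)" "h \<noteq> 0"
  shows "\<exists>v. h = fls_X_intpow (fls_subdegree h) * v ^ p"
proof -
  let ?u = "fls_base_factor_to_fps h"
  have "?u $ 0 \<noteq> 0" using assms(2) by simp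
  then obtain v where v: "v ^ p = ?u" using fps_root_exists[OF assms(1)] by blast
  have "h = fls_shift (- fls_subdegree h) (fps_to_fls ?u)"
    by (rule fls_conv_base_factor_to_fps_shift_subdegree)
  also have "\<dots> = fls_shift (- fls_subdegree h) (fps_to_fls (v ^ p))" by (simp only: v)
  also have "\<dots> = fls_X_intpow (fls_subdegree h) * fps_to_fls v ^ p"
    by (simp add: fls_X_intpow_times_conv_shift fps_to_fls_power)
  finally show ?thesis by blast
qed

lemma fls_compose_power_inj:
  assumes "d > 0" "fls_compose_power f d = fls_compose_power g d"
  shows "f = g"
proof (rule fls_eqI)
  fix n
  have "fls_compose_power f d $$ (int d * n) = fls_compose_power g d $$ (int d * n)" using assms(2) by simp
  then show "f $$ n = g $$ n" using assms(1) by (simp add: fls_nth_compose_power)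
qed

lemma fls_compose_power_nth_eq_0:
  assumes "d > 0" "fls_compose_power f d $$ n \<noteq> 0"
  shows "int d dvd n"
  using assms by (auto simp: fls_nth_compose_power split: if_splits)

lemma fls_compose_power_subdegree_dvd:
  assumes "d > 0" "f \<noteq> 0"
  shows "int d dvd fls_subdegree (fls_compose_power f d)"
proof -
  have "fls_compose_power f d \<noteq> 0" using fls_compose_power_inj[OF assms(1), of f 0] assms(2) by auto
  then have "fls_compose_power f d $$ fls_subdegree (fls_compose_power f d) \<noteq> 0" by simp
  then show ?thesis using fls_compose_power_nth_eq_0[OF assms(1)] by blast
qed

text \<open>Nonzero terms with distinct subdegrees cannot cancel.\<close>

lemma fls_sum_distinct_subdegree:
  fixes f :: "'b \<Rightarrow> 'k::field fls"
  assumes "finite A" "inj_on (\<lambda>i. fls_subdegree (f i)) {i \<in> A. f i \<noteq> 0}" "sum f A = 0" "i \<in> A"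
  shows "f i = 0"
proof (rule ccontr)
  assume "f i \<noteq> 0"
  define B where "B = {i \<in> A. f i \<noteq> 0}"
  have B: "finite B" "B \<noteq> {}" using assms \<open>f i \<noteq> 0\<close> by (auto simp: B_def)
  define m where "m = arg_min_on (\<lambda>i. fls_subdegree (f i)) B"
  have m: "m \<in> B" unfolding m_def by (rule arg_min_if_finite[OF B])
  have min: "fls_subdegree (f m) < fls_subdegree (f j)" if "j \<in> B" "j \<noteq> m" for j
  proof -
    have "fls_subdegree (f m) \<le> fls_subdegree (f j)"
      unfolding m_def by (rule arg_min_least[OF B that(1)])
    moreover have "fls_subdegree (f m) \<noteq> fls_subdegree (f j)"
      using assms(2) m that unfolding B_def[symmetric] by (auto dest: inj_onD)
    ultimately show ?thesis by simp
  qed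
  have "sum f A $$ fls_subdegree (f m) = (\<Sum>j\<in>A. f j $$ fls_subdegree (f m))"
    by (induction A rule: infinite_finite_induct) auto
  also have "\<dots> = (\<Sum>j\<in>{m}. f j $$ fls_subdegree (f m))"
  proof (rule sum.mono_neutral_right)
    show "\<forall>j\<in>A - {m}. f j $$ fls_subdegree (f m) = 0"
    proof
      fix j assume j: "j \<in> A - {m}"
      show "f j $$ fls_subdegree (f m) = 0"
      proof (cases "f j = 0")
        case False
        then show ?thesis using min[of j] j by (simp add: B_def)
      qed simp
    qed
  qed (use assms m in \<open>auto simp: B_def\<close>)
  also have "\<dots> \<noteq> 0" using m by (simp add: B_def)
  finally show False using assms(3) by simp
qed

section \<open>Permutations of prime order\<close>

text \<open>By Bezout, a power of s fixing a moved point has exponent divisible by p, so the orbit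
  of that point has p elements and is everything. A fixed point would lie in this orbit and would
  force its starting point to be fixed too.\<close>

lemma prime_order_perm:
  fixes s :: "nat \<Rightarrow> nat"
  assumes p: "prime p" and s: "s permutes {1..p}" and sp: "(s ^^ p) = id" and neq: "s \<noteq> id"
  shows "i \<in> {1..p} \<Longrightarrow> bij_betw (\<lambda>k. (s ^^ k) i) {..<p} {1..p}"
    and "i \<in> {1..p} \<Longrightarrow> s i \<noteq> i"
proof -
  have inS: "(s ^^ k) i \<in> {1..p}" if "i \<in> {1..p}" for i k
    using that permutes_in_image[OF s] by (induction k) auto
  have inj_pow: "inj (s ^^ k)" for k using permutes_inj[OF s] by (rule inj_fn)
  have orbit: "bij_betw (\<lambda>k. (s ^^ k) i) {..<p} {1..p}" if i: "i \<in> {1..p}" "s i \<noteq> i" for i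
  proof -
    have fixed: "p dvd n" if n: "(s ^^ n) i = i" for n
    proof (rule ccontr)
      assume "\<not> p dvd n"
      then have "coprime n p" using prime_imp_coprime[OF p] by (simp add: coprime_commute[of n])
      moreover have "n \<noteq> 0" using \<open>\<not> p dvd n\<close> by (metis dvd_0_right)
      ultimately obtain a b where ab: "n * a = p * b + 1"
        using bezout_nat[of n p] by (auto simp: coprime_iff_gcd_eq_1)
      have "((s ^^ n) ^^ a) i = i" using n by (induction a) auto
      moreover have "((s ^^ p) ^^ b) = id" by (simp add: sp)
      ultimately have "s i = i" using ab
        by (metis Suc_eq_plus1 comp_apply funpow.simps(2) funpow_mult id_apply mult.commute)
      with i show False by simp
    qed
    have "inj_on (\<lambda>k. (s ^^ k) i) {..<p}"
    proof (rule inj_onI)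
      fix a b assume "a \<in> {..<p}" "b \<in> {..<p}" "(s ^^ a) i = (s ^^ b) i"
      then show "a = b"
      proof (induction a b rule: linorder_wlog)
        case (le a b)
        have "(s ^^ a) ((s ^^ (b - a)) i) = (s ^^ a) i"
          using le by (metis comp_apply funpow_add le_add_diff_inverse)
        then have "(s ^^ (b - a)) i = i" using inj_pow by (auto dest: injD)
        then have "p dvd b - a" by (rule fixed)
        moreover have "b - a < p" using le by auto
        ultimately show ?case using le(1) by (auto dest: nat_dvd_not_less)
      qed auto
    qed
    moreover from this have "(\<lambda>k. (s ^^ k) i) ` {..<p} = {1..p}"
      using inS i by (intro card_subset_eq) (auto simp: card_image)
    ultimately show ?thesis by (simp add: bij_betw_def)
  qed
  obtain i0 where i0: "s i0 \<noteq> i0" using neq by (auto simp: fun_eq_iff)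
  then have i0S: "i0 \<in> {1..p}" using s by (meson permutes_not_in)
  show nofix: "s i \<noteq> i" if i: "i \<in> {1..p}" for i
  proof
    assume fix_i: "s i = i"
    have "i \<in> (\<lambda>k. (s ^^ k) i0) ` {..<p}" using orbit[OF i0S i0] i by (simp only: bij_betw_def)
    then obtain k where k: "i = (s ^^ k) i0" by auto
    have "(s ^^ k) (s i0) = (s ^^ k) i0" using fix_i k by (metis funpow_swap1)
    with inj_pow[of k] i0 show False by (auto dest: injD)
  qed
  show "bij_betw (\<lambda>k. (s ^^ k) i) {..<p} {1..p}" if "i \<in> {1..p}" using orbit nofix that by blast
qed

text \<open>The cycle is the orbit of 1 listed in order; s^p = id accounts for the step from its
  last entry back to the first.\<close>

lemma prime_order_perm_cycle:
  assumes p: "prime p" and s: "s permutes {1..p}" and sp: "(s ^^ p) = id" and neq: "s \<noteq> id"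
  shows "\<exists>cs. cycle cs \<and> set cs = {1..p} \<and> cycle_of_list cs = s"
proof -
  have p1: "p > 1" using p by (rule prime_gt_1_nat)
  define cs where "cs = map (\<lambda>k. (s ^^ k) 1) [0..<p]"
  have bij: "bij_betw (\<lambda>k. (s ^^ k) 1) {..<p} {1..p}"
    using prime_order_perm(1)[OF assms, of 1] p1 by simp
  have cyc: "cycle cs" using bij by (simp add: cs_def distinct_map bij_betw_def lessThan_atLeast0)
  have set: "set cs = {1..p}" using bij by (simp add: cs_def bij_betw_def lessThan_atLeast0)
  have len: "length cs = p" by (simp add: cs_def)
  have "cycle_of_list cs j = s j" for j
  proof (cases "j \<in> {1..p}")
    case True
    then have "j \<in> (\<lambda>k. (s ^^ k) 1) ` {..<p}" using bij by (simp only: bij_betw_def)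
    then obtain k where k: "k < p" "j = (s ^^ k) 1" by auto
    have "map (cycle_of_list cs) cs = rotate 1 cs" using cyclic_rotation[OF cyc, of 1] by simp
    then have "cycle_of_list cs (cs ! k) = rotate 1 cs ! k" using k len by (metis nth_map)
    also have "\<dots> = cs ! ((1 + k) mod p)" using k len by (subst nth_rotate) auto
    also have "\<dots> = (s ^^ ((1 + k) mod p)) 1" using p1 by (simp add: cs_def)
    also have "\<dots> = s j"
    proof (cases "Suc k = p")
      case True
      then have "s j = (s ^^ p) 1" using k by auto
      then show ?thesis using True by (simp add: sp)
    next
      case False
      then have "(1 + k) mod p = Suc k" using k by simp
      then show ?thesis using k by simp
    qed
    finally show ?thesis using k by (simp add: cs_def)
  next
    case False
    then show ?thesis using s set by (metis id_outside_supp permutes_not_in)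
  qed
  then show ?thesis using cyc set by (intro exI[of _ cs]) auto
qed

section \<open>Kummer extensions of a field of Laurent series\<close>

text \<open>Presents a type-class ring as a ring record, so that homomorphisms from quotient rings
  may take Laurent series as values.\<close>

definition type_ring :: "'b::comm_ring_1 ring" where
  "type_ring = \<lparr>carrier = UNIV, mult = (*), one = 1, zero = 0, add = (+)\<rparr>"

lemma type_ring_simps [simp]:
  "carrier type_ring = UNIV" "x \<otimes>\<^bsub>type_ring\<^esub> y = x * y" "x \<oplus>\<^bsub>type_ring\<^esub> y = x + y"
  "\<one>\<^bsub>type_ring\<^esub> = 1" "\<zero>\<^bsub>type_ring\<^esub> = 0"
  by (simp_all add: type_ring_def)

lemma type_ring_cring: "cring (type_ring :: 'b::comm_ring_1 ring)"
proof (rule cringI)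
  show "abelian_group (type_ring :: 'b ring)"
    by (rule abelian_groupI) (auto simp: ac_simps intro: exI[of _ "- _"])
  show "comm_monoid (type_ring :: 'b ring)"
    by (rule comm_monoidI) (auto simp: ac_simps)
qed (auto simp: distrib_right)

lemma type_ring_pow [simp]: "x [^]\<^bsub>type_ring\<^esub> (n::nat) = x ^ n"
proof -
  interpret cring "type_ring :: 'a ring" by (rule type_ring_cring)
  show ?thesis by (induction n) (simp_all add: mult.commute)
qed

lemma type_ring_finsum [simp]:
  fixes f :: "'a \<Rightarrow> 'b::comm_ring_1"
  shows "finsum type_ring f A = sum f A"
proof -
  interpret cring "type_ring :: 'b ring" by (rule type_ring_cring)
  show ?thesis by (induction A rule: infinite_finite_induct) simp_all
qed

locale fls_copy =
  fixes K (structure) and E :: "'k::field fls \<Rightarrow> 'a"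
  assumes inj: "inj E" and carrier_eq: "carrier K = range E"
    and E_add: "E f \<oplus> E g = E (f + g)" and E_mult: "E f \<otimes> E g = E (f * g)"
    and E_zero: "\<zero> = E 0" and E_one: "\<one> = E 1"
begin

lemma E_eq [simp]: "E f = E g \<longleftrightarrow> f = g"
  using inj by (auto dest: injD)

lemma E_closed [simp]: "E f \<in> carrier K"
  by (simp add: carrier_eq)

lemma K_cring: "cring K"
proof (rule cringI)
  show "abelian_group K"
  proof (rule abelian_groupI)
    fix x assume "x \<in> carrier K"
    then obtain f where "x = E f" by (auto simp: carrier_eq)
    then show "\<exists>y\<in>carrier K. y \<oplus> x = \<zero>" by (intro bexI[of _ "E (- f)"]) (simp_all add: E_add E_zero)
  qed (auto simp: carrier_eq E_add E_zero ac_simps)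
  show "comm_monoid K"
    by (rule comm_monoidI) (auto simp: carrier_eq E_mult E_one ac_simps)
qed (auto simp: carrier_eq E_add E_mult distrib_right)

sublocale K: cring K by (rule K_cring)

definition Ei :: "'a \<Rightarrow> 'k fls" where "Ei = the_inv E"

lemma Ei_E [simp]: "Ei (E f) = f"
  unfolding Ei_def by (rule the_inv_f_f[OF inj])

lemma E_Ei [simp]: "x \<in> carrier K \<Longrightarrow> E (Ei x) = x"
  by (auto simp: carrier_eq)

end

text \<open>The situation at one closed point: K is the local field, E identifies it with the
  Laurent series, and \<open>E h\<close> is the component of the idele whose root is
  adjoined.\<close>

locale kummer = fls_copy K E + root_of_unity w p
  for K (structure) and E :: "'k::alg_closed_field fls \<Rightarrow> 'a" and w :: 'k and p :: nat +
  fixes h :: "'k fls"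
  assumes h_neq_0: "h \<noteq> 0"
begin

abbreviation (input) t where "t \<equiv> E h"
abbreviation (input) S where "S \<equiv> root_ext K p t"
abbreviation (input) emb where "emb \<equiv> root_emb K p t"
abbreviation (input) TR :: "'k fls ring" where "TR \<equiv> type_ring"
abbreviation (input) Aut where "Aut \<equiv> alg_aut_group K emb S"

lemma p_pos: "p > 0" using p_gt_1 by simp

sublocale rx: root_extension K "UP K" p t
  by unfold_locales (simp_all add: p_pos)

definition W :: "'k fls" where "W = fls_const w"

sublocale W: root_of_unity W p
proof
  show "prime p" by (rule prime)
  show "W ^ p = 1" by (simp add: W_def w_power flip: fls_const_power)
  show "W \<noteq> 1" using w_neq_1 by (simp add: W_def)
  have "of_nat p = fls_const (of_nat p :: 'k)" by (simp add: fls_of_nat)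
  then show "of_nat p \<noteq> (0 :: 'k fls)" using p_neq_0 by simp
qed

abbreviation (input) comp :: "'k fls \<Rightarrow> 'k fls" where "comp f \<equiv> fls_compose_power f p"

lemma comp_eq_0_iff: "comp f = 0 \<longleftrightarrow> f = 0"
  using fls_compose_power_inj[OF p_pos, of f 0] by auto

lemma comp_W: "comp W = W"
  using p_pos by (simp add: W_def)

lemma comp_sum: "comp (sum f A) = (\<Sum>a\<in>A. comp (f a))"
  by (induction A rule: infinite_finite_induct) auto

text \<open>The image of this embedding is the field of series in z^p, over which z is a p-th root
  of the variable.\<close>

definition \<kappa> :: "'a \<Rightarrow> 'k fls" where "\<kappa> a = comp (Ei a)"

lemma \<kappa>_hom: "\<kappa> \<in> ring_hom K TR"
  using p_pos by (auto simp: ring_hom_def \<kappa>_def carrier_eq E_mult E_add E_one)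

definition v :: "'k fls" where "v = (SOME v. h = fls_X_intpow (fls_subdegree h) * v ^ p)"
text \<open>Substituting z^p into h = z^n v^p gives z^(np) v(z^p)^p, and y is the evident p-th root
  of it.\<close>

definition y :: "'k fls" where "y = fls_X_intpow (fls_subdegree h) * comp v"

lemma h_eq: "h = fls_X_intpow (fls_subdegree h) * v ^ p"
  unfolding v_def by (rule someI_ex[OF fls_root_exists[OF p_neq_0 h_neq_0]])

lemma v_neq_0: "v \<noteq> 0"
  using h_eq h_neq_0 p_pos by (auto simp: power_0_left)

lemma y_neq_0: "y \<noteq> 0"
  by (simp add: y_def v_neq_0 comp_eq_0_iff)

lemma y_power: "y ^ p = \<kappa> t"
proof -
  have "comp h = comp (fls_X_intpow (fls_subdegree h)) * comp v ^ p"
    using arg_cong[OF h_eq, of comp] p_pos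
    by (simp only: fls_compose_power_mult fls_compose_power_power simp_thms)
  then show ?thesis
    using p_pos by (simp add: \<kappa>_def y_def power_mult_distrib fls_X_intpow_power)
qed

text \<open>The indices 1 to p give all extensions of \<kappa>. Indices are not reduced modulo p,
  which leaves \<open>\<phi> (Suc j)\<close> available for describing a rotation.\<close>

definition \<phi> :: "nat \<Rightarrow> (nat \<Rightarrow> 'a) set \<Rightarrow> 'k fls" where
  "\<phi> j = (SOME \<Phi>. \<Phi> \<in> ring_hom S TR \<and> (\<forall>r\<in>carrier K. \<Phi> (emb r) = \<kappa> r) \<and> \<Phi> rx.rt = W ^ j * y)"

lemma W_power_p: "(W ^ j) ^ p = 1"
proof -
  have "(W ^ j) ^ p = (W ^ p) ^ j" by (simp add: mult.commute flip: power_mult)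
  then show ?thesis by (simp add: W.w_power)
qed

lemma \<phi>: "\<phi> j \<in> ring_hom S TR" "r \<in> carrier K \<Longrightarrow> \<phi> j (emb r) = \<kappa> r" "\<phi> j rx.rt = W ^ j * y"
proof -
  have "\<exists>\<Phi>. \<Phi> \<in> ring_hom S TR \<and> (\<forall>r\<in>carrier K. \<Phi> (emb r) = \<kappa> r) \<and> \<Phi> rx.rt = W ^ j * y"
    by (rule rx.hom_ex[OF type_ring_cring \<kappa>_hom])
      (simp_all add: power_mult_distrib W_power_p y_power)
  from someI_ex[OF this]
  show "\<phi> j \<in> ring_hom S TR" "r \<in> carrier K \<Longrightarrow> \<phi> j (emb r) = \<kappa> r" "\<phi> j rx.rt = W ^ j * y"
    unfolding \<phi>_def[symmetric] by blast+
qed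

lemma \<phi>_mult: "a \<in> carrier S \<Longrightarrow> b \<in> carrier S \<Longrightarrow> \<phi> j (a \<otimes>\<^bsub>S\<^esub> b) = \<phi> j a * \<phi> j b"
  using ring_hom_mult[OF \<phi>(1)] by simp

lemma \<phi>_add: "a \<in> carrier S \<Longrightarrow> b \<in> carrier S \<Longrightarrow> \<phi> j (a \<oplus>\<^bsub>S\<^esub> b) = \<phi> j a + \<phi> j b"
  using ring_hom_add[OF \<phi>(1)] by simp

lemma \<phi>_one: "\<phi> j \<one>\<^bsub>S\<^esub> = 1"
  using ring_hom_one[OF \<phi>(1)] by simp

lemma short_closed: "rx.short f \<Longrightarrow> f i \<in> carrier K"
  using rx.coeff_closed[of f i] by (simp add: rx.short_def rx.coeff_eq)

text \<open>As a function of j this is the discrete Fourier transform of the family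
  \<open>\<kappa> (f i) * y ^ i\<close>, so the inversion lemmas apply to the values of an element
  under the embeddings.\<close>

lemma \<phi>_cls: "rx.short f \<Longrightarrow> \<phi> j (rx.cls f) = (\<Sum>i<p. (\<kappa> (f i) * y ^ i) * W ^ (j * i))"
  unfolding power_mult
  by (subst rx.hom_short[OF type_ring_cring \<phi>(1)])
    (simp_all add: \<phi> short_closed power_mult_distrib mult_ac)

text \<open>The image of the adjoined root is a p-th root of y^p, hence W^j y for some j, and a
  homomorphism is determined by that image and by its restriction to the base.\<close>

lemma hom_cases:
  assumes "\<Psi> \<in> ring_hom S TR" "\<And>r. r \<in> carrier K \<Longrightarrow> \<Psi> (emb r) = \<kappa> r"
  shows "\<exists>j\<in>{1..p}. \<forall>s\<in>carrier S. \<Psi> s = \<phi> j s"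
proof -
  interpret S: cring S by (rule rx.S_cring)
  interpret H: ring_hom_cring S TR \<Psi> by (intro ring_hom_cringI rx.S_cring type_ring_cring assms(1))
  have "\<Psi> rx.rt ^ p = \<Psi> (rx.rt [^]\<^bsub>S\<^esub> p)" by (simp add: H.hom_pow)
  also have "\<dots> = y ^ p" by (simp add: rx.rt_power assms(2) y_power)
  finally obtain j where j: "j \<in> {1..p}" "\<Psi> rx.rt = W ^ j * y" using W.root_cases[OF _ y_neq_0] by blast
  have "\<Psi> s = \<phi> j s" if "s \<in> carrier S" for s
    by (rule rx.hom_eqI[OF type_ring_cring assms(1) \<phi>(1)]) (use that assms(2) \<phi> j in auto)
  with j show ?thesis by blast
qed

lemma \<phi>_eq_iff:
  assumes "i \<in> {1..p}" "j \<in> {1..p}"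
  shows "(\<forall>s\<in>carrier S. \<phi> i s = \<phi> j s) \<longleftrightarrow> i = j"
proof
  assume "\<forall>s\<in>carrier S. \<phi> i s = \<phi> j s"
  then have "W ^ i * y = W ^ j * y" using \<phi>(3) rx.rt_closed by metis
  then show "i = j" using W.w_power_inj[OF assms] y_neq_0 by simp
qed simp

lemma \<kappa>_eq_0_iff: "a \<in> carrier K \<Longrightarrow> \<kappa> a = 0 \<longleftrightarrow> a = \<zero>"
  by (auto simp: \<kappa>_def carrier_eq comp_eq_0_iff E_zero)

text \<open>A constant transform has no coefficients of positive index, so the normal form of s
  reduces to its constant term.\<close>

lemma \<phi>_const:
  assumes s: "s \<in> carrier S" and c: "\<And>j. j \<in> {1..p} \<Longrightarrow> \<phi> j s = d"
  shows "\<exists>a\<in>carrier K. s = emb a"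
proof -
  obtain f where f: "rx.short f" "s = rx.cls f" using rx.short_rep[OF s] by blast
  have "f k = \<zero>" if "0 < k" "k < p" for k
  proof -
    have "\<kappa> (f k) * y ^ k = 0"
      by (rule W.dft_const[OF _ that]) (use c f \<phi>_cls in simp)
    then show ?thesis using y_neq_0 \<kappa>_eq_0_iff short_closed[OF f(1)] by auto
  qed
  then have *: "f n = (if n = 0 then f 0 else \<zero>)" for n
    using f(1) by (cases "n < p") (auto simp: rx.short_def)
  have f0: "f 0 \<in> carrier K" by (rule short_closed[OF f(1)])
  have "f = (\<lambda>n. if n = 0 then f 0 else \<zero>)" by (rule ext) (rule *)
  also have "\<dots> = up_ring.monom (UP K) (f 0) 0" using f0 by (simp add: UP_def)
  finally have "rx.cls f = rx.cls (up_ring.monom (UP K) (f 0) 0)" by (rule arg_cong)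
  then have "s = emb (f 0)" by (simp only: f(2) rx.emb_eq)
  with f0 show ?thesis by blast
qed

text \<open>A vanishing transform has vanishing coefficients, and neither the factor y^k nor the
  substitution loses information.\<close>

lemma \<phi>_inj:
  assumes s: "s \<in> carrier S" "s' \<in> carrier S" and eq: "\<And>j. j \<in> {1..p} \<Longrightarrow> \<phi> j s = \<phi> j s'"
  shows "s = s'"
proof -
  obtain f g where f: "rx.short f" "s = rx.cls f" and g: "rx.short g" "s' = rx.cls g"
    using rx.short_rep s by meson
  have "f k = g k" if "k < p" for k
  proof -
    have "\<kappa> (f k) * y ^ k - \<kappa> (g k) * y ^ k = 0"
    proof (rule W.dft_inj[OF _ that])
      fix j assume "j \<in> {1..p}"
      then show "(\<Sum>i<p. (\<kappa> (f i) * y ^ i - \<kappa> (g i) * y ^ i) * W ^ (j * i)) = 0"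
        using eq[of j] f g by (simp add: \<phi>_cls left_diff_distrib sum_subtractf)
    qed
    then have "\<kappa> (f k) = \<kappa> (g k)" using y_neq_0 by simp
    then have "Ei (f k) = Ei (g k)" unfolding \<kappa>_def by (rule fls_compose_power_inj[OF p_pos])
    then show ?thesis using short_closed f g by (metis E_Ei)
  qed
  then have "f = g" using f(1) g(1) by (auto simp: rx.short_def fun_eq_iff) (metis not_le)
  with f g show ?thesis by simp
qed

subsection \<open>The action of automorphisms on the embeddings\<close>

lemma Aut_group: "group Aut"
  by (rule alg_aut_group(1)) (use rx.S_cring in \<open>auto simp: cring.axioms(1)\<close>)

lemma Aut_iff: "g \<in> carrier Aut \<longleftrightarrow>
    g \<in> Bij (carrier S) \<and> g \<in> ring_hom S S \<and> (\<forall>r\<in>carrier K. g (emb r) = emb r)"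
  by (rule alg_aut_group(2)) (use rx.S_cring in \<open>auto simp: cring.axioms(1)\<close>)

lemma Aut_one: "\<one>\<^bsub>Aut\<^esub> = (\<lambda>s\<in>carrier S. s)"
  by (rule alg_aut_group(3)) (use rx.S_cring in \<open>auto simp: cring.axioms(1)\<close>)

lemma Aut_closed: "g \<in> carrier Aut \<Longrightarrow> s \<in> carrier S \<Longrightarrow> g s \<in> carrier S"
  using Aut_iff ring_hom_closed by metis

lemma Aut_surj: "g \<in> carrier Aut \<Longrightarrow> s \<in> carrier S \<Longrightarrow> \<exists>s'\<in>carrier S. s = g s'"
  unfolding Aut_iff Bij_def bij_betw_def by blast

sublocale A: group Aut by (rule Aut_group)

lemma \<phi>_comp_hom:
  assumes "g \<in> ring_hom S S"
  shows "(\<lambda>s. \<phi> j (g s)) \<in> ring_hom S TR"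
  using ring_hom_trans[OF assms \<phi>(1)[of j]] by (simp add: comp_def)

text \<open>The index of the embedding obtained by composing \<open>\<phi> i\<close> with the
  inverse of g. The inverse makes \<rho> multiplicative instead of order-reversing and agrees with
  the convention in \<open>perm_identification\<close>. Off {1..p} the value is i, as
  \<open>permutes\<close> demands.\<close>

definition \<rho> :: "((nat \<Rightarrow> 'a) set \<Rightarrow> (nat \<Rightarrow> 'a) set) \<Rightarrow> nat \<Rightarrow> nat" where
  "\<rho> g i = (if i \<in> {1..p} then THE j. j \<in> {1..p} \<and> (\<forall>s\<in>carrier S. \<phi> j (g s) = \<phi> i s) else i)"

lemma \<rho>_ex1:
  assumes g: "g \<in> carrier Aut" and i: "i \<in> {1..p}"
  shows "\<exists>!j. j \<in> {1..p} \<and> (\<forall>s\<in>carrier S. \<phi> j (g s) = \<phi> i s)"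
proof -
  let ?g' = "inv\<^bsub>Aut\<^esub> g"
  have g': "?g' \<in> carrier Aut" using g by simp
  have "(\<lambda>s. \<phi> i (?g' s)) \<in> ring_hom S TR" using g' Aut_iff by (intro \<phi>_comp_hom) blast
  moreover have "\<phi> i (?g' (emb r)) = \<kappa> r" if "r \<in> carrier K" for r
    using g' that \<phi>(2) unfolding Aut_iff by simp
  ultimately obtain j where j: "j \<in> {1..p}" "\<And>s. s \<in> carrier S \<Longrightarrow> \<phi> i (?g' s) = \<phi> j s"
    using hom_cases by blast
  have "\<phi> j (g s) = \<phi> i s" if s: "s \<in> carrier S" for s
  proof -
    have "?g' (g s) = s"
      using alg_aut_mult[OF g' g s] A.l_inv[OF g] s by (simp add: Aut_one)
    then show ?thesis using j(2)[OF Aut_closed[OF g s]] by simp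
  qed
  moreover have "j' = j" if "j' \<in> {1..p}" "\<forall>s\<in>carrier S. \<phi> j' (g s) = \<phi> i s" for j'
  proof -
    have "\<phi> j' s = \<phi> j s" if "s \<in> carrier S" for s
      using Aut_surj[OF g that] \<open>\<forall>s\<in>carrier S. \<phi> j' (g s) = \<phi> i s\<close> calculation by auto
    then show ?thesis using \<phi>_eq_iff that(1) j(1) by blast
  qed
  ultimately show ?thesis using j(1) by blast
qed

lemma \<rho>:
  assumes g: "g \<in> carrier Aut" and i: "i \<in> {1..p}"
  shows "\<rho> g i \<in> {1..p}" "s \<in> carrier S \<Longrightarrow> \<phi> (\<rho> g i) (g s) = \<phi> i s"
  using theI'[OF \<rho>_ex1[OF assms]] i by (simp_all add: \<rho>_def)

lemma \<rho>_eqI: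
  assumes g: "g \<in> carrier Aut" and i: "i \<in> {1..p}" and j: "j \<in> {1..p}"
    and "\<And>s. s \<in> carrier S \<Longrightarrow> \<phi> j (g s) = \<phi> i s"
  shows "\<rho> g i = j"
  using \<rho>_ex1[OF g i] \<rho>[OF g i] j assms(4) by blast

lemma \<rho>_permutes:
  assumes g: "g \<in> carrier Aut"
  shows "\<rho> g permutes {1..p}"
proof -
  have "inj_on (\<rho> g) {1..p}"
  proof (rule inj_onI)
    fix i j assume ij: "i \<in> {1..p}" "j \<in> {1..p}" "\<rho> g i = \<rho> g j"
    then have "\<forall>s\<in>carrier S. \<phi> i s = \<phi> j s" using \<rho>(2)[OF g] by metis
    then show "i = j" using \<phi>_eq_iff ij by blast
  qed
  moreover have "\<rho> g ` {1..p} \<subseteq> {1..p}" using \<rho>(1)[OF g] by blast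
  ultimately have "bij_betw (\<rho> g) {1..p} {1..p}"
    by (simp add: bij_betw_def endo_inj_surj)
  then show ?thesis by (rule bij_imp_permutes) (simp add: \<rho>_def del: atLeastAtMost_iff)
qed

lemma \<rho>_mult:
  assumes g: "g \<in> carrier Aut" and g': "g' \<in> carrier Aut"
  shows "\<rho> (g \<otimes>\<^bsub>Aut\<^esub> g') = \<rho> g \<circ> \<rho> g'"
proof
  fix i
  show "\<rho> (g \<otimes>\<^bsub>Aut\<^esub> g') i = (\<rho> g \<circ> \<rho> g') i"
  proof (cases "i \<in> {1..p}")
    case True
    show ?thesis
    proof (rule \<rho>_eqI[OF A.m_closed[OF g g'] True])
      show "(\<rho> g \<circ> \<rho> g') i \<in> {1..p}" using \<rho>(1) g g' True by (simp del: atLeastAtMost_iff)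
      fix s assume "s \<in> carrier S"
      then show "\<phi> ((\<rho> g \<circ> \<rho> g') i) ((g \<otimes>\<^bsub>Aut\<^esub> g') s) = \<phi> i s"
        using \<rho>[OF g \<rho>(1)[OF g' True]] \<rho>[OF g' True] Aut_closed[OF g'] alg_aut_mult[OF g g'] by simp
    qed
  qed (auto simp: \<rho>_def)
qed

lemma \<rho>_hom: "\<rho> \<in> hom Aut (sym_group p)"
  using \<rho>_permutes \<rho>_mult by (auto simp: hom_def sym_group_def)

lemma \<rho>_inj: "inj_on \<rho> (carrier Aut)"
proof (rule inj_onI)
  fix g g' assume g: "g \<in> carrier Aut" and g': "g' \<in> carrier Aut" and eq: "\<rho> g = \<rho> g'"
  show "g = g'"
  proof (rule alg_aut_eqI[OF g g'])
    fix s assume s: "s \<in> carrier S"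
    show "g s = g' s"
    proof (rule \<phi>_inj)
      fix j assume "j \<in> {1..p}"
      then obtain i where i: "i \<in> {1..p}" "j = \<rho> g i"
        using permutes_image[OF \<rho>_permutes[OF g]] by blast
      then show "\<phi> j (g s) = \<phi> j (g' s)" using \<rho>(2)[OF g i(1) s] \<rho>(2)[OF g' i(1) s] eq by simp
    qed (use s g g' Aut_closed in auto)
  qed
qed

lemma \<rho>_pow: "g \<in> carrier Aut \<Longrightarrow> \<rho> (g [^]\<^bsub>Aut\<^esub> (n::nat)) = \<rho> g ^^ n"
proof (induction n)
  case 0
  \<comment> \<open>An idempotent permutation is the identity.\<close>
  have "\<rho> \<one>\<^bsub>Aut\<^esub> \<circ> \<rho> \<one>\<^bsub>Aut\<^esub> = \<rho> \<one>\<^bsub>Aut\<^esub>" using \<rho>_mult[of "\<one>\<^bsub>Aut\<^esub>" "\<one>\<^bsub>Aut\<^esub>"] by simp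
  then have "\<rho> \<one>\<^bsub>Aut\<^esub> (\<rho> \<one>\<^bsub>Aut\<^esub> i) = \<rho> \<one>\<^bsub>Aut\<^esub> i" for i by (metis comp_apply)
  then have "\<rho> \<one>\<^bsub>Aut\<^esub> i = i" for i
    using permutes_inj[OF \<rho>_permutes[of "\<one>\<^bsub>Aut\<^esub>"]] by (auto dest: injD)
  then show ?case by (simp add: fun_eq_iff)
next
  case (Suc n)
  then show ?case by (simp add: \<rho>_mult funpow_swap1 fun_eq_iff)
qed

lemma \<rho>_prime_order:
  assumes g: "g \<in> carrier Aut" and gp: "g [^]\<^bsub>Aut\<^esub> p = \<one>\<^bsub>Aut\<^esub>" and neq: "g \<noteq> \<one>\<^bsub>Aut\<^esub>"
  shows "\<rho> g permutes {1..p}" "\<rho> g ^^ p = id" "\<rho> g \<noteq> id"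
proof -
  have one: "\<rho> \<one>\<^bsub>Aut\<^esub> = id" using \<rho>_pow[OF g, of 0] by (simp add: id_def fun_eq_iff)
  show "\<rho> g permutes {1..p}" by (rule \<rho>_permutes[OF g])
  show "\<rho> g ^^ p = id" using \<rho>_pow[OF g, of p] gp one by simp
  show "\<rho> g \<noteq> id" using one neq inj_onD[OF \<rho>_inj, of g "\<one>\<^bsub>Aut\<^esub>"] g by auto
qed

lemma fixed_of_prime_order:
  assumes g: "g \<in> carrier Aut" "g [^]\<^bsub>Aut\<^esub> p = \<one>\<^bsub>Aut\<^esub>" "g \<noteq> \<one>\<^bsub>Aut\<^esub>"
    and s: "s \<in> carrier S" "g s = s"
  shows "\<exists>a\<in>carrier K. s = emb a"
proof (rule \<phi>_const[OF s(1)])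
  fix j assume j: "j \<in> {1..p}"
  have one: "1 \<in> {1..p}" using p_pos by simp
  have orb: "bij_betw (\<lambda>k. (\<rho> g ^^ k) 1) {..<p} {1..p}"
    by (rule prime_order_perm(1)[OF prime \<rho>_prime_order[OF g] one])
  have "(\<rho> g ^^ k) 1 \<in> {1..p} \<and> \<phi> ((\<rho> g ^^ k) 1) s = \<phi> 1 s" for k
  proof (induction k)
    case (Suc k)
    then have i: "(\<rho> g ^^ k) 1 \<in> {1..p}" and eq: "\<phi> ((\<rho> g ^^ k) 1) s = \<phi> 1 s" by blast+
    show ?case using \<rho>(1)[OF g(1) i] \<rho>(2)[OF g(1) i s(1)] unfolding s(2) eq by simp
  qed (use one in simp)
  moreover have "j \<in> (\<lambda>k. (\<rho> g ^^ k) 1) ` {..<p}" using orb j by (simp only: bij_betw_def)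
  ultimately show "\<phi> j s = \<phi> 1 s" by blast
qed

text \<open>Some embedding does not kill e, and in its target field the image of e cancels. So g and
  g' send the same index to that embedding, and the quotient of the two has a fixed index. Being of
  order dividing p, it must be trivial, since otherwise it would act as a p-cycle.\<close>

lemma idempotent_separates:
  assumes g: "g \<in> carrier Aut" "g' \<in> carrier Aut" "(inv\<^bsub>Aut\<^esub> g' \<otimes>\<^bsub>Aut\<^esub> g) [^]\<^bsub>Aut\<^esub> p = \<one>\<^bsub>Aut\<^esub>"
    and e: "e \<in> carrier S" "e \<otimes>\<^bsub>S\<^esub> e = e" "e \<noteq> \<zero>\<^bsub>S\<^esub>"
    and eq: "\<And>s. s \<in> carrier S \<Longrightarrow> g s \<otimes>\<^bsub>S\<^esub> e = g' s \<otimes>\<^bsub>S\<^esub> e"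
  shows "g = g'"
proof -
  interpret S: cring S by (rule rx.S_cring)
  let ?f = "inv\<^bsub>Aut\<^esub> g' \<otimes>\<^bsub>Aut\<^esub> g"
  have f: "?f \<in> carrier Aut" using g by simp
  have zero: "\<phi> j \<zero>\<^bsub>S\<^esub> = 0" for j
    using \<phi>_add[OF S.zero_closed S.zero_closed, of j] by (metis S.l_zero S.zero_closed add_cancel_left_right)
  obtain j where j: "j \<in> {1..p}" "\<phi> j e \<noteq> 0"
    using \<phi>_inj[OF e(1) S.zero_closed] e(3) zero by auto
  have "\<phi> j (g s) = \<phi> j (g' s)" if "s \<in> carrier S" for s
  proof -
    have "\<phi> j (g s) * \<phi> j e = \<phi> j (g' s) * \<phi> j e"
      using eq[OF that] \<phi>_mult e(1) Aut_closed[OF _ that] g by metis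
    then show ?thesis using j(2) by simp
  qed
  moreover obtain i i' where i: "i \<in> {1..p}" "j = \<rho> g i" "i' \<in> {1..p}" "j = \<rho> g' i'"
    using permutes_image[OF \<rho>_permutes[OF g(1)]] permutes_image[OF \<rho>_permutes[OF g(2)]] j(1) by blast
  ultimately have "\<forall>s\<in>carrier S. \<phi> i s = \<phi> i' s"
    using \<rho>(2)[OF g(1) i(1)] \<rho>(2)[OF g(2) i(3)] by metis
  then have "i = i'" using \<phi>_eq_iff i by blast
  have "g' \<otimes>\<^bsub>Aut\<^esub> ?f = g" using g by (simp add: A.m_assoc[symmetric])
  then have "\<rho> g' (\<rho> ?f i) = \<rho> g i" using \<rho>_mult[OF g(2) f] by (metis comp_apply)
  also have "\<dots> = \<rho> g' i" using i \<open>i = i'\<close> by simp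
  finally have fixi: "\<rho> ?f i = i" using permutes_inj[OF \<rho>_permutes[OF g(2)]] by (auto dest: injD)
  have "?f = \<one>\<^bsub>Aut\<^esub>"
  proof (rule ccontr)
    assume "?f \<noteq> \<one>\<^bsub>Aut\<^esub>"
    then have "\<rho> ?f i \<noteq> i"
      using prime_order_perm(2)[OF prime \<rho>_prime_order[OF f g(3)] i(1)] by blast
    with fixi show False by simp
  qed
  with g show ?thesis by (metis A.inv_closed A.inv_equality A.inv_inv)
qed

end

context kummer
begin

subsection \<open>The unramified case\<close>

text \<open>When p divides the order of h, this is a p-th root of h in the base field
  itself.\<close>

definition y0 :: "'k fls" where "y0 = fls_X_intpow (fls_subdegree h div int p) * v"

lemma y_unramified:
  assumes "int p dvd fls_subdegree h"
  shows "y = comp y0"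
  using assms p_pos by (simp add: y_def y0_def)

text \<open>Every ingredient of the Fourier form is now a series in z^p: the coefficients, the root
  y = y0(z^p), and the constant W.\<close>

lemma \<phi>_unramified:
  assumes "int p dvd fls_subdegree h" and s: "s \<in> carrier S"
  shows "\<phi> j s \<in> range comp"
proof -
  obtain f where f: "rx.short f" "s = rx.cls f" using rx.short_rep[OF s] by blast
  have "\<phi> j s = comp (\<Sum>i<p. (Ei (f i) * y0 ^ i) * W ^ (j * i))"
    unfolding f(2) \<phi>_cls[OF f(1)] comp_sum
    by (simp add: \<kappa>_def y_unramified[OF assms(1)] p_pos comp_W)
  then show ?thesis by blast
qed

text \<open>Undoing the substitution turns the p embeddings into p homomorphisms to K; they are the
  coordinates of the isomorphism with the product.\<close>

definition split :: "(nat \<Rightarrow> 'a) set \<Rightarrow> nat \<Rightarrow> 'a" where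
  "split s = (\<lambda>j\<in>{1..p}. E (the_inv comp (\<phi> j s)))"

lemma inj_comp: "inj comp"
  using fls_compose_power_inj[OF p_pos] by (auto intro: injI)

context
  assumes unram: "int p dvd fls_subdegree h"
begin

lemma comp_split:
  assumes "s \<in> carrier S" "j \<in> {1..p}"
  shows "comp (Ei (split s j)) = \<phi> j s"
  using f_the_inv_into_f[OF inj_comp \<phi>_unramified[OF unram assms(1)]] assms(2)
  by (simp add: split_def)

lemma split_eqI:
  assumes "s \<in> carrier S" "j \<in> {1..p}" "\<phi> j s = comp f"
  shows "split s j = E f"
proof -
  have "comp (Ei (split s j)) = comp f" using comp_split[OF assms(1,2)] assms(3) by simp
  then have "Ei (split s j) = f" by (rule fls_compose_power_inj[OF p_pos])
  moreover have "split s j \<in> carrier K" using assms(2) by (simp add: split_def)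
  ultimately show ?thesis by (metis E_Ei)
qed

lemma split_surj:
  assumes "b \<in> {1..p} \<rightarrow>\<^sub>E carrier K"
  shows "\<exists>s\<in>carrier S. split s = b"
proof -
  obtain c where c: "\<And>j. j \<in> {1..p} \<Longrightarrow> (\<Sum>i<p. c i * W ^ (j * i)) = Ei (b j)"
    using W.dft_surj[of "\<lambda>j. Ei (b j)"] by blast
  have y00: "y0 \<noteq> 0" using v_neq_0 by (simp add: y0_def)
  \<comment> \<open>Division by \<open>y0 ^ i\<close> compensates the factor \<open>y ^ i\<close>
    occurring in the Fourier form of the embeddings.\<close>
  define f where "f = (\<lambda>i. if i < p then E (c i / y0 ^ i) else \<zero>)"
  have "f \<in> up K"
    unfolding up_def by (auto simp: f_def bound_def intro!: exI[of _ p])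
  then have fP: "f \<in> carrier (UP K)" unfolding UP_def by (simp only: partial_object.select_convs)
  then have f: "rx.short f" by (simp add: rx.short_def f_def)
  have s: "rx.cls f \<in> carrier S" by (rule rx.cls_closed[OF fP])
  have "split (rx.cls f) j = b j" if j: "j \<in> {1..p}" for j
  proof -
    have "\<phi> j (rx.cls f) = comp (\<Sum>i<p. c i * W ^ (j * i))"
      unfolding \<phi>_cls[OF f] comp_sum
    proof (rule sum.cong)
      fix i assume "i \<in> {..<p}"
      then have "\<kappa> (f i) = comp (c i / y0 ^ i)" by (simp only: f_def \<kappa>_def lessThan_iff if_True Ei_E)
      then have "\<kappa> (f i) * y ^ i * W ^ (j * i) = comp (c i / y0 ^ i) * comp y0 ^ i * comp W ^ (j * i)"
        by (simp only: y_unramified[OF unram] comp_W)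
      also have "\<dots> = comp (c i / y0 ^ i * y0 ^ i * W ^ (j * i))"
        using p_pos by (simp only: fls_compose_power_mult fls_compose_power_power simp_thms)
      also have "c i / y0 ^ i * y0 ^ i = c i" using y00 by simp
      finally show "\<kappa> (f i) * y ^ i * W ^ (j * i) = comp (c i * W ^ (j * i))" .
    qed simp
    then have "split (rx.cls f) j = E (\<Sum>i<p. c i * W ^ (j * i))" by (rule split_eqI[OF s j])
    also have "\<dots> = E (Ei (b j))" by (simp only: c[OF j])
    also have "\<dots> = b j" using assms j by (intro E_Ei) (simp add: PiE_iff)
    finally show ?thesis .
  qed
  then have "split (rx.cls f) = b"
    using assms by (intro extensionalityI[of _ "{1..p}"]) (auto simp: split_def PiE_def)
  with s show ?thesis by blast
qed

lemma split_iso: "split \<in> ring_iso S (power_ring K p)"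
proof -
  interpret S: cring S by (rule rx.S_cring)
  have "split \<in> ring_hom S (power_ring K p)"
  proof (rule ring_hom_memI)
    fix a b assume ab: "a \<in> carrier S" "b \<in> carrier S"
    show "split a \<in> carrier (power_ring K p)" by (auto simp: power_ring_def split_def)
    have "split (a \<otimes>\<^bsub>S\<^esub> b) j = split a j \<otimes> split b j" if j: "j \<in> {1..p}" for j
    proof -
      have "split (a \<otimes>\<^bsub>S\<^esub> b) j = E (Ei (split a j) * Ei (split b j))"
        by (rule split_eqI[OF S.m_closed[OF ab] j]) (simp add: \<phi>_mult ab comp_split[OF ab(1) j] comp_split[OF ab(2) j])
      also have "\<dots> = split a j \<otimes> split b j"
        using j by (simp add: split_def E_mult)
      finally show ?thesis .
    qed
    then show "split (a \<otimes>\<^bsub>S\<^esub> b) = split a \<otimes>\<^bsub>power_ring K p\<^esub> split b"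
      by (intro extensionalityI[of _ "{1..p}"]) (auto simp: power_ring_def split_def)
    have "split (a \<oplus>\<^bsub>S\<^esub> b) j = split a j \<oplus> split b j" if j: "j \<in> {1..p}" for j
    proof -
      have "split (a \<oplus>\<^bsub>S\<^esub> b) j = E (Ei (split a j) + Ei (split b j))"
        by (rule split_eqI[OF S.a_closed[OF ab] j]) (simp add: \<phi>_add ab comp_split[OF ab(1) j] comp_split[OF ab(2) j])
      also have "\<dots> = split a j \<oplus> split b j"
        using j by (simp add: split_def E_add)
      finally show ?thesis .
    qed
    then show "split (a \<oplus>\<^bsub>S\<^esub> b) = split a \<oplus>\<^bsub>power_ring K p\<^esub> split b"
      by (intro extensionalityI[of _ "{1..p}"]) (auto simp: power_ring_def split_def)
  next
    have "split \<one>\<^bsub>S\<^esub> j = \<one>" if j: "j \<in> {1..p}" for j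
      unfolding E_one by (rule split_eqI[OF S.one_closed j]) (simp add: \<phi>_one p_pos)
    then show "split \<one>\<^bsub>S\<^esub> = \<one>\<^bsub>power_ring K p\<^esub>"
      by (intro extensionalityI[of _ "{1..p}"]) (auto simp: power_ring_def split_def)
  qed
  moreover have "inj_on split (carrier S)"
  proof (rule inj_onI)
    fix a b assume ab: "a \<in> carrier S" "b \<in> carrier S" "split a = split b"
    show "a = b" by (rule \<phi>_inj[OF ab(1,2)]) (use ab comp_split in metis)
  qed
  moreover have "split ` carrier S = carrier (power_ring K p)"
  proof (intro equalityI subsetI)
    fix b assume "b \<in> carrier (power_ring K p)"
    then show "b \<in> split ` carrier S" using split_surj[of b] by (auto simp: power_ring_def)
  qed (auto simp: power_ring_def split_def)
  ultimately show ?thesis by (simp add: ring_iso_def bij_betw_def)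
qed

lemma split_emb: "c \<in> carrier K \<Longrightarrow> split (emb c) = (\<lambda>i\<in>{1..p}. c)"
proof (rule extensionalityI[of _ "{1..p}"])
  fix j assume c: "c \<in> carrier K" and j: "j \<in> {1..p}"
  have "split (emb c) j = E (Ei c)"
    by (rule split_eqI[OF _ j]) (simp_all add: c \<phi> \<kappa>_def)
  then show "split (emb c) j = (\<lambda>i\<in>{1..p}. c) j" using c j by simp
qed (auto simp: split_def)

lemma split_\<rho>:
  assumes "g \<in> carrier Aut" "s \<in> carrier S" "i \<in> {1..p}"
  shows "split (g s) (\<rho> g i) = split s i"
proof -
  have "split (g s) (\<rho> g i) = E (Ei (split s i))"
    using \<rho>[OF assms(1,3)] assms Aut_closed by (intro split_eqI) (simp_all add: comp_split)
  then show ?thesis using assms(3) by (simp add: split_def)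
qed

text \<open>A permutation of the p factors is a ring automorphism of the product fixing the
  diagonal, and \<open>split\<close> transports it to the algebra.\<close>

lemma \<rho>_surj:
  assumes s: "\<sigma> permutes {1..p}"
  shows "\<exists>g\<in>carrier Aut. \<rho> g = \<sigma>"
proof -
  interpret S: cring S by (rule rx.S_cring)
  have hom: "split \<in> ring_hom S (power_ring K p)" and bij: "bij_betw split (carrier S) (carrier (power_ring K p))"
    using split_iso by (auto simp: ring_iso_def)
  let ?i = "inv_into UNIV \<sigma>"
  have pi: "?i permutes {1..p}" by (rule permutes_inv[OF s])
  \<comment> \<open>The inverse of \<sigma> appears so that coordinate j is moved to position
    \<sigma> j.\<close>
  define q where "q b = (\<lambda>j\<in>{1..p}. b (?i j))" for b :: "nat \<Rightarrow> 'a"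
  have q: "q b \<in> carrier (power_ring K p)" if "b \<in> carrier (power_ring K p)" for b
    using that permutes_in_image[OF pi] by (auto simp: power_ring_def q_def PiE_iff)
  define g where "g = (\<lambda>s\<in>carrier S. the_inv_into (carrier S) split (q (split s)))"
  have sp: "split s \<in> carrier (power_ring K p)" if "s \<in> carrier S" for s
    using bij that by (auto simp: bij_betw_def)
  have g_closed: "g s \<in> carrier S" and split_g: "split (g s) = q (split s)" if "s \<in> carrier S" for s
    using that q[OF sp[OF that]] bij
    by (auto simp: g_def bij_betw_def intro!: the_inv_into_into f_the_inv_into_f)
  have inj: "a = b" if "a \<in> carrier S" "b \<in> carrier S" "split a = split b" for a b
    using bij that by (auto simp: bij_betw_def dest: inj_onD)
  have qop: "q (a \<otimes>\<^bsub>power_ring K p\<^esub> b) = q a \<otimes>\<^bsub>power_ring K p\<^esub> q b"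
    "q (a \<oplus>\<^bsub>power_ring K p\<^esub> b) = q a \<oplus>\<^bsub>power_ring K p\<^esub> q b" for a b
    using permutes_in_image[OF pi] by (auto simp: power_ring_def q_def fun_eq_iff)
  have "g \<in> ring_hom S S"
  proof (rule ring_hom_memI)
    fix a b assume ab: "a \<in> carrier S" "b \<in> carrier S"
    show "g (a \<otimes>\<^bsub>S\<^esub> b) = g a \<otimes>\<^bsub>S\<^esub> g b"
      by (rule inj) (use ab g_closed in \<open>simp_all add: split_g ring_hom_mult[OF hom] qop\<close>)
    show "g (a \<oplus>\<^bsub>S\<^esub> b) = g a \<oplus>\<^bsub>S\<^esub> g b"
      by (rule inj) (use ab g_closed in \<open>simp_all add: split_g ring_hom_add[OF hom] qop\<close>)
  next
    have "q \<one>\<^bsub>power_ring K p\<^esub> = \<one>\<^bsub>power_ring K p\<^esub>"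
      using permutes_in_image[OF pi] by (auto simp: power_ring_def q_def fun_eq_iff)
    then show "g \<one>\<^bsub>S\<^esub> = \<one>\<^bsub>S\<^esub>"
      by (intro inj) (use g_closed in \<open>simp_all add: split_g ring_hom_one[OF hom]\<close>)
  qed (rule g_closed)
  moreover have "g (emb c) = emb c" if "c \<in> carrier K" for c
  proof (rule inj)
    show "split (g (emb c)) = split (emb c)"
      using that permutes_in_image[OF pi] by (auto simp: split_g split_emb q_def fun_eq_iff)
  qed (use that g_closed in auto)
  moreover have "g \<in> Bij (carrier S)"
  proof -
    have "inj_on g (carrier S)"
    proof (rule inj_onI)
      fix a b assume ab: "a \<in> carrier S" "b \<in> carrier S" "g a = g b"
      have q_eq: "q (split a) = q (split b)" using ab split_g by metis
      have "split a j = split b j" if "j \<in> {1..p}" for j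
      proof -
        have "\<sigma> j \<in> {1..p}" using permutes_in_image[OF s] that by blast
        then have "split a (?i (\<sigma> j)) = split b (?i (\<sigma> j))"
          using fun_cong[OF q_eq, of "\<sigma> j"] by (simp add: q_def)
        then show ?thesis by (simp add: permutes_inverses(2)[OF s])
      qed
      then have "split a = split b"
        by (intro extensionalityI[of _ "{1..p}"]) (auto simp: split_def)
      with ab show "a = b" using inj by blast
    qed
    moreover have "\<exists>s\<in>carrier S. g s = s'" if s': "s' \<in> carrier S" for s'
    proof -
      have "(\<lambda>j\<in>{1..p}. split s' (\<sigma> j)) \<in> {1..p} \<rightarrow>\<^sub>E carrier K"
        using permutes_in_image[OF s] by (auto simp: split_def)
      then obtain a where a: "a \<in> carrier S" "split a = (\<lambda>j\<in>{1..p}. split s' (\<sigma> j))"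
        using split_surj by blast
      have "split (g a) j = split s' j" if "j \<in> {1..p}" for j
        using that permutes_in_image[OF pi, of j] a
        by (simp add: split_g q_def permutes_inverses(1)[OF s] del: atLeastAtMost_iff)
      then have "split (g a) = split s'"
        by (intro extensionalityI[of _ "{1..p}"]) (auto simp: split_def)
      then have "g a = s'" using inj g_closed a(1) s' by blast
      with a(1) show ?thesis by blast
    qed
    moreover have "g \<in> extensional (carrier S)" by (simp add: g_def)
    ultimately have "g ` carrier S = carrier S" using g_closed by blast
    with \<open>inj_on g (carrier S)\<close> \<open>g \<in> extensional (carrier S)\<close> show ?thesis
      by (simp add: Bij_def bij_betw_def)
  qed
  ultimately have gA: "g \<in> carrier Aut" unfolding Aut_iff by blast
  have "\<rho> g j = \<sigma> j" for j
  proof (cases "j \<in> {1..p}")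
    case True
    show ?thesis
    proof (rule \<rho>_eqI[OF gA True])
      show sj: "\<sigma> j \<in> {1..p}" using permutes_in_image[OF s] True by blast
      fix a assume a: "a \<in> carrier S"
      have "\<phi> (\<sigma> j) (g a) = comp (Ei (split (g a) (\<sigma> j)))" using comp_split g_closed[OF a] sj by simp
      also have "split (g a) (\<sigma> j) = split a j"
        using sj by (simp add: split_g[OF a] q_def permutes_inverses(2)[OF s])
      finally show "\<phi> (\<sigma> j) (g a) = \<phi> j a" using comp_split[OF a True] by simp
    qed
  next
    case False
    then show ?thesis using permutes_not_in[OF s] by (simp add: \<rho>_def del: atLeastAtMost_iff)
  qed
  with gA show ?thesis by blast
qed

end

subsection \<open>The ramified case\<close>

context
  assumes ram: "\<not> int p dvd fls_subdegree h"
begin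

lemma y_subdegree_cong: "int p dvd fls_subdegree y - fls_subdegree h"
  using fls_compose_power_subdegree_dvd[OF p_pos v_neq_0] v_neq_0
  by (simp add: y_def comp_eq_0_iff)

text \<open>In contrast to the unramified case, one embedding alone separates elements. Its summands
  have orders congruent to i times the order of h modulo p; these are pairwise distinct when p does
  not divide that order, so nothing cancels.\<close>

lemma \<phi>_inj_ramified:
  assumes s: "s \<in> carrier S" "s' \<in> carrier S" and eq: "\<phi> j s = \<phi> j s'"
  shows "s = s'"
proof -
  obtain f g where f: "rx.short f" "s = rx.cls f" and g: "rx.short g" "s' = rx.cls g"
    using rx.short_rep s by meson
  define a where "a i = comp (Ei (f i) - Ei (g i)) * y ^ i * W ^ (j * i)" for i
  have sum0: "sum a {..<p} = 0"
    using eq f g by (simp add: \<phi>_cls a_def \<kappa>_def left_diff_distrib sum_subtractf)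
  have Wd: "fls_subdegree W = 0" by (simp add: W_def)
  have "inj_on (\<lambda>i. fls_subdegree (a i)) {i \<in> {..<p}. a i \<noteq> 0}"
  proof (rule inj_onI)
    fix i i' assume i: "i \<in> {i \<in> {..<p}. a i \<noteq> 0}" "i' \<in> {i \<in> {..<p}. a i \<noteq> 0}"
      and eq: "fls_subdegree (a i) = fls_subdegree (a i')"
    \<comment> \<open>The coefficient, being a series in z^p, contributes a multiple of p to the
      order, and the orders of y and h agree modulo p.\<close>
    have deg: "int p dvd fls_subdegree (a k) - int k * fls_subdegree h" if "a k \<noteq> 0" for k
    proof -
      have nz: "Ei (f k) - Ei (g k) \<noteq> 0" using that by (auto simp: a_def)
      then have nz': "comp (Ei (f k) - Ei (g k)) \<noteq> 0" by (simp only: comp_eq_0_iff not_False_eq_True)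
      have "fls_subdegree (a k) = fls_subdegree (comp (Ei (f k) - Ei (g k))) + int k * fls_subdegree y"
        using nz' y_neq_0 by (simp add: a_def Wd fls_subdegree_pow del: fls_compose_power_diff)
      moreover have "int p dvd fls_subdegree (comp (Ei (f k) - Ei (g k)))"
        by (rule fls_compose_power_subdegree_dvd[OF p_pos nz])
      moreover have "int p dvd int k * (fls_subdegree y - fls_subdegree h)"
        using y_subdegree_cong by (rule dvd_mult)
      ultimately have "int p dvd fls_subdegree (comp (Ei (f k) - Ei (g k))) + int k * (fls_subdegree y - fls_subdegree h)"
        by (intro dvd_add)
      then show ?thesis using \<open>fls_subdegree (a k) = _\<close> by (simp add: right_diff_distrib add_diff_eq)
    qed
    have "int p dvd (fls_subdegree (a i) - int i * fls_subdegree h) - (fls_subdegree (a i') - int i' * fls_subdegree h)"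
      using i by (intro dvd_diff deg) auto
    then have "int p dvd (int i' - int i) * fls_subdegree h" using eq by (simp add: algebra_simps)
    moreover have "prime (int p)" using prime by simp
    ultimately have "int p dvd int i' - int i" using ram prime_dvd_mult_iff by blast
    moreover have "\<bar>int i' - int i\<bar> < int p" using i by auto
    ultimately have "int i' - int i = 0" using zdvd_not_zless[of "\<bar>int i' - int i\<bar>" "int p"] by fastforce
    then show "i = i'" by simp
  qed
  from fls_sum_distinct_subdegree[OF _ this sum0] have "a i = 0" if "i < p" for i using that by simp
  then have "Ei (f i) - Ei (g i) = 0" if "i < p" for i
    using that y_neq_0 comp_eq_0_iff[of "Ei (f i) - Ei (g i)"] by (simp add: a_def del: fls_compose_power_diff)
  then have "f i = g i" if "i < p" for i
    using short_closed f g that by (metis E_Ei right_minus_eq)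
  then have "f = g" using f(1) g(1) by (auto simp: rx.short_def fun_eq_iff) (metis not_le)
  with f g show ?thesis by simp
qed

text \<open>Multiplying the adjoined root by W is compatible with its defining equation. As W is a
  constant, the substitution leaves it unchanged, so every embedding is shifted to the next.
  Bijectivity follows because the p-th iterate is the identity.\<close>

lemma rotation_exists:
  "\<exists>g\<in>carrier Aut. \<forall>s\<in>carrier S. \<forall>j. \<phi> j (g s) = \<phi> (Suc j) s"
proof -
  interpret S: cring S by (rule rx.S_cring)
  let ?z = "emb (E W) \<otimes>\<^bsub>S\<^esub> rx.rt"
  have emb_hom: "ring_hom_cring K S emb"
    by (intro ring_hom_cringI K_cring rx.S_cring rx.emb_hom)
  have Wp: "E W [^] p = \<one>"
  proof -
    have "E W [^] n = E (W ^ n)" for n by (induction n) (simp_all add: E_one E_mult mult.commute)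
    then show ?thesis by (simp add: W.w_power E_one)
  qed
  have "?z [^]\<^bsub>S\<^esub> p = emb (E W) [^]\<^bsub>S\<^esub> p \<otimes>\<^bsub>S\<^esub> rx.rt [^]\<^bsub>S\<^esub> p"
    by (simp add: S.nat_pow_distrib)
  also have "emb (E W) [^]\<^bsub>S\<^esub> p = emb (E W [^] p)"
    using ring_hom_cring.hom_pow[OF emb_hom, of "E W" p] by simp
  also have "\<dots> = \<one>\<^bsub>S\<^esub>" unfolding Wp by (rule ring_hom_one[OF rx.emb_hom])
  finally have "?z [^]\<^bsub>S\<^esub> p = emb t" by (simp add: rx.rt_power)
  then obtain \<Phi> where \<Phi>: "\<Phi> \<in> ring_hom S S" "\<And>r. r \<in> carrier K \<Longrightarrow> \<Phi> (emb r) = emb r" "\<Phi> rx.rt = ?z"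
    using rx.hom_ex[OF rx.S_cring rx.emb_hom, of ?z] by auto
  have \<Phi>_closed: "\<Phi> s \<in> carrier S" if "s \<in> carrier S" for s using \<Phi>(1) that by (rule ring_hom_closed)
  have shift: "\<phi> j (\<Phi> s) = \<phi> (Suc j) s" if s: "s \<in> carrier S" for j s
  proof (rule rx.hom_eqI[OF type_ring_cring \<phi>_comp_hom[OF \<Phi>(1)] \<phi>(1) _ _ s])
    show "\<phi> j (\<Phi> (emb r)) = \<phi> (Suc j) (emb r)" if "r \<in> carrier K" for r
      using that \<Phi>(2) \<phi>(2) by simp
    show "\<phi> j (\<Phi> rx.rt) = \<phi> (Suc j) rx.rt"
      unfolding \<Phi>(3) by (simp add: \<phi>_mult \<phi> \<kappa>_def comp_W)
  qed
  have pow_closed: "(\<Phi> ^^ k) s \<in> carrier S" if "s \<in> carrier S" for k s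
    using that \<Phi>_closed by (induction k) auto
  have shift_pow: "\<phi> j ((\<Phi> ^^ k) s) = \<phi> (j + k) s" if s: "s \<in> carrier S" for j k s
  proof (induction k arbitrary: j)
    case (Suc k)
    have "\<phi> j ((\<Phi> ^^ Suc k) s) = \<phi> (Suc j) ((\<Phi> ^^ k) s)" using shift pow_closed[OF s] by simp
    then show ?case using Suc by simp
  qed simp
  have period: "\<phi> (j + p) s = \<phi> j s" if "s \<in> carrier S" for j s
    by (rule rx.hom_eqI[OF type_ring_cring \<phi>(1) \<phi>(1) _ _ that])
      (simp_all add: \<phi> power_add W.w_power)
  \<comment> \<open>The index shifted by p gives the same embedding, and a single embedding suffices
    to identify the elements.\<close>
  have \<Phi>p: "(\<Phi> ^^ p) s = s" if s: "s \<in> carrier S" for s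
    by (rule \<phi>_inj_ramified[of _ _ 0]) (use s pow_closed period[of s 0] shift_pow[of s 0 p] in auto)
  define g where "g = (\<lambda>s\<in>carrier S. \<Phi> s)"
  have "bij_betw g (carrier S) (carrier S)"
  proof (rule bij_betw_imageI)
    show "inj_on g (carrier S)"
    proof (rule inj_onI)
      fix a b assume ab: "a \<in> carrier S" "b \<in> carrier S" "g a = g b"
      then have "\<phi> (Suc 0) a = \<phi> (Suc 0) b" using shift[of a 0] shift[of b 0] by (simp add: g_def)
      with ab show "a = b" by (intro \<phi>_inj_ramified)
    qed
    have "s \<in> g ` carrier S" if s: "s \<in> carrier S" for s
    proof
      have "\<Phi> ((\<Phi> ^^ (p - 1)) s) = (\<Phi> ^^ Suc (p - 1)) s" by simp
      also have "\<dots> = s" using \<Phi>p[OF s] p_pos by simp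
      finally show "s = g ((\<Phi> ^^ (p - 1)) s)" using pow_closed[OF s] by (simp add: g_def)
    qed (rule pow_closed[OF s])
    then show "g ` carrier S = carrier S" using \<Phi>_closed by (auto simp: g_def)
  qed
  then have "g \<in> Bij (carrier S)" by (simp add: Bij_def g_def)
  moreover have "g \<in> ring_hom S S"
    using \<Phi>(1) by (auto simp: g_def ring_hom_def)
  moreover have "\<forall>r\<in>carrier K. g (emb r) = emb r" using \<Phi>(2) by (simp add: g_def)
  ultimately have "g \<in> carrier Aut" unfolding Aut_iff by blast
  moreover have "\<forall>s\<in>carrier S. \<forall>j. \<phi> j (g s) = \<phi> (Suc j) s" using shift by (simp add: g_def)
  ultimately show ?thesis by blast
qed

text \<open>An automorphism is known from its effect on one embedding, since that embedding is
  injective. Hence it coincides with a power of the rotation, which has order p and acts as a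
  p-cycle.\<close>

lemma \<rho>_image_ramified:
  "\<exists>cs. cycle cs \<and> set cs = {1..p} \<and> \<rho> ` carrier Aut = generate (sym_group p) {cycle_of_list cs}"
proof -
  obtain g where g: "g \<in> carrier Aut" and shift: "\<And>s j. s \<in> carrier S \<Longrightarrow> \<phi> j (g s) = \<phi> (Suc j) s"
    using rotation_exists by blast
  have g_pow: "\<phi> j ((g [^]\<^bsub>Aut\<^esub> n) s) = \<phi> (j + n) s" if s: "s \<in> carrier S" for j s and n :: nat
  proof (induction n arbitrary: j)
    case 0
    then show ?case using s by (simp add: Aut_one)
  next
    case (Suc n)
    have "(g [^]\<^bsub>Aut\<^esub> Suc n) s = (g \<otimes>\<^bsub>Aut\<^esub> g [^]\<^bsub>Aut\<^esub> n) s" using A.nat_pow_Suc2[OF g] by simp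
    also have "\<dots> = g ((g [^]\<^bsub>Aut\<^esub> n) s)" using g s by (intro alg_aut_mult) auto
    finally show ?case using shift Suc[of "Suc j"] Aut_closed[of "g [^]\<^bsub>Aut\<^esub> n" s] g s by simp
  qed
  have powers: "\<exists>n::nat. f = g [^]\<^bsub>Aut\<^esub> n" if f: "f \<in> carrier Aut" for f
  proof -
    have "(\<lambda>s. \<phi> 1 (f s)) \<in> ring_hom S TR" using f Aut_iff by (intro \<phi>_comp_hom) blast
    moreover have "\<phi> 1 (f (emb r)) = \<kappa> r" if "r \<in> carrier K" for r
      using f that \<phi>(2) unfolding Aut_iff by simp
    ultimately obtain j where j: "j \<in> {1..p}" "\<And>s. s \<in> carrier S \<Longrightarrow> \<phi> 1 (f s) = \<phi> j s"
      using hom_cases[of "\<lambda>s. \<phi> 1 (f s)"] by blast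
    \<comment> \<open>After n rotations \<open>\<phi> 1\<close> has become
      \<open>\<phi> (1 + n)\<close>, whence the exponent j - 1.\<close>
    have "f = g [^]\<^bsub>Aut\<^esub> (j - 1)"
    proof (rule alg_aut_eqI[OF f A.nat_pow_closed[OF g]])
      fix s assume s: "s \<in> carrier S"
      have "\<phi> 1 (f s) = \<phi> 1 ((g [^]\<^bsub>Aut\<^esub> (j - 1)) s)" using j s g_pow by simp
      then show "f s = (g [^]\<^bsub>Aut\<^esub> (j - 1)) s"
        by (intro \<phi>_inj_ramified) (use s f g Aut_closed in auto)
    qed
    then show ?thesis by blast
  qed
  have period: "\<phi> (j + p) s = \<phi> j s" if "s \<in> carrier S" for j s
    by (rule rx.hom_eqI[OF type_ring_cring \<phi>(1) \<phi>(1) _ _ that])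
      (simp_all add: \<phi> power_add W.w_power)
  have gp: "g [^]\<^bsub>Aut\<^esub> p = \<one>\<^bsub>Aut\<^esub>"
  proof (rule alg_aut_eqI[OF A.nat_pow_closed[OF g] A.one_closed])
    fix s assume s: "s \<in> carrier S"
    have "(g [^]\<^bsub>Aut\<^esub> p) s = s"
      by (rule \<phi>_inj_ramified[of _ _ 0]) (use s g_pow[OF s, of 0 p] period[OF s, of 0] Aut_closed g in auto)
    then show "(g [^]\<^bsub>Aut\<^esub> p) s = \<one>\<^bsub>Aut\<^esub> s" using s by (simp add: Aut_one)
  qed
  have g1: "g \<noteq> \<one>\<^bsub>Aut\<^esub>"
  proof
    assume "g = \<one>\<^bsub>Aut\<^esub>"
    then have "\<forall>s\<in>carrier S. \<phi> 1 s = \<phi> 2 s" using shift[of _ 1] by (simp add: Aut_one numeral_2_eq_2)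
    then show False using \<phi>_eq_iff[of 1 2] p_gt_1 by simp
  qed
  obtain cs where cs: "cycle cs" "set cs = {1..p}" "cycle_of_list cs = \<rho> g"
    using prime_order_perm_cycle[OF prime \<rho>_prime_order[OF g gp g1]] by blast
  interpret sym: group "sym_group p" by (rule sym_group_is_group)
  interpret h: group_hom Aut "sym_group p" \<rho> by (intro group_hom.intro A.group_axioms sym.group_axioms group_hom_axioms.intro \<rho>_hom)
  have "\<rho> ` carrier Aut = generate (sym_group p) {\<rho> g}"
  proof
    show "generate (sym_group p) {\<rho> g} \<subseteq> \<rho> ` carrier Aut"
      using g by (intro sym.generate_subgroup_incl h.img_is_subgroup) auto
    have sub: "subgroup (generate (sym_group p) {\<rho> g}) (sym_group p)"
      using g by (intro sym.generate_is_subgroup) auto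
    have "\<rho> (g [^]\<^bsub>Aut\<^esub> n) \<in> generate (sym_group p) {\<rho> g}" for n :: nat
    proof (induction n)
      case 0
      show ?case using subgroup.one_closed[OF sub] by simp
    next
      case (Suc n)
      then show ?case
        using subgroup.m_closed[OF sub Suc generate.incl[of "\<rho> g"]] g by simp
    qed
    then show "\<rho> ` carrier Aut \<subseteq> generate (sym_group p) {\<rho> g}" using powers by blast
  qed
  with cs show ?thesis by metis
qed

end

end

section \<open>Separability from a separability idempotent\<close>

locale comm_algebra = S: cring S + R: cring R for S :: "'s ring" (structure) and R :: "('r, 'm) ring_scheme" (structure) +
  fixes \<iota> :: "'r \<Rightarrow> 's"
  assumes \<iota>_hom: "\<iota> \<in> ring_hom R S"
begin

abbreviation (input) Q where "Q \<equiv> pair_ring S"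
abbreviation (input) pm where "pm a b \<equiv> Poly_Mapping.single (a, b) (1::int)"

definition pr :: "'s \<times> 's \<Rightarrow> 's \<times> 's \<Rightarrow> 's \<times> 's" where
  "pr z w = (fst z \<otimes>\<^bsub>S\<^esub> fst w, snd z \<otimes>\<^bsub>S\<^esub> snd w)"

lemma Q_mult: "f \<otimes>\<^bsub>Q\<^esub> g = (\<Sum>z\<in>Poly_Mapping.keys f. \<Sum>w\<in>Poly_Mapping.keys g.
    Poly_Mapping.single (pr z w) (Poly_Mapping.lookup f z * Poly_Mapping.lookup g w))"
  by (simp add: pair_ring_def pr_def case_prod_beta)

lemma Q_simps: "\<one>\<^bsub>Q\<^esub> = pm \<one>\<^bsub>S\<^esub> \<one>\<^bsub>S\<^esub>" "\<zero>\<^bsub>Q\<^esub> = 0" "f \<oplus>\<^bsub>Q\<^esub> g = f + g"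
  "f \<in> carrier Q \<longleftrightarrow> Poly_Mapping.keys f \<subseteq> carrier S \<times> carrier S"
  by (simp_all add: pair_ring_def)

lemma Q_mult_superset:
  assumes "finite A" "Poly_Mapping.keys f \<subseteq> A" "finite B" "Poly_Mapping.keys g \<subseteq> B"
  shows "f \<otimes>\<^bsub>Q\<^esub> g = (\<Sum>z\<in>A. \<Sum>w\<in>B. Poly_Mapping.single (pr z w) (Poly_Mapping.lookup f z * Poly_Mapping.lookup g w))"
proof -
  have "(\<Sum>w\<in>Poly_Mapping.keys g. Poly_Mapping.single (pr z w) (Poly_Mapping.lookup f z * Poly_Mapping.lookup g w)) =
      (\<Sum>w\<in>B. Poly_Mapping.single (pr z w) (Poly_Mapping.lookup f z * Poly_Mapping.lookup g w))" for z
    using assms by (intro sum.mono_neutral_left) (auto simp: in_keys_iff)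
  then have "f \<otimes>\<^bsub>Q\<^esub> g = (\<Sum>z\<in>Poly_Mapping.keys f. \<Sum>w\<in>B.
      Poly_Mapping.single (pr z w) (Poly_Mapping.lookup f z * Poly_Mapping.lookup g w))"
    by (simp add: Q_mult)
  also have "\<dots> = (\<Sum>z\<in>A. \<Sum>w\<in>B. Poly_Mapping.single (pr z w) (Poly_Mapping.lookup f z * Poly_Mapping.lookup g w))"
    using assms by (intro sum.mono_neutral_left) (auto simp: in_keys_iff)
  finally show ?thesis .
qed

lemma Q_mult_add_left: "(f + f') \<otimes>\<^bsub>Q\<^esub> g = f \<otimes>\<^bsub>Q\<^esub> g + f' \<otimes>\<^bsub>Q\<^esub> g"
proof -
  let ?A = "Poly_Mapping.keys f \<union> Poly_Mapping.keys f'" and ?B = "Poly_Mapping.keys g"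
  have "Poly_Mapping.keys (f + f') \<subseteq> ?A" by (rule Poly_Mapping.keys_add)
  then show ?thesis
    by (simp add: Q_mult_superset[of ?A _ ?B] lookup_add distrib_right single_add sum.distrib)
qed

lemma Q_mult_add_right: "g \<otimes>\<^bsub>Q\<^esub> (f + f') = g \<otimes>\<^bsub>Q\<^esub> f + g \<otimes>\<^bsub>Q\<^esub> f'"
proof -
  let ?A = "Poly_Mapping.keys f \<union> Poly_Mapping.keys f'" and ?B = "Poly_Mapping.keys g"
  have "Poly_Mapping.keys (f + f') \<subseteq> ?A" by (rule Poly_Mapping.keys_add)
  then show ?thesis
    by (simp add: Q_mult_superset[of ?B _ ?A] lookup_add distrib_left single_add sum.distrib)
qed

lemma Q_mult_zero: "0 \<otimes>\<^bsub>Q\<^esub> g = 0" "g \<otimes>\<^bsub>Q\<^esub> 0 = 0"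
  by (simp_all add: Q_mult)

lemma Q_mult_single: "Poly_Mapping.single z c \<otimes>\<^bsub>Q\<^esub> Poly_Mapping.single w d = Poly_Mapping.single (pr z w) (c * d)"
  by (subst Q_mult_superset[of "{z}" _ "{w}"]) simp_all

lemma Q_expand: "f = (\<Sum>z\<in>Poly_Mapping.keys f. Poly_Mapping.single z (Poly_Mapping.lookup f z))"
  by (rule poly_mapping_eqI) (simp add: lookup_sum lookup_single when_def in_keys_iff)

lemma Q_add_closed: "f \<in> carrier Q \<Longrightarrow> g \<in> carrier Q \<Longrightarrow> f + g \<in> carrier Q"
  using Poly_Mapping.keys_add[of f g] unfolding Q_simps(4) by blast

text \<open>The formal pairs generate the additive group, so identities that are additive in each
  argument need checking on pairs only.\<close>

lemma Q_induct [consumes 1, case_names zero add pure uminus]: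
  assumes "f \<in> carrier Q" and z: "P 0"
    and add: "\<And>f g. f \<in> carrier Q \<Longrightarrow> g \<in> carrier Q \<Longrightarrow> P f \<Longrightarrow> P g \<Longrightarrow> P (f + g)"
    and pure: "\<And>a b. a \<in> carrier S \<Longrightarrow> b \<in> carrier S \<Longrightarrow> P (pm a b)"
    and uminus: "\<And>f. f \<in> carrier Q \<Longrightarrow> P f \<Longrightarrow> P (- f)"
  shows "P f"
proof -
  have carr: "Poly_Mapping.single z c \<in> carrier Q" if "z \<in> carrier S \<times> carrier S" for z c
    using that by (simp add: Q_simps)
  have single: "P (Poly_Mapping.single z c)" if zz: "z \<in> carrier S \<times> carrier S" for z c
  proof (induction c rule: int_induct[where k = 0])
    case (step1 i)
    then show ?case using add[OF carr[OF zz] carr[OF zz]] pure zz by (auto simp: single_add)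
  next
    case (step2 i)
    have "P (- Poly_Mapping.single z 1)" using uminus[OF carr[OF zz]] pure zz by auto
    moreover have "- Poly_Mapping.single z (1::int) \<in> carrier Q" using zz by (simp add: Q_simps)
    ultimately have "P (Poly_Mapping.single z i + (- Poly_Mapping.single z 1))"
      using add[OF carr[OF zz]] step2 by blast
    then show ?case by (simp add: single_diff)
  qed (simp add: z)
  have "P (\<Sum>z\<in>A. Poly_Mapping.single z (Poly_Mapping.lookup f z)) \<and>
      (\<Sum>z\<in>A. Poly_Mapping.single z (Poly_Mapping.lookup f z)) \<in> carrier Q"
    if "finite A" "A \<subseteq> carrier S \<times> carrier S" for A
    using that
  proof (induction A rule: finite_induct)
    case (insert x F)
    then have x: "x \<in> carrier S \<times> carrier S" and IH: "P (\<Sum>z\<in>F. Poly_Mapping.single z (Poly_Mapping.lookup f z))"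
      "(\<Sum>z\<in>F. Poly_Mapping.single z (Poly_Mapping.lookup f z)) \<in> carrier Q" by auto
    have "Poly_Mapping.single x (Poly_Mapping.lookup f x) + (\<Sum>z\<in>F. Poly_Mapping.single z (Poly_Mapping.lookup f z)) \<in> carrier Q"
      by (rule Q_add_closed[OF carr[OF x] IH(2)])
    then show ?case
      using add[OF carr[OF x] IH(2) single[OF x] IH(1)] by (simp only: sum.insert[OF insert.hyps])
  qed (simp_all add: z Q_simps)
  from this[of "Poly_Mapping.keys f"] show ?thesis
    using assms(1) Q_expand[of f] by (simp add: Q_simps(4))
qed

lemma pm_closed: "a \<in> carrier S \<Longrightarrow> b \<in> carrier S \<Longrightarrow> pm a b \<in> carrier Q"
  by (simp add: Q_simps)

lemma Q_uminus_closed: "f \<in> carrier Q \<Longrightarrow> - f \<in> carrier Q"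
  by (simp add: Q_simps)

lemma Q_mult_uminus: "(- f) \<otimes>\<^bsub>Q\<^esub> g = - (f \<otimes>\<^bsub>Q\<^esub> g)" "f \<otimes>\<^bsub>Q\<^esub> (- g) = - (f \<otimes>\<^bsub>Q\<^esub> g)"
  using Q_mult_add_left[of f "- f" g] Q_mult_add_right[of f g "- g"]
  by (simp_all add: Q_mult_zero eq_neg_iff_add_eq_0 add.commute)

lemma Q_mult_closed:
  assumes f: "f \<in> carrier Q" and g: "g \<in> carrier Q"
  shows "f \<otimes>\<^bsub>Q\<^esub> g \<in> carrier Q"
  using f
proof (induction f rule: Q_induct)
  case (pure a b)
  from g show ?case
  proof (induction g rule: Q_induct)
    case (pure c d)
    then show ?case using \<open>a \<in> carrier S\<close> \<open>b \<in> carrier S\<close> by (simp add: Q_mult_single pr_def pm_closed)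
  qed (simp_all add: Q_mult_zero Q_mult_add_right Q_mult_uminus Q_add_closed Q_uminus_closed, simp add: Q_simps)
qed (simp_all add: Q_mult_zero Q_mult_add_left Q_mult_uminus Q_add_closed Q_uminus_closed, simp add: Q_simps)

lemma Q_mult_comm:
  assumes f: "f \<in> carrier Q" and g: "g \<in> carrier Q"
  shows "f \<otimes>\<^bsub>Q\<^esub> g = g \<otimes>\<^bsub>Q\<^esub> f"
  using f
proof (induction f rule: Q_induct)
  case (pure a b)
  from g show ?case
  proof (induction g rule: Q_induct)
    case (pure c d)
    then show ?case
      using \<open>a \<in> carrier S\<close> \<open>b \<in> carrier S\<close> by (simp add: Q_mult_single pr_def S.m_comm)
  qed (simp_all add: Q_mult_zero Q_mult_add_left Q_mult_add_right Q_mult_uminus)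
qed (simp_all add: Q_mult_zero Q_mult_add_left Q_mult_add_right Q_mult_uminus)

lemma Q_mult_assoc:
  assumes f: "f \<in> carrier Q" and g: "g \<in> carrier Q" and h: "h \<in> carrier Q"
  shows "(f \<otimes>\<^bsub>Q\<^esub> g) \<otimes>\<^bsub>Q\<^esub> h = f \<otimes>\<^bsub>Q\<^esub> (g \<otimes>\<^bsub>Q\<^esub> h)"
  using f
proof (induction f rule: Q_induct)
  case f: (pure a b)
  from g show ?case
  proof (induction g rule: Q_induct)
    case g: (pure c d)
    from h show ?case
    proof (induction h rule: Q_induct)
      case (pure c' d')
      then show ?case using f g by (simp add: Q_mult_single pr_def S.m_assoc)
    qed (simp_all add: Q_mult_zero Q_mult_add_left Q_mult_add_right Q_mult_uminus)
  qed (simp_all add: Q_mult_zero Q_mult_add_left Q_mult_add_right Q_mult_uminus)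
qed (simp_all add: Q_mult_zero Q_mult_add_left Q_mult_add_right Q_mult_uminus)

lemma Q_mult_one:
  assumes f: "f \<in> carrier Q"
  shows "\<one>\<^bsub>Q\<^esub> \<otimes>\<^bsub>Q\<^esub> f = f"
  using f
proof (induction f rule: Q_induct)
  case (pure a b)
  then show ?case by (simp add: Q_simps(1) Q_mult_single pr_def)
qed (simp_all add: Q_mult_zero Q_mult_add_right Q_mult_uminus)

lemma Q_cring: "cring Q"
proof (rule cringI)
  show "abelian_group Q"
  proof (rule abelian_groupI)
    fix f assume "f \<in> carrier Q"
    then show "\<exists>g\<in>carrier Q. g \<oplus>\<^bsub>Q\<^esub> f = \<zero>\<^bsub>Q\<^esub>"
      by (intro bexI[of _ "- f"]) (simp_all add: Q_simps(2,3) Q_uminus_closed)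
  qed (simp_all add: Q_simps(2,3) Q_add_closed ac_simps, simp add: Q_simps(4))
  show "comm_monoid Q"
  proof (rule comm_monoidI)
    show "\<one>\<^bsub>Q\<^esub> \<in> carrier Q" by (simp add: Q_simps(1) pm_closed)
  qed (rule Q_mult_closed Q_mult_assoc Q_mult_one Q_mult_comm; assumption)+
qed (simp add: Q_simps(3) Q_mult_add_left)

sublocale Q: cring Q by (rule Q_cring)

lemma Q_a_inv: "f \<in> carrier Q \<Longrightarrow> \<ominus>\<^bsub>Q\<^esub> f = - f"
  by (rule Q.minus_equality) (simp_all add: Q_simps(2,3) Q_uminus_closed)

abbreviation (input) J where "J \<equiv> Idl\<^bsub>Q\<^esub> (tensor_rels R \<iota> S)"
abbreviation (input) T where "T \<equiv> tensor_square R \<iota> S"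

lemma \<iota>_closed [simp]: "r \<in> carrier R \<Longrightarrow> \<iota> r \<in> carrier S"
  by (rule ring_hom_closed[OF \<iota>_hom])

lemma tensor_rels_cases:
  assumes "u \<in> tensor_rels R \<iota> S"
  obtains
    (left) a a' b where "u = pm (a \<oplus>\<^bsub>S\<^esub> a') b - pm a b - pm a' b" "a \<in> carrier S" "a' \<in> carrier S" "b \<in> carrier S"
  | (right) a b b' where "u = pm a (b \<oplus>\<^bsub>S\<^esub> b') - pm a b - pm a b'" "a \<in> carrier S" "b \<in> carrier S" "b' \<in> carrier S"
  | (scalar) r a b where "u = pm (\<iota> r \<otimes>\<^bsub>S\<^esub> a) b - pm a (\<iota> r \<otimes>\<^bsub>S\<^esub> b)" "r \<in> carrier R" "a \<in> carrier S" "b \<in> carrier S"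
  using assms unfolding tensor_rels_def Let_def by blast

lemma tensor_rels_mem:
  "a \<in> carrier S \<Longrightarrow> a' \<in> carrier S \<Longrightarrow> b \<in> carrier S \<Longrightarrow> pm (a \<oplus>\<^bsub>S\<^esub> a') b - pm a b - pm a' b \<in> tensor_rels R \<iota> S"
  "a \<in> carrier S \<Longrightarrow> b \<in> carrier S \<Longrightarrow> b' \<in> carrier S \<Longrightarrow> pm a (b \<oplus>\<^bsub>S\<^esub> b') - pm a b - pm a b' \<in> tensor_rels R \<iota> S"
  "r \<in> carrier R \<Longrightarrow> a \<in> carrier S \<Longrightarrow> b \<in> carrier S \<Longrightarrow> pm (\<iota> r \<otimes>\<^bsub>S\<^esub> a) b - pm a (\<iota> r \<otimes>\<^bsub>S\<^esub> b) \<in> tensor_rels R \<iota> S"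
  unfolding tensor_rels_def Let_def by blast+

lemma Q_diff_closed: "f \<in> carrier Q \<Longrightarrow> g \<in> carrier Q \<Longrightarrow> f - g \<in> carrier Q"
  using Q_add_closed[of f "- g"] Q_uminus_closed by simp

lemma tensor_rels_subset: "tensor_rels R \<iota> S \<subseteq> carrier Q"
  by (auto elim!: tensor_rels_cases intro!: Q_diff_closed pm_closed)

lemma J_ideal: "ideal J Q"
  by (rule Q.genideal_ideal[OF tensor_rels_subset])

lemma T_eq: "T = Q Quot J"
  by (simp add: tensor_square_def)

lemma T_cring: "cring T"
  unfolding T_eq by (rule ideal.quotient_is_cring[OF J_ideal Q_cring])

sublocale T: cring T by (rule T_cring)

definition tc :: "('s \<times> 's \<Rightarrow>\<^sub>0 int) \<Rightarrow> ('s \<times> 's \<Rightarrow>\<^sub>0 int) set" where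
  "tc f = J +>\<^bsub>Q\<^esub> f"

lemma tc_hom: "tc \<in> ring_hom Q T"
  using ideal.rcos_ring_hom[OF J_ideal] by (simp add: T_eq tc_def[abs_def])

lemma T_carrier: "carrier T = tc ` carrier Q"
  by (auto simp: T_eq FactRing_def A_RCOSETS_def' tc_def)

lemma tc_eqI: "f \<in> carrier Q \<Longrightarrow> g \<in> carrier Q \<Longrightarrow> f - g \<in> J \<Longrightarrow> tc f = tc g"
  using Q.quotient_eq_iff_same_a_r_cos[OF J_ideal, of f g]
  by (simp add: tc_def a_minus_def Q_a_inv Q_simps(3))

definition ten :: "'s \<Rightarrow> 's \<Rightarrow> ('s \<times> 's \<Rightarrow>\<^sub>0 int) set" where
  "ten a b = tc (pm a b)"

lemma ten_closed [simp]: "a \<in> carrier S \<Longrightarrow> b \<in> carrier S \<Longrightarrow> ten a b \<in> carrier T"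
  unfolding ten_def by (rule ring_hom_closed[OF tc_hom pm_closed])

lemma ten_add_left: "a \<in> carrier S \<Longrightarrow> a' \<in> carrier S \<Longrightarrow> b \<in> carrier S \<Longrightarrow>
    ten (a \<oplus>\<^bsub>S\<^esub> a') b = ten a b \<oplus>\<^bsub>T\<^esub> ten a' b"
proof -
  assume c: "a \<in> carrier S" "a' \<in> carrier S" "b \<in> carrier S"
  have "tc (pm (a \<oplus>\<^bsub>S\<^esub> a') b) = tc (pm a b \<oplus>\<^bsub>Q\<^esub> pm a' b)"
    using c Q.genideal_self[OF tensor_rels_subset] tensor_rels_mem(1)[OF c]
    by (intro tc_eqI) (auto simp: Q_simps(3) pm_closed Q_add_closed diff_diff_eq)
  also have "\<dots> = ten a b \<oplus>\<^bsub>T\<^esub> ten a' b"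
    unfolding ten_def by (rule ring_hom_add[OF tc_hom]) (use c pm_closed in auto)
  finally show ?thesis by (simp add: ten_def)
qed

lemma ten_add_right: "a \<in> carrier S \<Longrightarrow> b \<in> carrier S \<Longrightarrow> b' \<in> carrier S \<Longrightarrow>
    ten a (b \<oplus>\<^bsub>S\<^esub> b') = ten a b \<oplus>\<^bsub>T\<^esub> ten a b'"
proof -
  assume c: "a \<in> carrier S" "b \<in> carrier S" "b' \<in> carrier S"
  have "tc (pm a (b \<oplus>\<^bsub>S\<^esub> b')) = tc (pm a b \<oplus>\<^bsub>Q\<^esub> pm a b')"
    using c Q.genideal_self[OF tensor_rels_subset] tensor_rels_mem(2)[OF c]
    by (intro tc_eqI) (auto simp: Q_simps(3) pm_closed Q_add_closed diff_diff_eq)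
  also have "\<dots> = ten a b \<oplus>\<^bsub>T\<^esub> ten a b'"
    unfolding ten_def by (rule ring_hom_add[OF tc_hom]) (use c pm_closed in auto)
  finally show ?thesis by (simp add: ten_def)
qed

lemma ten_scalar: "r \<in> carrier R \<Longrightarrow> a \<in> carrier S \<Longrightarrow> b \<in> carrier S \<Longrightarrow>
    ten (\<iota> r \<otimes>\<^bsub>S\<^esub> a) b = ten a (\<iota> r \<otimes>\<^bsub>S\<^esub> b)"
  unfolding ten_def using Q.genideal_self[OF tensor_rels_subset] tensor_rels_mem(3)
  by (intro tc_eqI) (auto intro!: pm_closed)

lemma ten_mult: "a \<in> carrier S \<Longrightarrow> b \<in> carrier S \<Longrightarrow> c \<in> carrier S \<Longrightarrow> d \<in> carrier S \<Longrightarrow>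
    ten a b \<otimes>\<^bsub>T\<^esub> ten c d = ten (a \<otimes>\<^bsub>S\<^esub> c) (b \<otimes>\<^bsub>S\<^esub> d)"
  unfolding ten_def
  by (subst ring_hom_mult[OF tc_hom, symmetric]) (simp_all add: pm_closed Q_mult_single pr_def)

lemma ten_one: "ten \<one>\<^bsub>S\<^esub> \<one>\<^bsub>S\<^esub> = \<one>\<^bsub>T\<^esub>"
  using ring_hom_one[OF tc_hom] by (simp add: ten_def Q_simps(1))

lemma pair_mult_superset:
  assumes "finite A" "Poly_Mapping.keys f \<subseteq> A" "A \<subseteq> carrier S \<times> carrier S"
  shows "pair_mult S f = (\<Oplus>\<^bsub>S\<^esub>z\<in>A. add_pow S (Poly_Mapping.lookup f z) (fst z \<otimes>\<^bsub>S\<^esub> snd z))"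
  unfolding pair_mult_def
proof (rule S.add.finprod_mono_neutral_cong_left)
  show "\<And>i. i \<in> A - Poly_Mapping.keys f \<Longrightarrow> add_pow S (Poly_Mapping.lookup f i) (fst i \<otimes>\<^bsub>S\<^esub> snd i) = \<zero>\<^bsub>S\<^esub>"
    by (simp add: in_keys_iff add_pow_def)
qed (use assms in auto)

lemma pair_mult_closed: "f \<in> carrier Q \<Longrightarrow> pair_mult S f \<in> carrier S"
  unfolding pair_mult_def Q_simps(4) by (rule S.finsum_closed) auto

lemma pair_mult_add:
  assumes "f \<in> carrier Q" "g \<in> carrier Q"
  shows "pair_mult S (f + g) = pair_mult S f \<oplus>\<^bsub>S\<^esub> pair_mult S g"
proof -
  let ?A = "Poly_Mapping.keys f \<union> Poly_Mapping.keys g"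
  have A: "finite ?A" "?A \<subseteq> carrier S \<times> carrier S" using assms by (auto simp: Q_simps(4))
  have sub: "Poly_Mapping.keys (f + g) \<subseteq> ?A" "Poly_Mapping.keys f \<subseteq> ?A" "Poly_Mapping.keys g \<subseteq> ?A"
    using Poly_Mapping.keys_add[of f g] by auto
  have prod: "fst z \<otimes>\<^bsub>S\<^esub> snd z \<in> carrier S" if "z \<in> ?A" for z using that A(2) by auto
  have "pair_mult S (f + g) = (\<Oplus>\<^bsub>S\<^esub>z\<in>?A. add_pow S (Poly_Mapping.lookup f z) (fst z \<otimes>\<^bsub>S\<^esub> snd z) \<oplus>\<^bsub>S\<^esub>
      add_pow S (Poly_Mapping.lookup g z) (fst z \<otimes>\<^bsub>S\<^esub> snd z))"
    unfolding pair_mult_superset[OF A(1) sub(1) A(2)]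
    by (rule S.finsum_cong') (use prod in \<open>auto simp: lookup_add S.add.int_pow_mult\<close>)
  also have "\<dots> = pair_mult S f \<oplus>\<^bsub>S\<^esub> pair_mult S g"
    unfolding pair_mult_superset[OF A(1) sub(2) A(2)] pair_mult_superset[OF A(1) sub(3) A(2)]
    by (rule S.finsum_addf) (use prod in auto)
  finally show ?thesis .
qed

lemma pair_mult_zero: "pair_mult S 0 = \<zero>\<^bsub>S\<^esub>"
  by (simp add: pair_mult_def)

lemma pair_mult_uminus: "f \<in> carrier Q \<Longrightarrow> pair_mult S (- f) = \<ominus>\<^bsub>S\<^esub> pair_mult S f"
  using pair_mult_add[of "- f" f] Q_uminus_closed[of f] pair_mult_closed
  by (intro S.minus_equality[symmetric]) (simp_all add: pair_mult_zero)

lemma pair_mult_pm: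
  assumes "a \<in> carrier S" "b \<in> carrier S"
  shows "pair_mult S (pm a b) = a \<otimes>\<^bsub>S\<^esub> b"
  using assms by (subst pair_mult_superset[of "{(a, b)}"]) (simp_all add: S.add.int_pow_1)

lemma pair_mult_mult:
  assumes f: "f \<in> carrier Q" and g: "g \<in> carrier Q"
  shows "pair_mult S (f \<otimes>\<^bsub>Q\<^esub> g) = pair_mult S f \<otimes>\<^bsub>S\<^esub> pair_mult S g"
  using f
proof (induction f rule: Q_induct)
  case f: (pure a b)
  from g show ?case
  proof (induction g rule: Q_induct)
    case (pure c d)
    have "pair_mult S (pm a b \<otimes>\<^bsub>Q\<^esub> pm c d) = (a \<otimes>\<^bsub>S\<^esub> c) \<otimes>\<^bsub>S\<^esub> (b \<otimes>\<^bsub>S\<^esub> d)"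
      using f pure by (simp add: Q_mult_single pr_def pair_mult_pm)
    also have "\<dots> = (a \<otimes>\<^bsub>S\<^esub> b) \<otimes>\<^bsub>S\<^esub> (c \<otimes>\<^bsub>S\<^esub> d)" using f pure by (simp add: S.m_ac)
    finally show ?case using f pure by (simp add: pair_mult_pm)
  next
    case (add g g')
    then show ?case using f
      by (simp add: Q_mult_add_right pair_mult_add Q_mult_closed pm_closed pair_mult_closed S.r_distr)
  next
    case (uminus g)
    then show ?case using f
      by (simp add: Q_mult_uminus pair_mult_uminus Q_mult_closed pm_closed pair_mult_closed S.r_minus)
  qed (simp add: Q_mult_zero pair_mult_zero pair_mult_closed pm_closed f)
next
  case (add f f')
  then show ?case using g
    by (simp add: Q_mult_add_left pair_mult_add Q_mult_closed pair_mult_closed S.l_distr)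
next
  case (uminus f)
  then show ?case using g
    by (simp add: Q_mult_uminus pair_mult_uminus Q_mult_closed pair_mult_closed S.l_minus)
qed (simp add: Q_mult_zero pair_mult_zero pair_mult_closed g)

lemma pair_mult_diff:
  "f \<in> carrier Q \<Longrightarrow> g \<in> carrier Q \<Longrightarrow> pair_mult S (f - g) = pair_mult S f \<ominus>\<^bsub>S\<^esub> pair_mult S g"
  using pair_mult_add[of f "- g"] by (simp add: Q_uminus_closed pair_mult_uminus a_minus_def)

text \<open>Multiplication S \<times> S \<rightarrow> S is bilinear over the base and therefore
  kills each of the three kinds of relations; the kernel, being an ideal, contains the ideal they
  generate.\<close>

lemma pair_mult_J:
  assumes "u \<in> J"
  shows "pair_mult S u = \<zero>\<^bsub>S\<^esub>"
proof -
  have "pair_mult S \<in> ring_hom Q S"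
    by (rule ring_hom_memI)
      (simp_all add: pair_mult_closed pair_mult_mult Q_simps(1,3) pair_mult_add pair_mult_pm)
  then interpret h: ring_hom_ring Q S "pair_mult S"
    by (intro ring_hom_ringI2 Q.ring_axioms S.ring_axioms)
  have "pair_mult S u = \<zero>\<^bsub>S\<^esub>" if "u \<in> tensor_rels R \<iota> S" for u
    using that
  proof (cases rule: tensor_rels_cases)
    case (left a a' b)
    then show ?thesis
      by (simp add: pair_mult_diff pm_closed Q_diff_closed pair_mult_pm S.l_distr) (simp add: S.minus_eq S.a_ac S.r_neg S.r_neg1)
  next
    case (right a b b')
    then show ?thesis
      by (simp add: pair_mult_diff pm_closed Q_diff_closed pair_mult_pm S.r_distr) (simp add: S.minus_eq S.a_ac S.r_neg S.r_neg1)
  next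
    case (scalar r a b)
    then show ?thesis
      by (simp add: pair_mult_diff pm_closed pair_mult_pm S.m_ac S.minus_eq S.r_neg)
  qed
  then have "tensor_rels R \<iota> S \<subseteq> a_kernel Q S (pair_mult S)"
    using tensor_rels_subset unfolding a_kernel_def' by blast
  then have "J \<subseteq> a_kernel Q S (pair_mult S)"
    by (rule Q.genideal_minimal[OF h.kernel_is_ideal])
  with assms show ?thesis unfolding a_kernel_def' by blast
qed

definition \<mu> :: "('s \<times> 's \<Rightarrow>\<^sub>0 int) set \<Rightarrow> 's" where
  "\<mu> V = the_elem (pair_mult S ` V)"

text \<open>Multiplication is constant on cosets, so the image of a coset is a singleton and
  \<open>the_elem\<close> in \<open>tensor_module\<close> has its intended value.\<close>

lemma \<mu>_tc:
  assumes "f \<in> carrier Q"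
  shows "\<mu> (tc f) = pair_mult S f"
proof -
  have "pair_mult S ` tc f = {pair_mult S f}"
  proof -
    have "pair_mult S (u + f) = pair_mult S f" if "u \<in> J" for u
      using that assms ideal.Icarr[OF J_ideal that] by (simp add: pair_mult_add pair_mult_J pair_mult_closed)
    moreover have "0 \<in> J"
      using additive_subgroup.zero_closed[OF ideal.axioms(1)[OF J_ideal]] by (simp add: Q_simps(2))
    ultimately show ?thesis
      unfolding tc_def a_r_coset_def' Q_simps(3) by force
  qed
  then show ?thesis by (simp add: \<mu>_def)
qed

lemma \<mu>_ten [simp]: "a \<in> carrier S \<Longrightarrow> b \<in> carrier S \<Longrightarrow> \<mu> (ten a b) = a \<otimes>\<^bsub>S\<^esub> b"
  by (simp add: ten_def \<mu>_tc pm_closed pair_mult_pm)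

lemma \<mu>_hom: "\<mu> \<in> ring_hom T S"
proof (rule ring_hom_memI)
  fix V W assume "V \<in> carrier T" "W \<in> carrier T"
  then obtain f g where fg: "f \<in> carrier Q" "g \<in> carrier Q" "V = tc f" "W = tc g" by (auto simp: T_carrier)
  have "V \<otimes>\<^bsub>T\<^esub> W = tc (f \<otimes>\<^bsub>Q\<^esub> g)" "V \<oplus>\<^bsub>T\<^esub> W = tc (f + g)"
    using fg ring_hom_mult[OF tc_hom] ring_hom_add[OF tc_hom] by (simp_all add: Q_simps(3))
  then show "\<mu> (V \<otimes>\<^bsub>T\<^esub> W) = \<mu> V \<otimes>\<^bsub>S\<^esub> \<mu> W" "\<mu> (V \<oplus>\<^bsub>T\<^esub> W) = \<mu> V \<oplus>\<^bsub>S\<^esub> \<mu> W" "\<mu> V \<in> carrier S"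
    using fg by (simp_all add: \<mu>_tc Q_mult_closed Q_add_closed pair_mult_mult pair_mult_add pair_mult_closed)
qed (simp flip: ten_one)

abbreviation (input) M where "M \<equiv> tensor_module S"

lemma M_simps: "carrier M = carrier S" "x \<oplus>\<^bsub>M\<^esub> y = x \<oplus>\<^bsub>S\<^esub> y" "\<zero>\<^bsub>M\<^esub> = \<zero>\<^bsub>S\<^esub>"
  "V \<odot>\<^bsub>M\<^esub> x = \<mu> V \<otimes>\<^bsub>S\<^esub> x"
  by (simp_all add: tensor_module_def ring.defs \<mu>_def)

lemma M_module: "module T M"
proof (rule moduleI)
  show "abelian_group M"
    by (rule abelian_groupI) (auto simp: M_simps S.a_ac intro: S.l_neg)
qed (auto simp: M_simps T_cring ring_hom_closed[OF \<mu>_hom] ring_hom_mult[OF \<mu>_hom] ring_hom_add[OF \<mu>_hom]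
    ring_hom_one[OF \<mu>_hom] S.l_distr S.r_distr S.m_assoc)

text \<open>By \<open>swap\<close>, every tensor V acts on e through its product \<mu> V. This makes
  x \<mapsto> (x \<otimes> 1) e linear over the tensor square, and \<mu> splits it because \<mu> e =
  1: S is a direct summand of the free module of rank one.\<close>

lemma separable_algebraI:
  assumes e: "e \<in> carrier T" and \<mu>e: "\<mu> e = \<one>\<^bsub>S\<^esub>"
    and swap: "\<And>b. b \<in> carrier S \<Longrightarrow> ten \<one>\<^bsub>S\<^esub> b \<otimes>\<^bsub>T\<^esub> e = ten b \<one>\<^bsub>S\<^esub> \<otimes>\<^bsub>T\<^esub> e"
  shows "separable_algebra R \<iota> S"
proof -
  have collapse: "V \<otimes>\<^bsub>T\<^esub> e = ten (\<mu> V) \<one>\<^bsub>S\<^esub> \<otimes>\<^bsub>T\<^esub> e" if V: "V \<in> carrier T" for V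
  proof -
    obtain f where f: "f \<in> carrier Q" "V = tc f" using V by (auto simp: T_carrier)
    have ten0: "ten \<zero>\<^bsub>S\<^esub> \<one>\<^bsub>S\<^esub> = \<zero>\<^bsub>T\<^esub>"
      using ten_add_left[of "\<zero>\<^bsub>S\<^esub>" "\<zero>\<^bsub>S\<^esub>" "\<one>\<^bsub>S\<^esub>"] T.add.l_cancel_one'[of "ten \<zero>\<^bsub>S\<^esub> \<one>\<^bsub>S\<^esub>" "ten \<zero>\<^bsub>S\<^esub> \<one>\<^bsub>S\<^esub>"] by simp
    have tc0: "tc 0 = \<zero>\<^bsub>T\<^esub>"
      using ring_hom_add[OF tc_hom, of 0 0] ring_hom_closed[OF tc_hom, of 0] T.add.l_cancel_one'[of "tc 0" "tc 0"]
      by (simp add: Q_simps)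
    have tc_closed: "tc f \<in> carrier T" if "f \<in> carrier Q" for f by (rule ring_hom_closed[OF tc_hom that])
    have "tc f \<otimes>\<^bsub>T\<^esub> e = ten (pair_mult S f) \<one>\<^bsub>S\<^esub> \<otimes>\<^bsub>T\<^esub> e"
      using f(1)
    proof (induction f rule: Q_induct)
      case zero
      then show ?case by (simp add: pair_mult_zero ten0 tc0)
    next
      case (add f g)
      have "tc (f + g) = tc f \<oplus>\<^bsub>T\<^esub> tc g" using ring_hom_add[OF tc_hom] add(1,2) by (simp add: Q_simps(3))
      then show ?case
        using add e by (simp add: pair_mult_add ten_add_left pair_mult_closed T.l_distr tc_closed)
    next
      case (pure a b)
      have "tc (pm a b) = ten a \<one>\<^bsub>S\<^esub> \<otimes>\<^bsub>T\<^esub> ten \<one>\<^bsub>S\<^esub> b"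
        using pure by (simp add: ten_mult) (simp add: ten_def)
      then have "tc (pm a b) \<otimes>\<^bsub>T\<^esub> e = ten a \<one>\<^bsub>S\<^esub> \<otimes>\<^bsub>T\<^esub> (ten b \<one>\<^bsub>S\<^esub> \<otimes>\<^bsub>T\<^esub> e)"
        using pure e swap by (simp add: T.m_assoc)
      also have "\<dots> = ten (a \<otimes>\<^bsub>S\<^esub> b) \<one>\<^bsub>S\<^esub> \<otimes>\<^bsub>T\<^esub> e"
        using pure e by (simp add: T.m_assoc[symmetric] ten_mult)
      finally show ?case using pure by (simp add: pair_mult_pm)
    next
      case (uminus f)
      have "tc (- f) \<otimes>\<^bsub>T\<^esub> e \<oplus>\<^bsub>T\<^esub> tc f \<otimes>\<^bsub>T\<^esub> e = tc (- f + f) \<otimes>\<^bsub>T\<^esub> e"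
        using uminus e ring_hom_add[OF tc_hom, of "- f" f]
        by (simp add: Q_simps(3) Q_uminus_closed T.l_distr tc_closed)
      also have "\<dots> = ten (pair_mult S (- f) \<oplus>\<^bsub>S\<^esub> pair_mult S f) \<one>\<^bsub>S\<^esub> \<otimes>\<^bsub>T\<^esub> e"
        using uminus e by (simp add: tc0 ten0 pair_mult_uminus pair_mult_closed S.l_neg)
      also have "\<dots> = ten (pair_mult S (- f)) \<one>\<^bsub>S\<^esub> \<otimes>\<^bsub>T\<^esub> e \<oplus>\<^bsub>T\<^esub> tc f \<otimes>\<^bsub>T\<^esub> e"
        using uminus e by (simp add: ten_add_left pair_mult_closed Q_uminus_closed T.l_distr)
      finally show ?case
        using uminus(1) e by (simp add: tc_closed Q_uminus_closed pair_mult_closed)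
    qed
    then show ?thesis using f by (simp add: \<mu>_tc)
  qed
  \<comment> \<open>One arbitrary label serves as a basis of the free module of rank one.\<close>
  let ?B = "{undefined :: 's}"
  let ?F = "free_module T ?B"
  define j where "j s = (\<lambda>b\<in>?B. ten s \<one>\<^bsub>S\<^esub> \<otimes>\<^bsub>T\<^esub> e)" for s
  define q where "q f = \<mu> (f (undefined :: 's))" for f :: "'s \<Rightarrow> ('s \<times> 's \<Rightarrow>\<^sub>0 int) set"
  have smult: "ten (\<mu> V \<otimes>\<^bsub>S\<^esub> x) \<one>\<^bsub>S\<^esub> \<otimes>\<^bsub>T\<^esub> e = V \<otimes>\<^bsub>T\<^esub> (ten x \<one>\<^bsub>S\<^esub> \<otimes>\<^bsub>T\<^esub> e)"
    if "V \<in> carrier T" "x \<in> carrier S" for V x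
    using that e collapse[of "V \<otimes>\<^bsub>T\<^esub> ten x \<one>\<^bsub>S\<^esub>"]
    by (simp add: ring_hom_mult[OF \<mu>_hom] T.m_assoc)
  have "j \<in> linear_maps T M ?F"
    using e ring_hom_closed[OF \<mu>_hom]
    by (simp add: linear_maps_def j_def free_module_def M_simps ten_add_left T.l_distr fun_eq_iff smult)
  moreover have "q \<in> linear_maps T ?F M"
    by (auto simp: linear_maps_def q_def free_module_def M_simps PiE_iff
        ring_hom_closed[OF \<mu>_hom] ring_hom_add[OF \<mu>_hom] ring_hom_mult[OF \<mu>_hom])
  moreover have "q (j x) = x" if "x \<in> carrier M" for x
    using that e by (simp add: q_def j_def M_simps ring_hom_mult[OF \<mu>_hom] \<mu>e)
  ultimately show ?thesis
    unfolding separable_algebra_def projective_module_def using M_module by blast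
qed

end

subsection \<open>Separability of root extensions\<close>

context root_extension
begin

lemma emb_add_pow: "r \<in> carrier R \<Longrightarrow> emb (add_pow R (n::nat) r) = add_pow S n (emb r)"
proof (induction n)
  case 0
  interpret h: ring_hom_ring R S emb
    by (intro ring_hom_ringI2 R.ring_axioms cring.axioms(1)[OF S_cring] emb_hom)
  show ?case by (simp add: add_pow_def)
next
  case (Suc n)
  interpret S: cring S by (rule S_cring)
  have "emb (add_pow R (Suc n) r) = emb (add_pow R n r \<oplus> r)" by (simp add: add_pow_def)
  also have "\<dots> = emb (add_pow R n r) \<oplus>\<^bsub>S\<^esub> emb r"
    using Suc.prems by (intro ring_hom_add[OF emb_hom] R.add.nat_pow_closed)
  finally show ?case using Suc by (simp add: add_pow_def)
qed

text \<open>Here r plays the role of 1/p and t' that of 1/t, so that the separability idempotent can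
  be written down over any base ring containing both.\<close>

theorem separable:
  assumes t': "t' \<in> carrier R" "t \<otimes> t' = \<one>" and r: "r \<in> carrier R" "add_pow R p r = \<one>"
  shows "separable_algebra R emb S"
proof -
  interpret S: cring S by (rule S_cring)
  interpret C: comm_algebra S R emb
    by (intro comm_algebra.intro comm_algebra_axioms.intro S_cring R.cring_axioms emb_hom)
  interpret \<mu>: ring_hom_cring "tensor_square R emb S" S C.\<mu>
    by (intro ring_hom_cringI C.T_cring S_cring C.\<mu>_hom)
  let ?T = "tensor_square R emb S"
  let ?c = "emb r"
  obtain n where n: "p = Suc n" using p_pos by (cases p) auto
  \<comment> \<open>The inverse of \<open>rt\<close>, obtained from rt * rt^(p-1) = t.\<close>
  define \<tau>' where "\<tau>' = emb t' \<otimes>\<^bsub>S\<^esub> rt [^]\<^bsub>S\<^esub> n"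
  have \<tau>'_closed [simp]: "\<tau>' \<in> carrier S" using t' by (simp add: \<tau>'_def)
  have rt_p: "rt [^]\<^bsub>S\<^esub> p = rt [^]\<^bsub>S\<^esub> n \<otimes>\<^bsub>S\<^esub> rt"
    using S.nat_pow_Suc[of rt n] unfolding n[symmetric] .
  have "rt \<otimes>\<^bsub>S\<^esub> \<tau>' = emb t' \<otimes>\<^bsub>S\<^esub> rt [^]\<^bsub>S\<^esub> p" using t' by (simp add: \<tau>'_def rt_p S.m_ac)
  also have "\<dots> = emb (t \<otimes> t')" unfolding rt_power
    using ring_hom_mult[OF emb_hom t_closed t'(1)] S.m_comm[of "emb t'" "emb t"] t'(1) by simp
  also have "\<dots> = \<one>\<^bsub>S\<^esub>" using t' by (simp add: ring_hom_one[OF emb_hom])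
  finally have inv: "rt \<otimes>\<^bsub>S\<^esub> \<tau>' = \<one>\<^bsub>S\<^esub>" .
  have c: "?c \<in> carrier S" using r by simp
  define e where "e = (\<Oplus>\<^bsub>?T\<^esub>i\<in>{..n}. C.ten (?c \<otimes>\<^bsub>S\<^esub> rt [^]\<^bsub>S\<^esub> i) (\<tau>' [^]\<^bsub>S\<^esub> i))"
  have e: "e \<in> carrier ?T" unfolding e_def using c by (intro C.T.finsum_closed) auto
  have "C.\<mu> e = (\<Oplus>\<^bsub>S\<^esub>i\<in>{..n}. ?c)"
    unfolding e_def
  proof (subst \<mu>.hom_finsum)
    show "(\<Oplus>\<^bsub>S\<^esub>i\<in>{..n}. (C.\<mu> \<circ> (\<lambda>i. C.ten (?c \<otimes>\<^bsub>S\<^esub> rt [^]\<^bsub>S\<^esub> i) (\<tau>' [^]\<^bsub>S\<^esub> i))) i) = (\<Oplus>\<^bsub>S\<^esub>i\<in>{..n}. ?c)"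
    proof (rule S.finsum_cong')
      fix i :: nat
      have "?c \<otimes>\<^bsub>S\<^esub> rt [^]\<^bsub>S\<^esub> i \<otimes>\<^bsub>S\<^esub> \<tau>' [^]\<^bsub>S\<^esub> i = ?c \<otimes>\<^bsub>S\<^esub> (rt \<otimes>\<^bsub>S\<^esub> \<tau>') [^]\<^bsub>S\<^esub> i"
        unfolding S.nat_pow_distrib[OF rt_closed \<tau>'_closed]
        by (rule S.m_assoc[OF c S.nat_pow_closed[OF rt_closed] S.nat_pow_closed[OF \<tau>'_closed]])
      then show "(C.\<mu> \<circ> (\<lambda>i. C.ten (?c \<otimes>\<^bsub>S\<^esub> rt [^]\<^bsub>S\<^esub> i) (\<tau>' [^]\<^bsub>S\<^esub> i))) i = ?c"
        using c by (simp add: inv)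
    qed (use c in auto)
  qed (use c in auto)
  also have "\<dots> = add_pow S (card {..n}) ?c" using S.add.finprod_const[OF c, of "{..n}"] .
  also have "card {..n} = p" by (simp add: n)
  also have "add_pow S p ?c = \<one>\<^bsub>S\<^esub>" using r by (simp add: ring_hom_one[OF emb_hom] flip: emb_add_pow)
  finally have \<mu>e: "C.\<mu> e = \<one>\<^bsub>S\<^esub>" .
  \<comment> \<open>The elements whose two actions on e coincide are closed under sums and products;
    as the base and \<open>rt\<close> are among them, they exhaust S.\<close>
  define good where "good b \<longleftrightarrow> b \<in> carrier S \<and> C.ten \<one>\<^bsub>S\<^esub> b \<otimes>\<^bsub>?T\<^esub> e = C.ten b \<one>\<^bsub>S\<^esub> \<otimes>\<^bsub>?T\<^esub> e" for b
  have good_add: "good (a \<oplus>\<^bsub>S\<^esub> b)" if "good a" "good b" for a b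
    using that e by (simp add: good_def C.ten_add_left C.ten_add_right C.T.l_distr)
  have good_mult: "good (a \<otimes>\<^bsub>S\<^esub> b)" if "good a" "good b" for a b
  proof -
    have ab: "a \<in> carrier S" "b \<in> carrier S" using that by (auto simp: good_def)
    have "C.ten \<one>\<^bsub>S\<^esub> (a \<otimes>\<^bsub>S\<^esub> b) \<otimes>\<^bsub>?T\<^esub> e = C.ten \<one>\<^bsub>S\<^esub> a \<otimes>\<^bsub>?T\<^esub> (C.ten \<one>\<^bsub>S\<^esub> b \<otimes>\<^bsub>?T\<^esub> e)"
      using ab e by (simp add: C.ten_mult flip: C.T.m_assoc)
    also have "\<dots> = C.ten \<one>\<^bsub>S\<^esub> a \<otimes>\<^bsub>?T\<^esub> (C.ten b \<one>\<^bsub>S\<^esub> \<otimes>\<^bsub>?T\<^esub> e)" using that by (simp add: good_def)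
    also have "\<dots> = C.ten b \<one>\<^bsub>S\<^esub> \<otimes>\<^bsub>?T\<^esub> (C.ten \<one>\<^bsub>S\<^esub> a \<otimes>\<^bsub>?T\<^esub> e)"
      using ab e by (simp add: C.T.m_lcomm)
    also have "\<dots> = C.ten b \<one>\<^bsub>S\<^esub> \<otimes>\<^bsub>?T\<^esub> (C.ten a \<one>\<^bsub>S\<^esub> \<otimes>\<^bsub>?T\<^esub> e)" using that by (simp add: good_def)
    also have "\<dots> = C.ten (a \<otimes>\<^bsub>S\<^esub> b) \<one>\<^bsub>S\<^esub> \<otimes>\<^bsub>?T\<^esub> e"
      using ab e by (simp add: C.ten_mult S.m_comm flip: C.T.m_assoc)
    finally show ?thesis using ab by (simp add: good_def)
  qed
  have good_emb: "good (emb a)" if "a \<in> carrier R" for a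
    using that C.ten_scalar[of a "\<one>\<^bsub>S\<^esub>" "\<one>\<^bsub>S\<^esub>"] by (simp add: good_def)
  have good_rt: "good rt"
  proof -
    \<comment> \<open>The terms of e multiplied by 1 \<otimes> rt are a 0, ..., a n, whereas
      multiplication by rt \<otimes> 1 yields a 1, ..., a (n+1). The two sums differ only in their
      end terms.\<close>
    define a where "a i = C.ten (?c \<otimes>\<^bsub>S\<^esub> rt [^]\<^bsub>S\<^esub> i) (\<tau>' [^]\<^bsub>S\<^esub> i \<otimes>\<^bsub>S\<^esub> rt)" for i :: nat
    have a_closed: "a i \<in> carrier ?T" for i using c by (simp add: a_def)
    have a_Suc: "a (Suc i) = C.ten (?c \<otimes>\<^bsub>S\<^esub> rt [^]\<^bsub>S\<^esub> i \<otimes>\<^bsub>S\<^esub> rt) (\<tau>' [^]\<^bsub>S\<^esub> i)" for i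
    proof -
      have "\<tau>' [^]\<^bsub>S\<^esub> Suc i \<otimes>\<^bsub>S\<^esub> rt = \<tau>' [^]\<^bsub>S\<^esub> i \<otimes>\<^bsub>S\<^esub> (rt \<otimes>\<^bsub>S\<^esub> \<tau>')" by (simp add: S.m_ac)
      then show ?thesis using c by (simp add: a_def inv S.m_assoc)
    qed
    have distr: "V \<otimes>\<^bsub>?T\<^esub> e =
        (\<Oplus>\<^bsub>?T\<^esub>i\<in>{..n}. V \<otimes>\<^bsub>?T\<^esub> C.ten (?c \<otimes>\<^bsub>S\<^esub> rt [^]\<^bsub>S\<^esub> i) (\<tau>' [^]\<^bsub>S\<^esub> i))"
      if "V \<in> carrier ?T" for V
      unfolding e_def using c that by (intro C.T.finsum_rdistr) auto
    have "C.ten \<one>\<^bsub>S\<^esub> rt \<otimes>\<^bsub>?T\<^esub> e = (\<Oplus>\<^bsub>?T\<^esub>i\<in>{..n}. a i)"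
    proof (subst distr)
      show "(\<Oplus>\<^bsub>?T\<^esub>i\<in>{..n}. C.ten \<one>\<^bsub>S\<^esub> rt \<otimes>\<^bsub>?T\<^esub> C.ten (?c \<otimes>\<^bsub>S\<^esub> rt [^]\<^bsub>S\<^esub> i) (\<tau>' [^]\<^bsub>S\<^esub> i)) =
          (\<Oplus>\<^bsub>?T\<^esub>i\<in>{..n}. a i)"
        by (rule C.T.finsum_cong') (use c a_closed in \<open>simp_all add: C.ten_mult a_def S.m_comm\<close>)
    qed simp
    moreover have "C.ten rt \<one>\<^bsub>S\<^esub> \<otimes>\<^bsub>?T\<^esub> e = (\<Oplus>\<^bsub>?T\<^esub>i\<in>{..n}. a (Suc i))"
    proof (subst distr)
      show "(\<Oplus>\<^bsub>?T\<^esub>i\<in>{..n}. C.ten rt \<one>\<^bsub>S\<^esub> \<otimes>\<^bsub>?T\<^esub> C.ten (?c \<otimes>\<^bsub>S\<^esub> rt [^]\<^bsub>S\<^esub> i) (\<tau>' [^]\<^bsub>S\<^esub> i)) =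
          (\<Oplus>\<^bsub>?T\<^esub>i\<in>{..n}. a (Suc i))"
        unfolding a_Suc by (rule C.T.finsum_cong') (use c in \<open>simp_all add: C.ten_mult S.m_ac\<close>)
    qed simp
    \<comment> \<open>As \<open>Suc n\<close> is p, the left factor contains rt^p = t, which passes
      through the tensor sign and cancels the p-th power of \<tau>' on the right.\<close>
    moreover have "a (Suc n) = a 0"
    proof -
      have "rt [^]\<^bsub>S\<^esub> p \<otimes>\<^bsub>S\<^esub> \<tau>' [^]\<^bsub>S\<^esub> p = (rt \<otimes>\<^bsub>S\<^esub> \<tau>') [^]\<^bsub>S\<^esub> p" by (rule S.nat_pow_distrib[symmetric]) simp_all
      then have one: "emb t \<otimes>\<^bsub>S\<^esub> \<tau>' [^]\<^bsub>S\<^esub> p = \<one>\<^bsub>S\<^esub>" by (simp add: inv rt_power)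
      have "a p = C.ten (emb t \<otimes>\<^bsub>S\<^esub> ?c) (\<tau>' [^]\<^bsub>S\<^esub> p \<otimes>\<^bsub>S\<^esub> rt)"
        unfolding a_def rt_power using c by (simp add: S.m_comm)
      also have "\<dots> = C.ten ?c (emb t \<otimes>\<^bsub>S\<^esub> (\<tau>' [^]\<^bsub>S\<^esub> p \<otimes>\<^bsub>S\<^esub> rt))"
        using c by (intro C.ten_scalar) simp_all
      also have "emb t \<otimes>\<^bsub>S\<^esub> (\<tau>' [^]\<^bsub>S\<^esub> p \<otimes>\<^bsub>S\<^esub> rt) = rt"
        by (simp add: one flip: S.m_assoc)
      finally show ?thesis using c by (simp add: a_def n[symmetric])
    qed
    moreover have "(\<Oplus>\<^bsub>?T\<^esub>i\<in>{..n}. a i) = (\<Oplus>\<^bsub>?T\<^esub>i\<in>{..n}. a (Suc i))"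
    proof -
      let ?s = "\<Oplus>\<^bsub>?T\<^esub>i\<in>{..n}. a i" and ?s' = "\<Oplus>\<^bsub>?T\<^esub>i\<in>{..n}. a (Suc i)"
      have cl: "?s \<in> carrier ?T" "?s' \<in> carrier ?T" using a_closed by (auto intro!: C.T.finsum_closed)
      have "(\<Oplus>\<^bsub>?T\<^esub>i\<in>{..Suc n}. a i) = a (Suc n) \<oplus>\<^bsub>?T\<^esub> ?s"
        using a_closed by (intro C.T.finsum_Suc) auto
      moreover have "(\<Oplus>\<^bsub>?T\<^esub>i\<in>{..Suc n}. a i) = ?s' \<oplus>\<^bsub>?T\<^esub> a 0"
        using a_closed by (intro C.T.finsum_Suc2) auto
      ultimately have "a 0 \<oplus>\<^bsub>?T\<^esub> ?s = a 0 \<oplus>\<^bsub>?T\<^esub> ?s'"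
        using \<open>a (Suc n) = a 0\<close> C.T.a_comm[OF cl(2) a_closed] by simp
      then show ?thesis using cl a_closed[of 0] by (metis C.T.a_comm C.T.add.right_cancel)
    qed
    ultimately show ?thesis by (simp add: good_def)
  qed
  have good_pow: "good (rt [^]\<^bsub>S\<^esub> (i::nat))" for i
  proof (induction i)
    case 0
    then show ?case using good_emb[OF R.one_closed] by (simp add: ring_hom_one[OF emb_hom])
  qed (simp add: good_mult good_rt)
  have "good b" if b: "b \<in> carrier S" for b
  proof -
    obtain f where f: "short f" "b = cls f" using short_rep[OF b] by blast
    have fR: "f k \<in> carrier R" for k using coeff_closed[of f] f by (simp add: coeff_eq short_def)
    have zero: "good \<zero>\<^bsub>S\<^esub>"
    proof -
      interpret h: ring_hom_ring R S emb
        by (intro ring_hom_ringI2 R.ring_axioms S.ring_axioms emb_hom)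
      show ?thesis using good_emb[OF R.zero_closed] by simp
    qed
    have "good (\<Oplus>\<^bsub>S\<^esub>i\<in>A. emb (f i) \<otimes>\<^bsub>S\<^esub> rt [^]\<^bsub>S\<^esub> i)" if "finite A" for A
      using that
    proof (induction A rule: finite_induct)
      case (insert k A)
      then show ?case
        using fR by (subst S.finsum_insert) (auto intro!: good_add good_mult good_emb good_pow)
    qed (simp add: zero)
    then show ?thesis unfolding f(2) cls_short[OF f(1)] by simp
  qed
  then have "\<And>b. b \<in> carrier S \<Longrightarrow> C.ten \<one>\<^bsub>S\<^esub> b \<otimes>\<^bsub>?T\<^esub> e = C.ten b \<one>\<^bsub>S\<^esub> \<otimes>\<^bsub>?T\<^esub> e" by (simp add: good_def)
  with e \<mu>e show ?thesis by (rule C.separable_algebraI)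
qed

end

subsection \<open>Change of the base ring\<close>

locale base_change = R: root_extension R P p t + K: root_extension K U p "h t"
  for R (structure) and P (structure) and K :: "('k, 'n) ring_scheme" (structure) and U (structure)
    and p :: nat and t :: 'a and h :: "'a \<Rightarrow> 'k" +
  assumes h_hom: "h \<in> ring_hom R K"
begin

text \<open>A union over representatives in the same form as \<open>root_proj\<close>; all its
  members coincide by \<open>proj_cls\<close>.\<close>

definition proj :: "(nat \<Rightarrow> 'a) set \<Rightarrow> (nat \<Rightarrow> 'k) set" where
  "proj Y = (\<Union>f\<in>Y. K.cls (h \<circ> f))"

lemma hom_finsum: "finite A \<Longrightarrow> (\<And>i. i \<in> A \<Longrightarrow> f i \<in> carrier R) \<Longrightarrow> h (finsum R f A) = finsum K (h \<circ> f) A"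
proof -
  assume "finite A" "\<And>i. i \<in> A \<Longrightarrow> f i \<in> carrier R"
  interpret h: ring_hom_ring R K h
    by (intro ring_hom_ringI2 R.R.ring_axioms K.R.ring_axioms h_hom)
  show ?thesis by (rule h.hom_finsum) (use \<open>\<And>i. i \<in> A \<Longrightarrow> f i \<in> carrier R\<close> in auto)
qed

lemma h_zero: "h \<zero>\<^bsub>R\<^esub> = \<zero>\<^bsub>K\<^esub>"
proof -
  interpret h: ring_hom_ring R K h
    by (intro ring_hom_ringI2 R.R.ring_axioms K.R.ring_axioms h_hom)
  show ?thesis by simp
qed

lemma P_carrier: "carrier P = up R" "carrier U = up K"
  unfolding R.P_def K.P_def UP_def by (simp_all only: partial_object.select_convs)

lemma map_closed:
  assumes "f \<in> carrier P"
  shows "h \<circ> f \<in> carrier U"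
proof -
  have f: "f k \<in> carrier R" for k using R.coeff_closed[OF assms, of k] assms by (simp add: R.coeff_eq)
  obtain n where "\<forall>m>n. f m = \<zero>\<^bsub>R\<^esub>" using R.carrier_bound[OF assms] by blast
  then have "bound \<zero>\<^bsub>K\<^esub> n (h \<circ> f)" by (auto simp: bound_def h_zero)
  then show ?thesis unfolding P_carrier using f ring_hom_closed[OF h_hom] by (intro mem_upI) auto
qed

lemma map_hom: "(\<lambda>f. h \<circ> f) \<in> ring_hom P U"
proof (rule ring_hom_memI)
  fix f g assume fg: "f \<in> carrier P" "g \<in> carrier P"
  show "h \<circ> f \<in> carrier U" by (rule map_closed[OF fg(1)])
  have f: "f k \<in> carrier R" and g: "g k \<in> carrier R" for k
    using R.coeff_closed[OF fg(1), of k] R.coeff_closed[OF fg(2), of k] fg by (simp_all add: R.coeff_eq)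
  have U: "h \<circ> f \<in> carrier U" "h \<circ> g \<in> carrier U" using fg map_closed by auto
  show "h \<circ> (f \<otimes>\<^bsub>P\<^esub> g) = (h \<circ> f) \<otimes>\<^bsub>U\<^esub> (h \<circ> g)"
  proof
    fix n
    have "(h \<circ> (f \<otimes>\<^bsub>P\<^esub> g)) n = h (up_ring.coeff P (f \<otimes>\<^bsub>P\<^esub> g) n)"
      using fg by (simp add: R.coeff_eq)
    also have "\<dots> = h (\<Oplus>\<^bsub>R\<^esub>i\<in>{..n}. f i \<otimes>\<^bsub>R\<^esub> g (n - i))"
      using fg by (simp add: R.coeff_eq[OF fg(1)] R.coeff_eq[OF fg(2)])
    also have "\<dots> = (\<Oplus>\<^bsub>K\<^esub>i\<in>{..n}. h (f i) \<otimes>\<^bsub>K\<^esub> h (g (n - i)))"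
      using f g ring_hom_closed[OF h_hom]
      by (subst hom_finsum) (auto intro!: K.R.finsum_cong' simp: ring_hom_mult[OF h_hom])
    also have "\<dots> = up_ring.coeff U ((h \<circ> f) \<otimes>\<^bsub>U\<^esub> (h \<circ> g)) n"
      using U by (simp add: K.coeff_eq[OF U(1)] K.coeff_eq[OF U(2)])
    also have "\<dots> = ((h \<circ> f) \<otimes>\<^bsub>U\<^esub> (h \<circ> g)) n"
      using U by (simp add: K.coeff_eq)
    finally show "(h \<circ> (f \<otimes>\<^bsub>P\<^esub> g)) n = ((h \<circ> f) \<otimes>\<^bsub>U\<^esub> (h \<circ> g)) n" .
  qed
  show "h \<circ> (f \<oplus>\<^bsub>P\<^esub> g) = (h \<circ> f) \<oplus>\<^bsub>U\<^esub> (h \<circ> g)"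
  proof
    fix n
    have "(h \<circ> (f \<oplus>\<^bsub>P\<^esub> g)) n = h (up_ring.coeff P (f \<oplus>\<^bsub>P\<^esub> g) n)"
      using fg by (simp add: R.coeff_eq)
    also have "\<dots> = h (f n) \<oplus>\<^bsub>K\<^esub> h (g n)"
      using fg f g by (simp add: R.coeff_eq[OF fg(1)] R.coeff_eq[OF fg(2)] ring_hom_add[OF h_hom])
    also have "\<dots> = up_ring.coeff U ((h \<circ> f) \<oplus>\<^bsub>U\<^esub> (h \<circ> g)) n"
      using U by (simp add: K.coeff_eq[OF U(1)] K.coeff_eq[OF U(2)])
    also have "\<dots> = ((h \<circ> f) \<oplus>\<^bsub>U\<^esub> (h \<circ> g)) n"
      using U by (simp add: K.coeff_eq)
    finally show "(h \<circ> (f \<oplus>\<^bsub>P\<^esub> g)) n = ((h \<circ> f) \<oplus>\<^bsub>U\<^esub> (h \<circ> g)) n" .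
  qed
next
  have "\<one>\<^bsub>P\<^esub> = (\<lambda>n. if n = 0 then \<one>\<^bsub>R\<^esub> else \<zero>\<^bsub>R\<^esub>)" "\<one>\<^bsub>U\<^esub> = (\<lambda>n. if n = 0 then \<one>\<^bsub>K\<^esub> else \<zero>\<^bsub>K\<^esub>)"
    unfolding R.P_def K.P_def UP_def by simp_all
  then show "h \<circ> \<one>\<^bsub>P\<^esub> = \<one>\<^bsub>U\<^esub>" by (auto simp: fun_eq_iff h_zero ring_hom_one[OF h_hom])
qed

lemma map_monom: "a \<in> carrier R \<Longrightarrow> h \<circ> up_ring.monom P a n = up_ring.monom U (h a) n"
  using ring_hom_closed[OF h_hom] unfolding R.P_def K.P_def UP_def by (auto simp: fun_eq_iff h_zero)

lemma map_ideal:
  assumes "q \<in> root_ideal R p t"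
  shows "h \<circ> q \<in> root_ideal K p (h t)"
proof -
  interpret m: ring_hom_cring P U "\<lambda>f. h \<circ> f"
    by (intro ring_hom_cringI R.P.cring_axioms K.P.cring_axioms map_hom)
  have "h \<circ> R.minpol = K.minpol"
  proof -
    have "h \<circ> R.minpol = (h \<circ> up_ring.monom P \<one>\<^bsub>R\<^esub> p) \<ominus>\<^bsub>U\<^esub> (h \<circ> up_ring.monom P t 0)"
      unfolding R.minpol_def R.P.minus_eq K.P.minus_eq by simp
    then show ?thesis by (simp add: map_monom K.minpol_def ring_hom_one[OF h_hom])
  qed
  moreover obtain a where "a \<in> carrier P" "q = a \<otimes>\<^bsub>P\<^esub> R.minpol"
    using assms unfolding R.I_eq cgenideal_def by blast
  ultimately have "h \<circ> q = (h \<circ> a) \<otimes>\<^bsub>U\<^esub> K.minpol" "h \<circ> a \<in> carrier U"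
    using m.hom_mult[of a R.minpol] map_closed by simp_all
  then show ?thesis unfolding K.I_eq cgenideal_def by blast
qed

lemma proj_cls:
  assumes f: "f \<in> carrier P"
  shows "proj (R.cls f) = K.cls (h \<circ> f)"
proof -
  interpret I: ideal "root_ideal R p t" P by (rule R.I_ideal)
  have "K.cls (h \<circ> f') = K.cls (h \<circ> f)" if f': "f' \<in> R.cls f" for f'
  proof -
    obtain q where q: "q \<in> root_ideal R p t" "f' = q \<oplus>\<^bsub>P\<^esub> f"
      using f' unfolding R.cls_def a_r_coset_def' by blast
    have qP: "q \<in> carrier P" by (rule I.Icarr[OF q(1)])
    have "h \<circ> f' = (h \<circ> q) \<oplus>\<^bsub>U\<^esub> (h \<circ> f)"
      unfolding q(2) by (rule ring_hom_add[OF map_hom qP f])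
    then have "K.cls (h \<circ> f') = K.cls (h \<circ> q) \<oplus>\<^bsub>root_ext K p (h t)\<^esub> K.cls (h \<circ> f)"
      using ring_hom_add[OF K.cls_hom map_closed[OF qP] map_closed[OF f]] by simp
    also have "K.cls (h \<circ> q) = K.cls \<zero>\<^bsub>U\<^esub>"
      using map_ideal[OF q(1)] map_closed[OF qP] by (subst K.cls_eq_iff) (simp_all add: K.P.minus_eq)
    also have "\<dots> \<oplus>\<^bsub>root_ext K p (h t)\<^esub> K.cls (h \<circ> f) = K.cls (h \<circ> f)"
      using ring_hom_add[OF K.cls_hom K.P.zero_closed map_closed[OF f]] map_closed[OF f] by simp
    finally show ?thesis .
  qed
  moreover have "f \<in> R.cls f"
    unfolding R.cls_def using f by (rule I.a_rcos_self)
  ultimately show ?thesis unfolding proj_def by blast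
qed

lemma proj_hom: "proj \<in> ring_hom (root_ext R p t) (root_ext K p (h t))"
proof (rule ring_hom_memI)
  fix a b assume "a \<in> carrier (root_ext R p t)" "b \<in> carrier (root_ext R p t)"
  then obtain f g where fg: "f \<in> carrier P" "g \<in> carrier P" "a = R.cls f" "b = R.cls g"
    unfolding R.S_carrier by blast
  show "proj a \<in> carrier (root_ext K p (h t))" using fg by (simp add: proj_cls map_closed)
  have "a \<otimes>\<^bsub>root_ext R p t\<^esub> b = R.cls (f \<otimes>\<^bsub>P\<^esub> g)" "a \<oplus>\<^bsub>root_ext R p t\<^esub> b = R.cls (f \<oplus>\<^bsub>P\<^esub> g)"
    using fg ring_hom_mult[OF R.cls_hom] ring_hom_add[OF R.cls_hom] by simp_all
  then show "proj (a \<otimes>\<^bsub>root_ext R p t\<^esub> b) = proj a \<otimes>\<^bsub>root_ext K p (h t)\<^esub> proj b"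
    "proj (a \<oplus>\<^bsub>root_ext R p t\<^esub> b) = proj a \<oplus>\<^bsub>root_ext K p (h t)\<^esub> proj b"
    using fg by (simp_all add: proj_cls map_closed ring_hom_mult[OF map_hom] ring_hom_add[OF map_hom]
        ring_hom_mult[OF K.cls_hom] ring_hom_add[OF K.cls_hom])
next
  show "proj \<one>\<^bsub>root_ext R p t\<^esub> = \<one>\<^bsub>root_ext K p (h t)\<^esub>"
    using ring_hom_one[OF R.cls_hom] ring_hom_one[OF K.cls_hom] proj_cls[OF R.P.one_closed] ring_hom_one[OF map_hom]
    by simp
qed

lemma proj_emb: "a \<in> carrier R \<Longrightarrow> proj (root_emb R p t a) = root_emb K p (h t) (h a)"
  by (simp add: R.emb_eq K.emb_eq proj_cls map_monom)

lemma proj_rt: "proj R.rt = K.rt"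
  by (simp add: R.rt_def K.rt_def proj_cls map_monom ring_hom_one[OF h_hom])

lemma map_short: "R.short f \<Longrightarrow> K.short (h \<circ> f)"
  by (auto simp: R.short_def K.short_def map_closed h_zero)

end

section \<open>The adelic extension\<close>

text \<open>The two additional clauses translate integrality, as used for adeles, and the valuation,
  as used for \<open>Ram\<close>, into orders of Laurent series.\<close>

lemma local_field_fls:
  fixes X :: "('i::finite, 'k::field) ppoint set"
  assumes "nonsingular_projective_curve X" "x \<in> X"
  shows "\<exists>E :: 'k fls \<Rightarrow> _. fls_copy (local_field X x) E \<and>
    (\<forall>h. E h \<in> frac_of (complete_local_ring X x) ` carrier (complete_local_ring X x) \<longleftrightarrow> fls_subdegree h \<ge> 0) \<and>
    (\<forall>h. h \<noteq> 0 \<longrightarrow> frac_val (complete_local_ring X x) (E h) = fls_subdegree h)"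
proof -
  obtain E :: "'k fps \<Rightarrow> _" where "fps_copy (complete_local_ring X x) E"
    using local_field_laurent[OF assms] by blast
  then interpret F: fps_copy "complete_local_ring X x" E .
  have "fls_copy (frac_field (complete_local_ring X x)) F.FE"
    by (rule fls_copy.intro[OF F.FE_inj F.K_carrier F.FE_add F.FE_mult F.FE_zero F.FE_one])
  then show ?thesis
    unfolding local_field_def using F.frac_of_range F.frac_val_FE by blast
qed

text \<open>The zero series has subdegree 0 by convention and thus counts as integral without a
  separate case.\<close>

lemma fls_nonneg_iff: "fls_subdegree h \<ge> 0 \<longleftrightarrow> (\<exists>f. h = fps_to_fls f)"
proof
  assume "fls_subdegree h \<ge> 0"
  then have "h = fps_to_fls (fls_regpart h)" by (simp add: fls_regpart_to_fls_trivial)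
  then show "\<exists>f. h = fps_to_fls f" ..
qed (auto simp: fls_subdegree_fls_to_fps_gt0)

lemma fls_nonneg_add:
  assumes "fls_subdegree f \<ge> 0" "fls_subdegree g \<ge> 0"
  shows "fls_subdegree (f + g) \<ge> 0"
proof -
  obtain u v where "f = fps_to_fls u" "g = fps_to_fls v" using assms by (auto simp: fls_nonneg_iff)
  then have "f + g = fps_to_fls (u + v)" by simp
  then show ?thesis unfolding fls_nonneg_iff ..
qed

lemma fls_nonneg_mult:
  assumes "fls_subdegree f \<ge> 0" "fls_subdegree g \<ge> 0"
  shows "fls_subdegree (f * g :: 'k::field fls) \<ge> 0"
proof -
  obtain u v where "f = fps_to_fls u" "g = fps_to_fls v" using assms by (auto simp: fls_nonneg_iff)
  then have "f * g = fps_to_fls (u * v)" by (simp add: fls_times_fps_to_fls)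
  then show ?thesis unfolding fls_nonneg_iff ..
qed

locale adele_extension =
  fixes X :: "('i::finite, 'k::alg_closed_field) ppoint set" and p :: nat and t :: "('i, 'k) adele"
  assumes X: "nonsingular_projective_curve X" and prime: "prime p" and p_char: "p \<noteq> CHAR('k)"
    and t_unit: "t \<in> Units (adele_ring X)"
begin

abbreviation (input) AR where "AR \<equiv> adele_ring X"
abbreviation (input) LF where "LF x \<equiv> local_field X x"
abbreviation (input) S where "S \<equiv> root_ext (adele_ring X) p t"
abbreviation (input) emb where "emb \<equiv> root_emb (adele_ring X) p t"
abbreviation (input) Aut where "Aut \<equiv> alg_aut_group (adele_ring X) emb S"
abbreviation (input) pj where "pj x \<equiv> root_proj X p t x"

definition E :: "('i, 'k) ppoint \<Rightarrow> 'k fls \<Rightarrow> ('i, 'k) local_elem" where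
  "E x = (SOME E. fls_copy (LF x) E \<and>
    (\<forall>h. E h \<in> frac_of (complete_local_ring X x) ` carrier (complete_local_ring X x) \<longleftrightarrow> fls_subdegree h \<ge> 0) \<and>
    (\<forall>h. h \<noteq> 0 \<longrightarrow> frac_val (complete_local_ring X x) (E h) = fls_subdegree h))"

lemma E:
  assumes "x \<in> X"
  shows "fls_copy (LF x) (E x)"
    and "E x h \<in> frac_of (complete_local_ring X x) ` carrier (complete_local_ring X x) \<longleftrightarrow> fls_subdegree h \<ge> 0"
    and "h \<noteq> 0 \<Longrightarrow> frac_val (complete_local_ring X x) (E x h) = fls_subdegree h"
  using someI_ex[OF local_field_fls[OF X assms]] unfolding E_def[symmetric] by blast+

text \<open>Coordinates on the adeles: ring operations become pointwise operations on families of
  Laurent series, subject to finitely many poles.\<close>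

definition mk :: "(('i, 'k) ppoint \<Rightarrow> 'k fls) \<Rightarrow> ('i, 'k) adele" where
  "mk u = (\<lambda>x\<in>X. E x (u x))"

abbreviation (input) fin :: "(('i, 'k) ppoint \<Rightarrow> 'k fls) \<Rightarrow> bool" where
  "fin u \<equiv> finite {x \<in> X. fls_subdegree (u x) < 0}"

lemma mk_mem: "mk u \<in> carrier AR \<longleftrightarrow> fin u"
proof -
  have "mk u \<in> (\<Pi>\<^sub>E x\<in>X. carrier (LF x))"
    using fls_copy.carrier_eq[OF E(1)] by (auto simp: mk_def)
  moreover have "{x \<in> X. mk u x \<notin> frac_of (complete_local_ring X x) ` carrier (complete_local_ring X x)} =
      {x \<in> X. fls_subdegree (u x) < 0}"
    using E(2) by (auto simp: mk_def not_le)
  ultimately show ?thesis by (simp add: adele_ring_def)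
qed

lemma mk_cases:
  assumes "\<alpha> \<in> carrier AR"
  shows "\<exists>u. \<alpha> = mk u \<and> fin u"
proof -
  have \<alpha>: "\<alpha> \<in> (\<Pi>\<^sub>E x\<in>X. carrier (LF x))" using assms by (simp add: adele_ring_def)
  have "\<exists>v. \<alpha> x = E x v" if "x \<in> X" for x
  proof -
    have "\<alpha> x \<in> carrier (LF x)" using \<alpha> that by (simp add: PiE_iff)
    then show ?thesis unfolding fls_copy.carrier_eq[OF E(1)[OF that]] by blast
  qed
  then obtain u where u: "\<And>x. x \<in> X \<Longrightarrow> \<alpha> x = E x (u x)" by metis
  then have "\<alpha> = mk u" using \<alpha> by (intro extensionalityI[of _ X]) (auto simp: mk_def PiE_def)
  with mk_mem[of u] assms show ?thesis by blast
qed

lemma mk_eq_iff: "mk u = mk v \<longleftrightarrow> (\<forall>x\<in>X. u x = v x)"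
proof
  assume *: "mk u = mk v"
  show "\<forall>x\<in>X. u x = v x"
  proof
    fix x assume x: "x \<in> X"
    then have "E x (u x) = E x (v x)" using fun_cong[OF *, of x] by (simp add: mk_def)
    then show "u x = v x" using fls_copy.inj[OF E(1)[OF x]] by (auto dest: injD)
  qed
qed (simp add: mk_def cong: restrict_cong)

lemma mk_ops:
  "mk u \<oplus>\<^bsub>AR\<^esub> mk v = mk (\<lambda>x. u x + v x)" "mk u \<otimes>\<^bsub>AR\<^esub> mk v = mk (\<lambda>x. u x * v x)"
  "\<zero>\<^bsub>AR\<^esub> = mk (\<lambda>_. 0)" "\<one>\<^bsub>AR\<^esub> = mk (\<lambda>_. 1)"
  using fls_copy.E_add[OF E(1)] fls_copy.E_mult[OF E(1)] fls_copy.E_zero[OF E(1)] fls_copy.E_one[OF E(1)]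
  by (auto simp: adele_ring_def mk_def fun_eq_iff)

lemma fin_add: "fin u \<Longrightarrow> fin v \<Longrightarrow> fin (\<lambda>x. u x + v x)"
proof -
  assume "fin u" "fin v"
  moreover have "{x \<in> X. fls_subdegree (u x + v x) < 0} \<subseteq> {x \<in> X. fls_subdegree (u x) < 0} \<union> {x \<in> X. fls_subdegree (v x) < 0}"
    using fls_nonneg_add by (auto simp: not_less[symmetric])
  ultimately show ?thesis by (meson finite_UnI finite_subset)
qed

lemma fin_mult: "fin u \<Longrightarrow> fin v \<Longrightarrow> fin (\<lambda>x. u x * v x)"
proof -
  assume "fin u" "fin v"
  moreover have "{x \<in> X. fls_subdegree (u x * v x) < 0} \<subseteq> {x \<in> X. fls_subdegree (u x) < 0} \<union> {x \<in> X. fls_subdegree (v x) < 0}"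
    using fls_nonneg_mult by (auto simp: not_less[symmetric])
  ultimately show ?thesis by (meson finite_UnI finite_subset)
qed

lemma AR_cring: "cring AR"
proof (rule cringI)
  show "abelian_group AR"
  proof (rule abelian_groupI)
    fix a b assume "a \<in> carrier AR" "b \<in> carrier AR"
    then obtain u v where "a = mk u" "b = mk v" "fin u" "fin v" using mk_cases by meson
    then show "a \<oplus>\<^bsub>AR\<^esub> b \<in> carrier AR" "a \<oplus>\<^bsub>AR\<^esub> b = b \<oplus>\<^bsub>AR\<^esub> a"
      by (simp_all add: mk_ops mk_mem fin_add add.commute)
  next
    fix a b c assume "a \<in> carrier AR" "b \<in> carrier AR" "c \<in> carrier AR"
    then obtain u v w where "a = mk u" "b = mk v" "c = mk w" using mk_cases by meson
    then show "a \<oplus>\<^bsub>AR\<^esub> b \<oplus>\<^bsub>AR\<^esub> c = a \<oplus>\<^bsub>AR\<^esub> (b \<oplus>\<^bsub>AR\<^esub> c)" by (simp add: mk_ops add.assoc)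
  next
    fix a assume "a \<in> carrier AR"
    then obtain u where a: "a = mk u" "fin u" using mk_cases by meson
    then show "\<zero>\<^bsub>AR\<^esub> \<oplus>\<^bsub>AR\<^esub> a = a" by (simp add: mk_ops)
    have "mk (\<lambda>x. - u x) \<in> carrier AR" using a by (simp add: mk_mem)
    moreover have "mk (\<lambda>x. - u x) \<oplus>\<^bsub>AR\<^esub> a = \<zero>\<^bsub>AR\<^esub>" by (simp add: a mk_ops)
    ultimately show "\<exists>b\<in>carrier AR. b \<oplus>\<^bsub>AR\<^esub> a = \<zero>\<^bsub>AR\<^esub>" by blast
  qed (simp add: mk_ops(3) mk_mem)
  show "comm_monoid AR"
  proof (rule comm_monoidI)
    fix a b assume "a \<in> carrier AR" "b \<in> carrier AR"
    then obtain u v where "a = mk u" "b = mk v" "fin u" "fin v" using mk_cases by meson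
    then show "a \<otimes>\<^bsub>AR\<^esub> b \<in> carrier AR" "a \<otimes>\<^bsub>AR\<^esub> b = b \<otimes>\<^bsub>AR\<^esub> a"
      by (simp_all add: mk_ops mk_mem fin_mult mult.commute)
  next
    fix a b c assume "a \<in> carrier AR" "b \<in> carrier AR" "c \<in> carrier AR"
    then obtain u v w where "a = mk u" "b = mk v" "c = mk w" using mk_cases by meson
    then show "a \<otimes>\<^bsub>AR\<^esub> b \<otimes>\<^bsub>AR\<^esub> c = a \<otimes>\<^bsub>AR\<^esub> (b \<otimes>\<^bsub>AR\<^esub> c)" by (simp add: mk_ops mult.assoc)
  next
    fix a assume "a \<in> carrier AR"
    then obtain u where a: "a = mk u" "fin u" using mk_cases by meson
    then show "\<one>\<^bsub>AR\<^esub> \<otimes>\<^bsub>AR\<^esub> a = a" by (simp add: mk_ops)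
  qed (simp add: mk_ops(4) mk_mem)
next
  fix a b c assume "a \<in> carrier AR" "b \<in> carrier AR" "c \<in> carrier AR"
  then obtain u v w where "a = mk u" "b = mk v" "c = mk w" using mk_cases by meson
  then show "(a \<oplus>\<^bsub>AR\<^esub> b) \<otimes>\<^bsub>AR\<^esub> c = a \<otimes>\<^bsub>AR\<^esub> c \<oplus>\<^bsub>AR\<^esub> b \<otimes>\<^bsub>AR\<^esub> c"
    by (simp add: mk_ops distrib_right)
qed

sublocale AR: cring "adele_ring X" by (rule AR_cring)

lemma p_gt_1: "p > 1" using prime by (rule prime_gt_1_nat)

lemma p_neq_0: "of_nat p \<noteq> (0 :: 'k)" by (rule of_nat_prime_neq_0[OF prime p_char])

lemma t_closed: "t \<in> carrier AR" using t_unit by (simp add: Units_def)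

sublocale rx: root_extension "adele_ring X" "UP (adele_ring X)" p t
  using p_gt_1 t_closed by unfold_locales auto

definition w :: 'k where "w = (SOME w. w ^ p = 1 \<and> w \<noteq> 1)"

lemma w: "w ^ p = 1" "w \<noteq> 1"
  using someI_ex[OF root_of_unity_exists[OF prime p_neq_0]] unfolding w_def[symmetric] by blast+

definition tl :: "('i, 'k) ppoint \<Rightarrow> 'k fls" where "tl x = the_inv (E x) (t x)"

lemma tl:
  assumes x: "x \<in> X"
  shows "E x (tl x) = t x" "tl x \<noteq> 0"
proof -
  obtain t' where t': "t' \<in> carrier AR" "t \<otimes>\<^bsub>AR\<^esub> t' = \<one>\<^bsub>AR\<^esub>" using t_unit by (auto simp: Units_def)
  obtain u v where uv: "t = mk u" "t' = mk v" using mk_cases t_closed t'(1) by meson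
  have "t x = E x (u x)" using x uv by (simp add: mk_def)
  then have tlx: "tl x = u x" unfolding tl_def using the_inv_f_f[OF fls_copy.inj[OF E(1)[OF x]]] by simp
  with \<open>t x = E x (u x)\<close> show "E x (tl x) = t x" by simp
  have "u x * v x = 1" using t'(2) x unfolding uv mk_ops mk_eq_iff by blast
  then show "tl x \<noteq> 0" using tlx by auto
qed

lemma separable: "separable_algebra AR (root_emb AR p t) (root_ext AR p t)"
proof -
  obtain t' where t': "t' \<in> carrier AR" "t \<otimes>\<^bsub>AR\<^esub> t' = \<one>\<^bsub>AR\<^esub>" using t_unit by (auto simp: Units_def)
  \<comment> \<open>The constant adele 1/p, which is integral at every point.\<close>
  let ?c = "fls_const (inverse (of_nat p :: 'k))"
  have r: "mk (\<lambda>_. ?c) \<in> carrier AR" by (simp add: mk_mem)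
  have "add_pow AR n (mk (\<lambda>_. ?c)) = mk (\<lambda>_. of_nat n * ?c)" for n :: nat
  proof (induction n)
    case (Suc n)
    have "add_pow AR (Suc n) (mk (\<lambda>_. ?c)) = add_pow AR n (mk (\<lambda>_. ?c)) \<oplus>\<^bsub>AR\<^esub> mk (\<lambda>_. ?c)"
      by (simp add: add_pow_def)
    then show ?case using Suc by (simp add: mk_ops distrib_right add.commute)
  qed (simp add: add_pow_def mk_ops)
  moreover have "of_nat p * ?c = 1" using p_neq_0 by (simp add: fls_of_nat)
  ultimately have "add_pow AR p (mk (\<lambda>_. ?c)) = \<one>\<^bsub>AR\<^esub>" by (simp add: mk_ops)
  with t' r show ?thesis by (rule rx.separable)
qed

end

section \<open>Restriction of the adelic extension to one point\<close>

locale adele_point = adele_extension X p t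
  for X :: "('i::finite, 'k::alg_closed_field) ppoint set" and p t +
  fixes x :: "('i, 'k) ppoint"
  assumes x: "x \<in> X"
begin

lemma kummer: "kummer (local_field X x) (E x) w p (tl x)"
  using w p_neq_0 tl[OF x] prime
  by (intro kummer.intro E(1)[OF x] root_of_unity.intro kummer_axioms.intro)

sublocale k: kummer "local_field X x" "E x" w p "tl x"
  rewrites "E x (tl x) = t x"
  by (rule kummer) (rule tl(1)[OF x])

lemma eval_hom: "(\<lambda>\<alpha>. \<alpha> x) \<in> ring_hom (adele_ring X) (local_field X x)"
  using x by (auto simp: ring_hom_def adele_ring_def PiE_iff)

sublocale b: base_change "adele_ring X" "UP (adele_ring X)" "local_field X x" "UP (local_field X x)" p t "\<lambda>\<alpha>. \<alpha> x"
  by (intro base_change.intro base_change_axioms.intro rx.root_extension_axioms k.rx.root_extension_axioms eval_hom)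

abbreviation (input) Sx where "Sx \<equiv> root_ext (local_field X x) p (t x)"
abbreviation (input) embx where "embx \<equiv> root_emb (local_field X x) p (t x)"
abbreviation (input) Autx where "Autx \<equiv> alg_aut_group (local_field X x) embx Sx"

lemma root_proj_eq: "root_proj X p t x = b.proj"
  by (simp add: fun_eq_iff root_proj_def b.proj_def k.rx.cls_def comp_def)

text \<open>Extension by zero yields an adele because integrality can fail at x only.\<close>

lemma delta_closed:
  assumes "c \<in> carrier (local_field X x)"
  shows "(\<lambda>y\<in>X. if y = x then c else \<zero>\<^bsub>local_field X y\<^esub>) \<in> carrier (adele_ring X)"
proof -
  obtain v where v: "c = E x v" using assms by (auto simp: k.carrier_eq)
  have "(\<lambda>y\<in>X. if y = x then c else \<zero>\<^bsub>local_field X y\<^esub>) = mk (\<lambda>y. if y = x then v else 0)"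
    using fls_copy.E_zero[OF E(1)] by (auto simp: mk_def v fun_eq_iff)
  moreover have "finite {y \<in> X. fls_subdegree (if y = x then v else 0) < 0}"
    by (rule finite_subset[of _ "{x}"]) auto
  ultimately show ?thesis by (simp add: mk_mem)
qed

text \<open>The coefficients of a local normal form are extended by zero to the other
  points.\<close>

lemma proj_surj:
  assumes "s' \<in> carrier Sx"
  shows "\<exists>s\<in>carrier S. b.proj s = s'"
proof -
  obtain f where f: "k.rx.short f" "s' = k.rx.cls f" using k.rx.short_rep[OF assms] by blast
  define g where "g n = (\<lambda>y\<in>X. if y = x then f n else \<zero>\<^bsub>local_field X y\<^esub>)" for n :: nat
  have "g n \<in> carrier (adele_ring X)" for n
    unfolding g_def by (rule delta_closed[OF k.short_closed[OF f(1)]])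
  moreover have "g n = \<zero>\<^bsub>adele_ring X\<^esub>" if "n \<ge> p" for n
    using f(1) that by (auto simp: g_def k.rx.short_def adele_ring_def fun_eq_iff)
  ultimately have "g \<in> up (adele_ring X)"
    by (intro mem_upI) (auto simp: bound_def intro!: exI[of _ p])
  then have g: "g \<in> carrier (UP (adele_ring X))"
    unfolding UP_def by (simp only: partial_object.select_convs)
  have "(\<lambda>\<alpha>. \<alpha> x) \<circ> g = f" using x by (auto simp: g_def fun_eq_iff)
  then have "b.proj (rx.cls g) = s'" using b.proj_cls[OF g] f by simp
  with rx.cls_closed[OF g] show ?thesis by blast
qed

text \<open>The idempotent adele that cuts out the factor at x.\<close>

definition eps :: "('i, 'k) adele" where
  "eps = (\<lambda>y\<in>X. if y = x then \<one>\<^bsub>local_field X x\<^esub> else \<zero>\<^bsub>local_field X y\<^esub>)"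

lemma eps_closed: "eps \<in> carrier (adele_ring X)"
  unfolding eps_def by (rule delta_closed) simp

lemma eps_x: "eps x = \<one>\<^bsub>local_field X x\<^esub>" using x by (simp add: eps_def)

lemma eps_y: "y \<in> X \<Longrightarrow> y \<noteq> x \<Longrightarrow> eps y = \<zero>\<^bsub>local_field X y\<^esub>" by (simp add: eps_def)

end

context adele_extension
begin

lemma pt: "y \<in> X \<Longrightarrow> adele_point X p t y"
  by unfold_locales

lemma short_closed: "rx.short f \<Longrightarrow> f n \<in> carrier (adele_ring X)"
  using rx.coeff_closed[of f n] by (simp add: rx.short_def rx.coeff_eq)

lemma adele_ext: "\<alpha> \<in> carrier (adele_ring X) \<Longrightarrow> \<beta> \<in> carrier (adele_ring X) \<Longrightarrow> (\<And>x. x \<in> X \<Longrightarrow> \<alpha> x = \<beta> x) \<Longrightarrow> \<alpha> = \<beta>"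
  by (rule extensionalityI[of _ X]) (auto simp: adele_ring_def PiE_def)

text \<open>Normal forms remain normal forms at each point. Uniqueness there gives equality of all
  local coefficients, hence of the adelic ones.\<close>

lemma proj_eqI:
  assumes a: "a \<in> carrier S" and b: "b \<in> carrier S" and eq: "\<And>x. x \<in> X \<Longrightarrow> pj x a = pj x b"
  shows "a = b"
proof -
  obtain f g where f: "rx.short f" "a = rx.cls f" and g: "rx.short g" "b = rx.cls g"
    using rx.short_rep a b by meson
  have eq: "f n x = g n x" if x: "x \<in> X" for x n
  proof -
    interpret adele_point X p t x by (rule pt[OF x])
    have fg: "f \<in> carrier (UP (adele_ring X))" "g \<in> carrier (UP (adele_ring X))"
      using f g by (simp_all add: rx.short_def)
    have "k.rx.cls ((\<lambda>\<alpha>. \<alpha> x) \<circ> f) = k.rx.cls ((\<lambda>\<alpha>. \<alpha> x) \<circ> g)"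
      using eq[OF x] f g b.proj_cls[OF fg(1)] b.proj_cls[OF fg(2)] by (simp add: root_proj_eq)
    then have "(\<lambda>\<alpha>. \<alpha> x) \<circ> f = (\<lambda>\<alpha>. \<alpha> x) \<circ> g"
      by (rule k.rx.short_unique[OF b.map_short[OF f(1)] b.map_short[OF g(1)]])
    then show ?thesis by (auto simp: fun_eq_iff)
  qed
  have "f n = g n" for n
    by (rule adele_ext[OF short_closed[OF f(1)] short_closed[OF g(1)]]) (rule eq)
  then have "f = g" by (rule ext)
  then show ?thesis by (simp add: f(2) g(2))
qed

text \<open>No gluing of local elements, with its finiteness condition, is required: the constant
  coefficient of the normal form of s is already an adele and only has to agree with each local
  constant.\<close>

lemma proj_const:
  assumes s: "s \<in> carrier S" and c: "\<And>x. x \<in> X \<Longrightarrow> \<exists>a\<in>carrier (local_field X x). pj x s = root_emb (local_field X x) p (t x) a"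
  shows "\<exists>a\<in>carrier (adele_ring X). s = emb a"
proof -
  obtain f where f: "rx.short f" "s = rx.cls f" using rx.short_rep[OF s] by blast
  have fP: "f \<in> carrier (UP (adele_ring X))" using f by (simp add: rx.short_def)
  have f0: "f 0 \<in> carrier (adele_ring X)" by (rule short_closed[OF f(1)])
  show ?thesis
  proof
    show "s = emb (f 0)"
    proof (rule proj_eqI[OF s rx.emb_closed[OF f0]])
      fix x assume x: "x \<in> X"
      interpret adele_point X p t x by (rule pt[OF x])
      obtain a where a: "a \<in> carrier (local_field X x)" "pj x s = root_emb (local_field X x) p (t x) a" using c[OF x] by blast
      let ?m = "up_ring.monom (UP (local_field X x)) a 0"
      have m: "?m = (\<lambda>n. if n = 0 then a else \<zero>\<^bsub>local_field X x\<^esub>)"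
        using a(1) by (simp add: UP_def)
      have "k.rx.short ?m"
        using a(1) p_gt_1 by (simp add: k.rx.short_def k.rx.monom_closed) (simp add: m)
      moreover have "k.rx.cls ((\<lambda>\<alpha>. \<alpha> x) \<circ> f) = k.rx.cls ?m"
        using a f b.proj_cls[OF fP] by (simp add: root_proj_eq k.rx.emb_eq)
      ultimately have "(\<lambda>\<alpha>. \<alpha> x) \<circ> f = ?m" by (intro k.rx.short_unique[OF b.map_short[OF f(1)]])
      from fun_cong[OF this, of 0] have "f 0 x = a" by (simp add: m)
      then show "pj x s = pj x (emb (f 0))" using a b.proj_emb[OF f0] by (simp add: root_proj_eq)
    qed
  qed (rule f0)
qed

end

context adele_point
begin

text \<open>Having equal components at x means becoming equal after multiplication by
  \<open>emb eps\<close>. Automorphisms fix this scalar, so they preserve the relation and descend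
  to the local algebra.\<close>

lemma proj_respects:
  assumes g: "g \<in> carrier Aut" and s: "s1 \<in> carrier S" "s2 \<in> carrier S" and eq: "b.proj s1 = b.proj s2"
  shows "b.proj (g s1) = b.proj (g s2)"
proof -
  interpret S: cring S by (rule rx.S_cring)
  have hom: "g \<in> ring_hom S S" and fix_emb: "\<And>r. r \<in> carrier (adele_ring X) \<Longrightarrow> g (emb r) = emb r"
    using g alg_aut_group(2)[of S "adele_ring X" emb g] S.ring_axioms by auto
  have "emb eps \<otimes>\<^bsub>S\<^esub> s1 = emb eps \<otimes>\<^bsub>S\<^esub> s2"
  proof (rule proj_eqI)
    fix y assume y: "y \<in> X"
    interpret Y: adele_point X p t y by (rule pt[OF y])
    interpret SY: cring "root_ext (local_field X y) p (t y)" by (rule Y.k.rx.S_cring)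
    interpret hy: ring_hom_ring "local_field X y" "root_ext (local_field X y) p (t y)" "root_emb (local_field X y) p (t y)"
      by (intro ring_hom_ringI2 Y.k.K.ring_axioms SY.ring_axioms Y.k.rx.emb_hom)
    have pr: "root_proj X p t y (emb eps \<otimes>\<^bsub>S\<^esub> s) =
        root_emb (local_field X y) p (t y) (eps y) \<otimes>\<^bsub>root_ext (local_field X y) p (t y)\<^esub> root_proj X p t y s"
      if "s \<in> carrier S" for s
      unfolding Y.root_proj_eq
      using that eps_closed by (simp add: ring_hom_mult[OF Y.b.proj_hom] Y.b.proj_emb)
    show "root_proj X p t y (emb eps \<otimes>\<^bsub>S\<^esub> s1) = root_proj X p t y (emb eps \<otimes>\<^bsub>S\<^esub> s2)"
    proof (cases "y = x")
      case True
      then show ?thesis using pr s eq root_proj_eq by simp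
    next
      case False
      have "root_proj X p t y s \<in> carrier (root_ext (local_field X y) p (t y))" if "s \<in> carrier S" for s
        unfolding Y.root_proj_eq by (rule ring_hom_closed[OF Y.b.proj_hom that])
      then show ?thesis using pr s eps_y[OF y False] by simp
    qed
  qed (use s eps_closed in auto)
  then have "emb eps \<otimes>\<^bsub>S\<^esub> g s1 = emb eps \<otimes>\<^bsub>S\<^esub> g s2"
    using ring_hom_mult[OF hom] s eps_closed fix_emb by (metis rx.emb_closed)
  then have "b.proj (emb eps \<otimes>\<^bsub>S\<^esub> g s1) = b.proj (emb eps \<otimes>\<^bsub>S\<^esub> g s2)" by simp
  moreover have "b.proj (emb eps \<otimes>\<^bsub>S\<^esub> g s) = b.proj (g s)" if "s \<in> carrier S" for s
  proof -
    interpret SX: cring Sx by (rule k.rx.S_cring)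
    have gs: "g s \<in> carrier S" by (rule ring_hom_closed[OF hom that])
    have "b.proj (emb eps \<otimes>\<^bsub>S\<^esub> g s) = embx (eps x) \<otimes>\<^bsub>Sx\<^esub> b.proj (g s)"
      using gs eps_closed by (simp add: ring_hom_mult[OF b.proj_hom] b.proj_emb)
    also have "embx (eps x) = \<one>\<^bsub>Sx\<^esub>" unfolding eps_x by (rule ring_hom_one[OF k.rx.emb_hom])
    finally show ?thesis using ring_hom_closed[OF b.proj_hom gs] by simp
  qed
  ultimately show ?thesis using s by simp
qed

lemma Aut_iff: "g \<in> carrier Aut \<longleftrightarrow> g \<in> Bij (carrier S) \<and> g \<in> ring_hom S S \<and>
    (\<forall>r\<in>carrier (adele_ring X). g (emb r) = emb r)"
  by (rule alg_aut_group(2)) (simp_all add: cring.axioms(1)[OF rx.S_cring])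

text \<open>The automorphism is carried over along the surjection by choosing preimages. Its inverse
  is carried over in the same way, which yields bijectivity.\<close>

lemma component_ex:
  assumes g: "g \<in> carrier Aut"
  shows "\<exists>h\<in>carrier Autx. \<forall>s\<in>carrier S. b.proj (g s) = h (b.proj s)"
proof -
  interpret G: group Aut
    by (rule alg_aut_group(1)) (simp_all add: cring.axioms(1)[OF rx.S_cring])
  define sec where "sec s' = (SOME s. s \<in> carrier S \<and> b.proj s = s')" for s'
  have sec: "sec s' \<in> carrier S" "b.proj (sec s') = s'" if "s' \<in> carrier Sx" for s'
    using someI_ex[of "\<lambda>s. s \<in> carrier S \<and> b.proj s = s'"] proj_surj[OF that] unfolding sec_def by blast+
  define ind where "ind g = (\<lambda>s'\<in>carrier Sx. b.proj (g (sec s')))" for g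
  have closed: "f s \<in> carrier S" if "f \<in> carrier Aut" "s \<in> carrier S" for f s
    using that ring_hom_closed unfolding Aut_iff by metis
  have pclosed: "b.proj s \<in> carrier Sx" if "s \<in> carrier S" for s
    by (rule ring_hom_closed[OF b.proj_hom that])
  have ind: "ind f (b.proj s) = b.proj (f s)" if "f \<in> carrier Aut" "s \<in> carrier S" for f s
    unfolding ind_def using proj_respects[OF that(1) sec(1) that(2)] sec(2) pclosed[OF that(2)] by simp
  have hom: "ind f \<in> ring_hom Sx Sx" if f: "f \<in> carrier Aut" for f
  proof (rule ring_hom_memI)
    have fh: "f \<in> ring_hom S S" using f Aut_iff by blast
    interpret S: cring S by (rule rx.S_cring)
    fix a b assume "a \<in> carrier Sx" "b \<in> carrier Sx"
    then obtain a' b' where ab: "a' \<in> carrier S" "b' \<in> carrier S" "a = b.proj a'" "b = b.proj b'"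
      using proj_surj by metis
    show "ind f a \<in> carrier Sx" unfolding ab ind[OF f ab(1)] by (rule pclosed[OF closed[OF f ab(1)]])
    note fab = closed[OF f ab(1)] closed[OF f ab(2)]
    have "a \<otimes>\<^bsub>Sx\<^esub> b = b.proj (a' \<otimes>\<^bsub>S\<^esub> b')"
      unfolding ab(3,4) by (rule ring_hom_mult[OF b.proj_hom ab(1,2), symmetric])
    then have "ind f (a \<otimes>\<^bsub>Sx\<^esub> b) = b.proj (f (a' \<otimes>\<^bsub>S\<^esub> b'))"
      using ind[OF f S.m_closed[OF ab(1,2)]] by simp
    also have "\<dots> = b.proj (f a') \<otimes>\<^bsub>Sx\<^esub> b.proj (f b')"
      unfolding ring_hom_mult[OF fh ab(1,2)] by (rule ring_hom_mult[OF b.proj_hom fab])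
    finally show "ind f (a \<otimes>\<^bsub>Sx\<^esub> b) = ind f a \<otimes>\<^bsub>Sx\<^esub> ind f b"
      unfolding ab(3,4) ind[OF f ab(1)] ind[OF f ab(2)] .
    have "a \<oplus>\<^bsub>Sx\<^esub> b = b.proj (a' \<oplus>\<^bsub>S\<^esub> b')"
      unfolding ab(3,4) by (rule ring_hom_add[OF b.proj_hom ab(1,2), symmetric])
    then have "ind f (a \<oplus>\<^bsub>Sx\<^esub> b) = b.proj (f (a' \<oplus>\<^bsub>S\<^esub> b'))"
      using ind[OF f S.a_closed[OF ab(1,2)]] by simp
    also have "\<dots> = b.proj (f a') \<oplus>\<^bsub>Sx\<^esub> b.proj (f b')"
      unfolding ring_hom_add[OF fh ab(1,2)] by (rule ring_hom_add[OF b.proj_hom fab])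
    finally show "ind f (a \<oplus>\<^bsub>Sx\<^esub> b) = ind f a \<oplus>\<^bsub>Sx\<^esub> ind f b"
      unfolding ab(3,4) ind[OF f ab(1)] ind[OF f ab(2)] .
  next
    have fh: "f \<in> ring_hom S S" using f Aut_iff by blast
    have "ind f (b.proj \<one>\<^bsub>S\<^esub>) = b.proj (f \<one>\<^bsub>S\<^esub>)"
      using ring.ring_simprules(6)[OF cring.axioms(1)[OF rx.S_cring]] by (intro ind[OF f])
    then show "ind f \<one>\<^bsub>Sx\<^esub> = \<one>\<^bsub>Sx\<^esub>" by (simp add: ring_hom_one[OF fh] ring_hom_one[OF b.proj_hom])
  qed
  let ?g' = "inv\<^bsub>Aut\<^esub> g"
  have g': "?g' \<in> carrier Aut" using g by simp
  have inv1: "?g' (g s) = s" and inv2: "g (?g' s) = s" if s: "s \<in> carrier S" for s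
    using alg_aut_mult[OF g' g s] alg_aut_mult[OF g g' s] G.l_inv[OF g] G.r_inv[OF g] s
      alg_aut_group(3)[of S "adele_ring X" emb] cring.axioms(1)[OF rx.S_cring] by auto
  have "bij_betw (ind g) (carrier Sx) (carrier Sx)"
  proof (rule bij_betwI[of _ _ _ "ind ?g'"])
    show "ind g \<in> carrier Sx \<rightarrow> carrier Sx" "ind ?g' \<in> carrier Sx \<rightarrow> carrier Sx"
      using ring_hom_closed[OF hom[OF g]] ring_hom_closed[OF hom[OF g']] by auto
    fix a assume "a \<in> carrier Sx"
    then obtain a' where a: "a' \<in> carrier S" "a = b.proj a'" using proj_surj by metis
    show "ind ?g' (ind g a) = a" "ind g (ind ?g' a) = a"
      unfolding a(2) ind[OF g a(1)] ind[OF g' a(1)] ind[OF g' closed[OF g a(1)]] ind[OF g closed[OF g' a(1)]]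
        inv1[OF a(1)] inv2[OF a(1)] by (rule refl)+
  qed
  moreover have "ind g (embx c) = embx c" if c: "c \<in> carrier (local_field X x)" for c
  proof -
    \<comment> \<open>A local scalar lifts to an adele supported at x, and g fixes the image of that
      adele.\<close>
    let ?a = "\<lambda>y\<in>X. if y = x then c else \<zero>\<^bsub>local_field X y\<^esub>"
    have a: "?a \<in> carrier (adele_ring X)" by (rule delta_closed[OF c])
    have "embx c = b.proj (emb ?a)" using b.proj_emb[OF a] x by simp
    moreover have "g (emb ?a) = emb ?a" using g a unfolding Aut_iff by blast
    ultimately show ?thesis using ind[OF g rx.emb_closed[OF a]] by simp
  qed
  ultimately have "ind g \<in> carrier Autx"
    using hom[OF g] unfolding k.Aut_iff by (simp add: Bij_def ind_def)
  with ind[OF g] show ?thesis by (intro bexI[of _ "ind g"]) auto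
qed

lemma component:
  assumes g: "g \<in> carrier Aut"
  shows "component X p t x g \<in> carrier Autx"
    and "s \<in> carrier S \<Longrightarrow> b.proj (g s) = component X p t x g (b.proj s)"
proof -
  let ?P = "\<lambda>h. h \<in> carrier (aut_local X p t x) \<and>
     (\<forall>s\<in>carrier (adele_root_ext X p t). root_proj X p t x (g s) = h (root_proj X p t x s))"
  have "\<exists>!h. ?P h"
  proof -
    obtain h where h: "h \<in> carrier Autx" "\<forall>s\<in>carrier S. b.proj (g s) = h (b.proj s)"
      using component_ex[OF g] by blast
    show ?thesis
      unfolding aut_local_def local_emb_def local_root_ext_def adele_root_ext_def root_proj_eq
    proof (rule ex1I[of _ h])
      fix h' assume h': "h' \<in> carrier Autx \<and> (\<forall>s\<in>carrier S. b.proj (g s) = h' (b.proj s))"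
      show "h' = h"
      proof (rule alg_aut_eqI)
        fix s assume "s \<in> carrier Sx"
        then obtain s0 where "s0 \<in> carrier S" "s = b.proj s0" using proj_surj by metis
        then show "h' s = h s" using h h' by metis
      qed (use h h' in auto)
    qed (use h in auto)
  qed
  from theI'[OF this]
  have "?P (component X p t x g)" unfolding component_def .
  then show "component X p t x g \<in> carrier Autx" "s \<in> carrier S \<Longrightarrow> b.proj (g s) = component X p t x g (b.proj s)"
    unfolding aut_local_def local_emb_def local_root_ext_def adele_root_ext_def root_proj_eq by auto
qed

lemma component_mult:
  assumes g: "g \<in> carrier Aut" and g': "g' \<in> carrier Aut"
  shows "component X p t x (g \<otimes>\<^bsub>Aut\<^esub> g') = component X p t x g \<otimes>\<^bsub>Autx\<^esub> component X p t x g'"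
proof -
  interpret G: group Aut
    by (rule alg_aut_group(1)) (simp_all add: cring.axioms(1)[OF rx.S_cring])
  note c = component(1)[OF g] component(1)[OF g']
  have gg': "g \<otimes>\<^bsub>Aut\<^esub> g' \<in> carrier Aut" using g g' by simp
  show ?thesis
  proof (rule alg_aut_eqI[OF component(1)[OF gg'] k.A.m_closed[OF c]])
    fix s assume "s \<in> carrier Sx"
    then obtain s0 where s0: "s0 \<in> carrier S" "s = b.proj s0" using proj_surj by metis
    have g's0: "g' s0 \<in> carrier S" using g' s0(1) ring_hom_closed unfolding Aut_iff by metis
    have s: "b.proj s0 \<in> carrier Sx" by (rule ring_hom_closed[OF b.proj_hom s0(1)])
    show "component X p t x (g \<otimes>\<^bsub>Aut\<^esub> g') s = (component X p t x g \<otimes>\<^bsub>Autx\<^esub> component X p t x g') s"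
      unfolding s0(2) component(2)[OF gg' s0(1), symmetric] alg_aut_mult[OF c s] alg_aut_mult[OF g g' s0(1)]
        component(2)[OF g g's0] component(2)[OF g' s0(1)] ..
  qed
qed

end

section \<open>The equivalences\<close>

context adele_point
begin

lemma \<rho>_perm_identification: "perm_identification X p t x k.\<rho>"
proof -
  have ram: "x \<in> Ram X p t \<longleftrightarrow> \<not> int p dvd fls_subdegree (tl x)"
    using E(3)[OF x tl(2)[OF x]] x by (simp add: Ram_def tl(1)[OF x])
  show ?thesis
  proof (cases "x \<in> Ram X p t")
    case True
    then show ?thesis
      using k.\<rho>_hom k.\<rho>_inj k.\<rho>_image_ramified ram
      unfolding perm_identification_def aut_local_def local_emb_def local_root_ext_def by simp
  next
    case False
    then have unram: "int p dvd fls_subdegree (tl x)" using ram by simp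
    have "k.\<rho> ` carrier Autx = carrier (sym_group p)"
      using k.\<rho>_permutes k.\<rho>_surj[OF unram] by (auto simp: sym_group_def)
    then have "k.\<rho> \<in> iso Autx (sym_group p)"
      using k.\<rho>_hom k.\<rho>_inj by (simp add: iso_def bij_betw_def)
    then show ?thesis
      using False k.split_iso[OF unram] k.split_emb[OF unram] k.split_\<rho>[OF unram]
      unfolding perm_identification_def aut_local_def local_emb_def local_root_ext_def
      by (simp del: atLeastAtMost_iff) blast
  qed
qed

text \<open>The powers of g alone already carry any index to any other, since \<rho> g is a
  p-cycle.\<close>

lemma \<rho>_transitive:
  assumes H: "subgroup H Autx" and g: "g \<in> H" "g [^]\<^bsub>Autx\<^esub> p = \<one>\<^bsub>Autx\<^esub>" "g \<noteq> \<one>\<^bsub>Autx\<^esub>"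
  shows "transitive_action (Autx\<lparr>carrier := H\<rparr>) {1..p} (\<lambda>h. \<lambda>i\<in>{1..p}. k.\<rho> h i)"
proof -
  have sub: "H \<subseteq> carrier Autx" by (rule subgroup.subset[OF H])
  have gA: "g \<in> carrier Autx" using g sub by blast
  let ?r = "\<lambda>h. \<lambda>i\<in>{1..p}. k.\<rho> h i"
  have bij: "?r h \<in> Bij {1..p}" if "h \<in> H" for h
  proof -
    have "bij_betw (k.\<rho> h) {1..p} {1..p}" using k.\<rho>_permutes that sub by (intro permutes_imp_bij) blast
    then have "bij_betw (?r h) {1..p} {1..p}" by (subst bij_betw_cong[of _ _ "k.\<rho> h"]) auto
    then show ?thesis by (simp add: Bij_def)
  qed
  have hom: "?r \<in> hom (Autx\<lparr>carrier := H\<rparr>) (BijGroup {1..p})"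
  proof (rule homI)
    fix h h' assume h: "h \<in> carrier (Autx\<lparr>carrier := H\<rparr>)" "h' \<in> carrier (Autx\<lparr>carrier := H\<rparr>)"
    then have hA: "h \<in> carrier Autx" "h' \<in> carrier Autx" using sub by auto
    have "?r (h \<otimes>\<^bsub>Autx\<^esub> h') = compose {1..p} (?r h) (?r h')"
    proof
      fix i
      show "?r (h \<otimes>\<^bsub>Autx\<^esub> h') i = compose {1..p} (?r h) (?r h') i"
        using k.\<rho>(1)[OF hA(2), of i] by (simp add: k.\<rho>_mult[OF hA] compose_def del: atLeastAtMost_iff)
    qed
    then show "?r (h \<otimes>\<^bsub>Autx\<lparr>carrier := H\<rparr>\<^esub> h') = ?r h \<otimes>\<^bsub>BijGroup {1..p}\<^esub> ?r h'"
      using h bij by (simp add: BijGroup_def)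
  qed (use bij in \<open>simp add: BijGroup_def\<close>)
  show ?thesis
  proof (intro transitive_action.intro group_action.intro group_hom.intro group_hom_axioms.intro transitive_action_axioms.intro)
    show "group (Autx\<lparr>carrier := H\<rparr>)" by (rule k.A.subgroup_imp_group[OF H])
    show "group (BijGroup {1..p})" by (rule group_BijGroup)
    fix i j assume ij: "i \<in> {1..p}" "j \<in> {1..p}"
    have "j \<in> (\<lambda>n. (k.\<rho> g ^^ n) i) ` {..<p}"
      using prime_order_perm(1)[OF prime k.\<rho>_prime_order[OF gA g(2,3)] ij(1)] ij(2) by (simp only: bij_betw_def)
    then obtain n where n: "j = (k.\<rho> g ^^ n) i" by blast
    have "g [^]\<^bsub>Autx\<^esub> n \<in> H"
      using g(1) H by (induction n) (auto intro: subgroup.one_closed subgroup.m_closed)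
    moreover have "?r (g [^]\<^bsub>Autx\<^esub> n) i = j" using ij(1) n by (simp add: k.\<rho>_pow[OF gA])
    ultimately show "\<exists>h\<in>carrier (Autx\<lparr>carrier := H\<rparr>). ?r h i = j" by auto
  qed (rule hom)
qed

text \<open>The argument works for whatever identification \<sigma> is provided: the identity acts
  trivially and cannot send 1 to 2, which is an index because p > 1.\<close>

lemma transitive_nontrivial:
  assumes "transitive_subgroup_at X p t x H"
  shows "H \<noteq> {\<one>\<^bsub>Autx\<^esub>}"
proof
  assume H: "H = {\<one>\<^bsub>Autx\<^esub>}"
  obtain \<sigma> where "transitive_action (Autx\<lparr>carrier := H\<rparr>) {1..p} (\<lambda>h. \<lambda>i\<in>{1..p}. \<sigma> h i)"
    using assms unfolding transitive_subgroup_at_def aut_local_def local_emb_def local_root_ext_def by blast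
  then interpret transitive_action "Autx\<lparr>carrier := H\<rparr>" "{1..p}" "\<lambda>h. \<lambda>i\<in>{1..p}. \<sigma> h i" .
  have i: "1 \<in> {1..p}" "2 \<in> {1..p}" using p_gt_1 by auto
  obtain g where g: "g \<in> H" "(\<lambda>i\<in>{1..p}. \<sigma> g i) 1 = 2" using unique_orbit[OF i] by auto
  have "(\<lambda>i\<in>{1..p}. i) = (\<lambda>i\<in>{1..p}. \<sigma> \<one>\<^bsub>Autx\<^esub> i)" using id_eq_one by simp
  then have "(\<lambda>i\<in>{1..p}. \<sigma> \<one>\<^bsub>Autx\<^esub> i) 1 = 1" using i(1) by (metis restrict_apply)
  then show False using g H by simp
qed

lemma component_hom: "group_hom Aut Autx (component X p t x)"
proof -
  have "group Aut" by (rule alg_aut_group(1)) (simp_all add: cring.axioms(1)[OF rx.S_cring])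
  then show ?thesis
    by (intro group_hom.intro group_hom_axioms.intro homI k.A.group_axioms component(1) component_mult)
qed

end

section \<open>Subgroups of order p and the comparison of the four conditions\<close>

locale adele_subgroup = adele_extension X p t
  for X :: "('i::finite, 'k::alg_closed_field) ppoint set" and p t +
  fixes G
  assumes G: "subgroup G (alg_aut_group (adele_ring X) (root_emb (adele_ring X) p t) (root_ext (adele_ring X) p t))"
    and card_G: "card G = p"
begin

abbreviation (input) AutX where
  "AutX x \<equiv> alg_aut_group (local_field X x) (root_emb (local_field X x) p (t x)) (root_ext (local_field X x) p (t x))"
abbreviation (input) c where "c \<equiv> component X p t"

sublocale A: group Aut
  by (rule alg_aut_group(1)) (simp_all add: cring.axioms(1)[OF rx.S_cring])

lemma G_sub: "g \<in> G \<Longrightarrow> g \<in> carrier Aut"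
  using subgroup.subset[OF G] by blast

lemma G_fin: "finite G"
  using card_G p_gt_1 by (intro card_ge_0_finite) simp

lemma G_pow_p:
  assumes g: "g \<in> G"
  shows "g [^]\<^bsub>Aut\<^esub> p = \<one>\<^bsub>Aut\<^esub>"
proof -
  interpret GG: group "Aut\<lparr>carrier := G\<rparr>" by (rule A.subgroup_imp_group[OF G])
  have "g [^]\<^bsub>Aut\<lparr>carrier := G\<rparr>\<^esub> order (Aut\<lparr>carrier := G\<rparr>) = \<one>\<^bsub>Aut\<lparr>carrier := G\<rparr>\<^esub>"
    using g by (intro GG.pow_order_eq_1) simp
  then show ?thesis using A.nat_pow_consistent[of g p G] by (simp add: order_def card_G)
qed

lemma G_powers:
  assumes g: "g \<in> G" "g \<noteq> \<one>\<^bsub>Aut\<^esub>" and g': "g' \<in> G"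
  shows "\<exists>n::nat. g' = g [^]\<^bsub>Aut\<^esub> n"
proof -
  have gA: "g \<in> carrier Aut" by (rule G_sub[OF g(1)])
  have "A.ord g dvd p" using A.pow_eq_id[OF gA] G_pow_p[OF g(1)] by blast
  moreover have "A.ord g \<noteq> 1" using A.ord_eq_1[OF gA] g(2) by blast
  ultimately have ord: "A.ord g = p" using prime by (auto simp: prime_nat_iff)
  have "inj_on (\<lambda>n. g [^]\<^bsub>Aut\<^esub> n) {0..p - 1}" using A.ord_inj[OF gA] by (simp add: ord)
  moreover have "card {0..p - 1} = p" using p_gt_1 by simp
  ultimately have "card ((\<lambda>n. g [^]\<^bsub>Aut\<^esub> n) ` {0..p - 1}) = card G" by (simp add: card_image card_G)
  moreover have "g [^]\<^bsub>Aut\<^esub> n \<in> G" for n :: nat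
    using g(1) G by (induction n) (auto intro: subgroup.one_closed subgroup.m_closed)
  ultimately have "(\<lambda>n. g [^]\<^bsub>Aut\<^esub> n) ` {0..p - 1} = G"
    by (intro card_subset_eq[OF G_fin]) auto
  with g' show ?thesis by blast
qed

lemma G_nontrivial: "\<exists>g\<in>G. g \<noteq> \<one>\<^bsub>Aut\<^esub>"
proof (rule ccontr)
  assume "\<not> ?thesis"
  then have "G \<subseteq> {\<one>\<^bsub>Aut\<^esub>}" by blast
  then have "card G \<le> 1" by (metis card.empty card_insert_disjoint card_mono empty_iff finite.emptyI finite_insert One_nat_def)
  then show False using card_G p_gt_1 by simp
qed

lemma comp_hom: "x \<in> X \<Longrightarrow> group_hom Aut (AutX x) (c x)"
  by (rule adele_point.component_hom[OF pt])

lemma comp_pow_p: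
  assumes "x \<in> X" "g \<in> G"
  shows "c x g [^]\<^bsub>AutX x\<^esub> p = \<one>\<^bsub>AutX x\<^esub>"
proof -
  interpret h: group_hom Aut "AutX x" "c x" by (rule comp_hom[OF assms(1)])
  show ?thesis using h.hom_nat_pow[OF G_sub[OF assms(2)], of p] G_pow_p[OF assms(2)] by simp
qed

text \<open>The order of a component divides the prime p, so it is either p or 1.\<close>

lemma ord_comp:
  assumes x: "x \<in> X" and g: "g \<in> G"
  shows "group.ord (AutX x) (c x g) = p \<longleftrightarrow> c x g \<noteq> \<one>\<^bsub>AutX x\<^esub>"
proof -
  interpret h: group_hom Aut "AutX x" "c x" by (rule comp_hom[OF x])
  have cA: "c x g \<in> carrier (AutX x)" using G_sub[OF g] by simp
  have "h.ord (c x g) dvd p" using h.H.pow_eq_id[OF cA] comp_pow_p[OF x g] by blast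
  then have "h.ord (c x g) = 1 \<or> h.ord (c x g) = p" using prime by (auto simp: prime_nat_iff)
  then show ?thesis using h.H.ord_eq_1[OF cA] p_gt_1 by auto
qed

definition full :: bool where
  "full \<longleftrightarrow> (\<forall>g\<in>G. g \<noteq> \<one>\<^bsub>Aut\<^esub> \<longrightarrow> (\<forall>x\<in>X. c x g \<noteq> \<one>\<^bsub>AutX x\<^esub>))"

text \<open>One witness is enough: it is a power of every nontrivial element of G, so a trivial
  component of such an element would be inherited by the witness.\<close>

lemma fullI:
  assumes g: "g \<in> G" and nt: "\<And>x. x \<in> X \<Longrightarrow> c x g \<noteq> \<one>\<^bsub>AutX x\<^esub>"
  shows full
  unfolding full_def
proof (intro ballI impI notI)
  fix g' x assume g': "g' \<in> G" "g' \<noteq> \<one>\<^bsub>Aut\<^esub>" and x: "x \<in> X" and 1: "c x g' = \<one>\<^bsub>AutX x\<^esub>"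
  interpret h: group_hom Aut "AutX x" "c x" by (rule comp_hom[OF x])
  obtain n :: nat where "g = g' [^]\<^bsub>Aut\<^esub> n" using G_powers[OF g' g] by blast
  then have "c x g = \<one>\<^bsub>AutX x\<^esub>" using h.hom_nat_pow[OF G_sub[OF g'(1)], of n] 1 by simp
  with nt[OF x] show False by simp
qed

lemma X_nonempty: "X \<noteq> {}"
  using X by (simp add: nonsingular_projective_curve_def projective_variety_def)

lemma cond3_iff: "(\<exists>g\<in>G. \<forall>x\<in>X. group.ord (AutX x) (c x g) = p) \<longleftrightarrow> full"
proof
  assume "\<exists>g\<in>G. \<forall>x\<in>X. group.ord (AutX x) (c x g) = p"
  then show full using ord_comp fullI by blast
next
  assume full
  then show "\<exists>g\<in>G. \<forall>x\<in>X. group.ord (AutX x) (c x g) = p"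
    using G_nontrivial ord_comp unfolding full_def by blast
qed

lemma generator_iff:
  assumes full and g: "g \<in> G"
  shows "(\<forall>x\<in>X. group.ord (AutX x) (c x g) = p) \<longleftrightarrow> generate Aut {g} = G"
proof (cases "g = \<one>\<^bsub>Aut\<^esub>")
  case True
  \<comment> \<open>Nonemptiness of X matters here: without a point the identity would satisfy the
    order condition vacuously.\<close>
  obtain x where x: "x \<in> X" using X_nonempty by blast
  interpret h: group_hom Aut "AutX x" "c x" by (rule comp_hom[OF x])
  have "c x g = \<one>\<^bsub>AutX x\<^esub>" using True by simp
  then have "\<not> (\<forall>x\<in>X. group.ord (AutX x) (c x g) = p)" using ord_comp[OF x g] x by blast
  moreover have "card (generate Aut {g}) = 1" using True A.generate_one by simp
  then have "generate Aut {g} \<noteq> G" using card_G p_gt_1 by (metis less_irrefl)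
  ultimately show ?thesis by blast
next
  case False
  have sub: "subgroup (generate Aut {g}) Aut" using G_sub[OF g] by (intro A.generate_is_subgroup) simp
  have "g [^]\<^bsub>Aut\<^esub> n \<in> generate Aut {g}" for n :: nat
  proof (induction n)
    case (Suc n)
    then show ?case using subgroup.m_closed[OF sub Suc generate.incl[of g "{g}" Aut]] by simp
  qed (use subgroup.one_closed[OF sub] in simp)
  then have "G \<subseteq> generate Aut {g}" using G_powers[OF g False] by blast
  moreover have "generate Aut {g} \<subseteq> G" using g by (intro A.generate_subgroup_incl[OF _ G]) simp
  moreover have "\<forall>x\<in>X. group.ord (AutX x) (c x g) = p"
    using assms False ord_comp unfolding full_def by blast
  ultimately show ?thesis by blast
qed

lemma cond4_iff: "(\<forall>x\<in>X. transitive_subgroup_at X p t x (c x ` G)) \<longleftrightarrow> full"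
proof
  assume *: "\<forall>x\<in>X. transitive_subgroup_at X p t x (c x ` G)"
  obtain g where g: "g \<in> G" "g \<noteq> \<one>\<^bsub>Aut\<^esub>" using G_nontrivial by blast
  show full
  proof (rule fullI[OF g(1)])
    fix x assume x: "x \<in> X"
    interpret h: group_hom Aut "AutX x" "c x" by (rule comp_hom[OF x])
    show "c x g \<noteq> \<one>\<^bsub>AutX x\<^esub>"
    proof
      assume 1: "c x g = \<one>\<^bsub>AutX x\<^esub>"
      have "c x g' = \<one>\<^bsub>AutX x\<^esub>" if "g' \<in> G" for g'
      proof -
        obtain n :: nat where "g' = g [^]\<^bsub>Aut\<^esub> n" using G_powers[OF g \<open>g' \<in> G\<close>] by blast
        then show ?thesis using h.hom_nat_pow[OF G_sub[OF g(1)], of n] 1 by simp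
      qed
      then have "c x ` G = (\<lambda>_. \<one>\<^bsub>AutX x\<^esub>) ` G" by (rule image_cong[OF refl])
      also have "\<dots> = {\<one>\<^bsub>AutX x\<^esub>}" using g(1) by (simp add: image_constant_conv) blast
      finally have "c x ` G = {\<one>\<^bsub>AutX x\<^esub>}" .
      then show False using adele_point.transitive_nontrivial[OF pt[OF x]] * x by blast
    qed
  qed
next
  assume f: full
  show "\<forall>x\<in>X. transitive_subgroup_at X p t x (c x ` G)"
  proof
    fix x assume x: "x \<in> X"
    interpret adele_point X p t x by (rule pt[OF x])
    interpret h: group_hom Aut "AutX x" "c x" by (rule comp_hom[OF x])
    obtain g where g: "g \<in> G" "g \<noteq> \<one>\<^bsub>Aut\<^esub>" using G_nontrivial by blast
    have sub: "subgroup (c x ` G) (AutX x)" by (rule h.subgroup_img_is_subgroup[OF G])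
    have "c x g \<noteq> \<one>\<^bsub>AutX x\<^esub>" using f g x unfolding full_def by blast
    then have "transitive_action ((AutX x)\<lparr>carrier := c x ` G\<rparr>) {1..p} (\<lambda>h. \<lambda>i\<in>{1..p}. k.\<rho> h i)"
      using g(1) comp_pow_p[OF x g(1)] by (intro \<rho>_transitive[OF sub]) auto
    then show "transitive_subgroup_at X p t x (c x ` G)"
      unfolding transitive_subgroup_at_def aut_local_def local_emb_def local_root_ext_def
      by (intro conjI exI[of _ k.\<rho>] sub \<rho>_perm_identification)
  qed
qed

lemma Aut_props:
  assumes "g \<in> carrier Aut"
  shows "g \<in> ring_hom S S" "r \<in> carrier (adele_ring X) \<Longrightarrow> g (emb r) = emb r"
    "s \<in> carrier S \<Longrightarrow> g s \<in> carrier S"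
proof -
  have *: "g \<in> Bij (carrier S) \<and> g \<in> ring_hom S S \<and> (\<forall>r\<in>carrier (adele_ring X). g (emb r) = emb r)"
    using assms by (subst alg_aut_group(2)[symmetric]) (simp_all add: cring.axioms(1)[OF rx.S_cring])
  then show "g \<in> ring_hom S S" "r \<in> carrier (adele_ring X) \<Longrightarrow> g (emb r) = emb r" by blast+
  then show "s \<in> carrier S \<Longrightarrow> g s \<in> carrier S" using ring_hom_closed by metis
qed

lemma cond2_iff: "fixed_ring S G = emb ` carrier (adele_ring X) \<longleftrightarrow> full"
proof
  assume f: full
  obtain g where g: "g \<in> G" "g \<noteq> \<one>\<^bsub>Aut\<^esub>" using G_nontrivial by blast
  show "fixed_ring S G = emb ` carrier (adele_ring X)"
  proof (intro equalityI subsetI)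
    fix s assume "s \<in> fixed_ring S G"
    then have s: "s \<in> carrier S" "g s = s" using g by (auto simp: fixed_ring_def)
    have "\<exists>a\<in>carrier (adele_ring X). s = emb a"
    proof (rule proj_const[OF s(1)])
      fix x assume x: "x \<in> X"
      interpret adele_point X p t x by (rule pt[OF x])
      have nt: "c x g \<noteq> \<one>\<^bsub>AutX x\<^esub>" using f g x unfolding full_def by blast
      have "c x g (b.proj s) = b.proj s" using component(2)[OF G_sub[OF g(1)] s(1)] s(2) by simp
      then show "\<exists>a\<in>carrier (local_field X x). pj x s = root_emb (local_field X x) p (t x) a"
        unfolding root_proj_eq
        using component(1)[OF G_sub[OF g(1)]] comp_pow_p[OF x g(1)] nt ring_hom_closed[OF b.proj_hom s(1)]
        by (intro k.fixed_of_prime_order)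
    qed
    then show "s \<in> emb ` carrier (adele_ring X)" by blast
  next
    fix s assume "s \<in> emb ` carrier (adele_ring X)"
    then show "s \<in> fixed_ring S G" using Aut_props(2) G_sub by (auto simp: fixed_ring_def)
  qed
next
  assume fixed: "fixed_ring S G = emb ` carrier (adele_ring X)"
  obtain g where g: "g \<in> G" "g \<noteq> \<one>\<^bsub>Aut\<^esub>" using G_nontrivial by blast
  note gA = G_sub[OF g(1)]
  show full
  proof (rule fullI[OF g(1)], rule notI)
    fix x assume x: "x \<in> X" and 1: "c x g = \<one>\<^bsub>AutX x\<^esub>"
    interpret P: adele_point X p t x by (rule pt[OF x])
    interpret S: cring S by (rule rx.S_cring)
    \<comment> \<open>The element that is the adjoined root at x and zero at all other points. When
      the component of g at x is trivial, g fixes it although it does not come from the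
      base.\<close>
    define s where "s = emb P.eps \<otimes>\<^bsub>S\<^esub> rx.rt"
    have s: "s \<in> carrier S" using P.eps_closed by (simp add: s_def)
    have proj_s: "pj y s = root_emb (local_field X y) p (t y) (P.eps y) \<otimes>\<^bsub>root_ext (local_field X y) p (t y)\<^esub>
        root_extension.rt (local_field X y) p (t y)" if y: "y \<in> X" for y
    proof -
      interpret Y: adele_point X p t y by (rule pt[OF y])
      show ?thesis
        unfolding s_def Y.root_proj_eq
        using P.eps_closed by (simp add: ring_hom_mult[OF Y.b.proj_hom] Y.b.proj_emb Y.b.proj_rt)
    qed
    have gs: "g s = s"
    proof (rule proj_eqI[OF Aut_props(3)[OF gA s] s])
      fix y assume y: "y \<in> X"
      interpret Y: adele_point X p t y by (rule pt[OF y])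
      have cl: "Y.b.proj s \<in> carrier (root_ext (local_field X y) p (t y))"
        by (rule ring_hom_closed[OF Y.b.proj_hom s])
      have step: "pj y (g s) = c y g (pj y s)" unfolding Y.root_proj_eq by (rule Y.component(2)[OF gA s])
      show "pj y (g s) = pj y s"
      proof (cases "y = x")
        case True
        have "c y g (pj y s) = \<one>\<^bsub>AutX y\<^esub> (pj y s)" using 1 True by simp
        then show ?thesis using step cl unfolding Y.root_proj_eq by (simp add: Y.k.Aut_one)
      next
        case False
        interpret SY: cring "root_ext (local_field X y) p (t y)" by (rule Y.k.rx.S_cring)
        interpret hy: ring_hom_ring "local_field X y" "root_ext (local_field X y) p (t y)" "root_emb (local_field X y) p (t y)"
          by (intro ring_hom_ringI2 Y.k.K.ring_axioms SY.ring_axioms Y.k.rx.emb_hom)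
        have z: "pj y s = \<zero>\<^bsub>root_ext (local_field X y) p (t y)\<^esub>"
          unfolding proj_s[OF y] P.eps_y[OF y False] using Y.k.rx.rt_closed by simp
        have "c y g \<in> ring_hom (root_ext (local_field X y) p (t y)) (root_ext (local_field X y) p (t y))"
          using Y.component(1)[OF gA] Y.k.Aut_iff by blast
        then interpret hc: ring_hom_ring "root_ext (local_field X y) p (t y)" "root_ext (local_field X y) p (t y)" "c y g"
          by (intro ring_hom_ringI2 SY.ring_axioms)
        show ?thesis unfolding step z by simp
      qed
    qed
    have "g' s = s" if "g' \<in> G" for g'
    proof -
      obtain n :: nat where n: "g' = g [^]\<^bsub>Aut\<^esub> n" using G_powers[OF g \<open>g' \<in> G\<close>] by blast
      have "(g [^]\<^bsub>Aut\<^esub> n) s = s"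
      proof (induction n)
        case 0
        then show ?case
          using s alg_aut_group(3)[of S "adele_ring X" emb] by (simp add: cring.axioms(1)[OF rx.S_cring])
      next
        case (Suc n)
        then show ?case using alg_aut_mult[OF A.nat_pow_closed[OF gA] gA s] gs by simp
      qed
      with n show ?thesis by simp
    qed
    then have "s \<in> fixed_ring S G" using s by (simp add: fixed_ring_def)
    then obtain r where r: "r \<in> carrier (adele_ring X)" "s = emb r" using fixed by blast
    interpret SX: cring "root_ext (local_field X x) p (t x)" by (rule P.k.rx.S_cring)
    have "P.k.rx.rt = root_emb (local_field X x) p (t x) (r x)"
      using proj_s[OF x] P.b.proj_emb[OF r(1)] r(2) P.root_proj_eq
      by (simp add: P.eps_x ring_hom_one[OF P.k.rx.emb_hom])
    moreover have rx_mem: "r x \<in> carrier (local_field X x)" by (rule ring_hom_closed[OF P.eval_hom r(1)])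
    \<comment> \<open>Two embeddings agree on the base field, so they would agree on the root if it
      came from there; but they multiply y by different powers of W.\<close>
    ultimately have "P.k.\<phi> 1 P.k.rx.rt = P.k.\<phi> 2 P.k.rx.rt" by (simp add: P.k.\<phi>(2))
    then have "P.k.W ^ 1 = P.k.W ^ 2" using P.k.y_neq_0 by (simp add: P.k.\<phi>(3))
    then show False using P.k.W.w_power_inj[of 1 2] p_gt_1 by simp
  qed
qed

text \<open>The definition contains the condition on the fixed ring, which gives one direction. For
  the other, separability holds for every unit t, and the clause on idempotents is settled at one
  point at a time.\<close>

lemma cond1_iff:
  "galois_extension (adele_ring X) emb S (Aut\<lparr>carrier := G\<rparr>) (\<lambda>g. g) \<longleftrightarrow> full"
proof
  assume "galois_extension (adele_ring X) emb S (Aut\<lparr>carrier := G\<rparr>) (\<lambda>g. g)"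
  then show full unfolding galois_extension_def by (simp flip: cond2_iff)
next
  assume f: full
  have sep: "\<exists>s\<in>carrier S. g s \<otimes>\<^bsub>S\<^esub> e \<noteq> g' s \<otimes>\<^bsub>S\<^esub> e"
    if g: "g \<in> G" and g': "g' \<in> G" and neq: "g \<noteq> g'" and e: "e \<in> carrier S" "e \<otimes>\<^bsub>S\<^esub> e = e" "e \<noteq> \<zero>\<^bsub>S\<^esub>"
    for g g' e
  proof (rule ccontr)
    assume "\<not> ?thesis"
    then have eq: "g s \<otimes>\<^bsub>S\<^esub> e = g' s \<otimes>\<^bsub>S\<^esub> e" if "s \<in> carrier S" for s using that by blast
    interpret S: cring S by (rule rx.S_cring)
    note gA = G_sub[OF g] G_sub[OF g']
    \<comment> \<open>A nonzero idempotent has a nonzero component somewhere, and the local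
      separation result is applied at that point.\<close>
    have "\<exists>x\<in>X. pj x e \<noteq> pj x \<zero>\<^bsub>S\<^esub>" using proj_eqI[OF e(1) S.zero_closed] e(3) by blast
    then obtain x where xX: "x \<in> X" and xe: "pj x e \<noteq> pj x \<zero>\<^bsub>S\<^esub>" by blast
    interpret adele_point X p t x by (rule pt[OF xX])
    interpret h: group_hom Aut "AutX x" "c x" by (rule comp_hom[OF xX])
    interpret SX: cring "root_ext (local_field X x) p (t x)" by (rule k.rx.S_cring)
    interpret hp: ring_hom_ring S "root_ext (local_field X x) p (t x)" "b.proj"
      by (intro ring_hom_ringI2 S.ring_axioms SX.ring_axioms b.proj_hom)
    have diff: "inv\<^bsub>Aut\<^esub> g' \<otimes>\<^bsub>Aut\<^esub> g \<in> G"
      using g g' G by (intro subgroup.m_closed[OF G] subgroup.m_inv_closed[OF G])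
    have c_diff: "c x (inv\<^bsub>Aut\<^esub> g' \<otimes>\<^bsub>Aut\<^esub> g) = inv\<^bsub>AutX x\<^esub> (c x g') \<otimes>\<^bsub>AutX x\<^esub> c x g"
      using gA by simp
    have "c x g = c x g'"
    proof (rule k.idempotent_separates[OF component(1)[OF gA(1)] component(1)[OF gA(2)]])
      show "(inv\<^bsub>AutX x\<^esub> (c x g') \<otimes>\<^bsub>AutX x\<^esub> c x g) [^]\<^bsub>AutX x\<^esub> p = \<one>\<^bsub>AutX x\<^esub>"
        using comp_pow_p[OF xX diff] unfolding c_diff .
      show "b.proj e \<in> carrier (root_ext (local_field X x) p (t x))" using e(1) by simp
      show "b.proj e \<otimes>\<^bsub>root_ext (local_field X x) p (t x)\<^esub> b.proj e = b.proj e"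
        using ring_hom_mult[OF b.proj_hom e(1,1)] e(2) by simp
      show "b.proj e \<noteq> \<zero>\<^bsub>root_ext (local_field X x) p (t x)\<^esub>"
        using xe unfolding root_proj_eq by simp
      fix s' assume "s' \<in> carrier (root_ext (local_field X x) p (t x))"
      then obtain s where s: "s \<in> carrier S" "s' = b.proj s" using proj_surj by metis
      show "c x g s' \<otimes>\<^bsub>root_ext (local_field X x) p (t x)\<^esub> b.proj e =
          c x g' s' \<otimes>\<^bsub>root_ext (local_field X x) p (t x)\<^esub> b.proj e"
        unfolding s(2) component(2)[OF gA(1) s(1), symmetric] component(2)[OF gA(2) s(1), symmetric]
          ring_hom_mult[OF b.proj_hom Aut_props(3)[OF gA(1) s(1)] e(1), symmetric]
          ring_hom_mult[OF b.proj_hom Aut_props(3)[OF gA(2) s(1)] e(1), symmetric] eq[OF s(1)] ..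
    qed
    then have "c x (inv\<^bsub>Aut\<^esub> g' \<otimes>\<^bsub>Aut\<^esub> g) = \<one>\<^bsub>AutX x\<^esub>"
      unfolding c_diff using component(1)[OF gA(2)] by simp
    \<comment> \<open>Agreement at the single point x suffices, since \<open>full\<close> excludes a
      nontrivial element of G with trivial component there.\<close>
    then have "inv\<^bsub>Aut\<^esub> g' \<otimes>\<^bsub>Aut\<^esub> g = \<one>\<^bsub>Aut\<^esub>" using f diff xX unfolding full_def by blast
    then have "g = g'" using gA by (metis A.inv_closed A.inv_equality A.inv_inv)
    with neq show False by simp
  qed
  have "(\<lambda>g. g) \<in> hom (Aut\<lparr>carrier := G\<rparr>) Aut" using G_sub by (auto simp: hom_def)
  moreover have "fixed_ring S G = emb ` carrier (adele_ring X)" using f cond2_iff by blast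
  ultimately show "galois_extension (adele_ring X) emb S (Aut\<lparr>carrier := G\<rparr>) (\<lambda>g. g)"
    unfolding galois_extension_def
    using AR_cring rx.S_cring rx.emb_hom rx.emb_inj A.subgroup_imp_group[OF G] G_fin separable sep
    by simp
qed

end

theorem proposition3p59:
  fixes X :: "('i::finite, 'k::alg_closed_field) ppoint set"
    and p :: nat
    and t :: "('i, 'k) adele"
    and G :: "((nat \<Rightarrow> ('i, 'k) adele) set \<Rightarrow> (nat \<Rightarrow> ('i, 'k) adele) set) set"
  assumes "nonsingular_projective_curve X"
    and "prime p" and "p \<noteq> CHAR('k)"
    and "t \<in> Units (adele_ring X)"
    and "subgroup G (aut_adele X p t)"
    and "cyclic_group ((aut_adele X p t)\<lparr>carrier := G\<rparr>)"
    and "card G = p"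
  shows
    "let cond1 = galois_extension (adele_ring X) (adele_emb X p t) (adele_root_ext X p t)
                   ((aut_adele X p t)\<lparr>carrier := G\<rparr>) (\<lambda>g. g);
         cond2 = (fixed_ring (adele_root_ext X p t) G = adele_emb X p t ` carrier (adele_ring X));
         comps_order_p =
           (\<lambda>g. \<forall>x\<in>X. group.ord (aut_local X p t x) (component X p t x g) = p);
         cond3 = (\<exists>g\<in>G. comps_order_p g);
         cond4 = (\<forall>x\<in>X. transitive_subgroup_at X p t x (component X p t x ` G))
     in (cond1 \<longleftrightarrow> cond2) \<and> (cond2 \<longleftrightarrow> cond3) \<and> (cond3 \<longleftrightarrow> cond4) \<and>
        (cond3 \<longrightarrow> (\<forall>g\<in>G. comps_order_p g \<longleftrightarrow> generate (aut_adele X p t) {g} = G))"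
proof -
  note defs = aut_adele_def adele_emb_def adele_root_ext_def aut_local_def local_emb_def local_root_ext_def
  interpret adele_subgroup X p t G
    using assms unfolding defs
    by (intro adele_subgroup.intro adele_extension.intro adele_subgroup_axioms.intro)
  show ?thesis
    unfolding defs Let_def cond1_iff cond2_iff cond3_iff cond4_iff
    using generator_iff by blast
qed

end
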